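(* For any $c>0$ and $p>0$, there exist real numbers $\lambda_1(p,c)<1$ and $\lambda_2(p,c)>1$ such that there is an FPTAS for ${\rm Holant}(\mathcal{F}_c^{p},\Lambda_{\lambda_1(p,c),\lambda_2(p,c)})$.
   Context: A weighted Holant instance is $\Omega=(G(V,E),\{F_v\}_{v\in V},\{\lambda_e\}_{e\in E})$, where $G(V,E)$ is a graph, $F_v:\{0,1\}^{d_v}\to\mathbb{R}_{\ge 0}$ with $d_v$ the degree of $v$, and $\lambda_e\ge 0$ is the weight of edge $e$. Its partition function is $$Z(\Omega)=\sum_{\sigma:E\to\{0,1\}}\ \prod_{e\in E}\lambda_e^{\sigma(e)}\prod_{v\in V}F_v(\sigma|_{E(v)}),$$ where $E(v)$ is the set of edges incident to $v$ (an edge assigned $1$ contributes a factor $\lambda_e$, an edge assigned $0$ a factor $1$). ${\rm Holant}(\mathcal{F},\Lambda)$ is the problem of computing $Z(\Omega)$, given an instance $\Omega$ with all $F_v\in\mathcal{F}$ and all $\lambda_e\in\Lambda$. A symmetric function of arity $d$ is written $[f_0,f_1,\dots,f_d]$, with $f_i\ge 0$ its value on inputs of Hamming weight $i$. $\mathcal{F}_c$ is the set of (generalized) Fibonacci functions with parameter $c$, i.e. symmetric functions with $f_{i+2}=c f_{i+1}+f_i$ for $i=0,\dots,d-2$. $\mathcal{F}_c^{p}$ is the set of functions in $\mathcal{F}_c$ (of any arity) with $f_{i+1}\ge p f_i$ for all $i=0,\dots,d-1$. $\Lambda_{\lambda_1,\lambda_2}$ is the set of edge weights $\lambda_e$ with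 $\lambda_1\le\lambda_e\le\lambda_2$. An FPTAS is a deterministic algorithm which, given an instance of size $n$ and $\varepsilon>0$, outputs $Z'$ with $(1-\varepsilon)Z<Z'<(1+\varepsilon)Z$, where $Z$ is the correct value, in time polynomial in $n$ and $1/\varepsilon$.
   Formalization: When Z = 0 (e.g. an identically zero vertex function) the strict bounds (1-ε)Z < Z' < (1+ε)Z cannot hold; the output is then required to be exactly 0. Time is counted in unit-cost exact real arithmetic steps. *)

theory Defs
  imports Complex_Main "HOL-Library.FuncSet"
begin

section \<open>Algorithms over the reals\<close>

text \<open>
  The data of the problem are arbitrary real numbers, so the model of computation is exact real
  arithmetic at unit cost (as in the Blum--Shub--Smale model, without a floor operation). Data are
  binary trees with real leaves; programs are finite systems of first-order recursive functions in
  the style of Lisp. Every evaluation step touches a bounded number of tree nodes and costs one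
  unit, so that running times agree with those of a real RAM up to a polynomial.
\<close>

datatype val = Num real | Leaf | Node val val

primrec vsize :: "val \<Rightarrow> nat" where
  "vsize (Num r) = 1"
| "vsize Leaf = 1"
| "vsize (Node a b) = Suc (vsize a + vsize b)"

datatype aop = Add | Sub | Mul | Div

primrec arith :: "aop \<Rightarrow> real \<Rightarrow> real \<Rightarrow> real" where
  "arith Add = (+)"
| "arith Sub = (-)"
| "arith Mul = (*)"
| "arith Div = (/)"

text \<open>
  Variables are de Bruijn indices into the environment. A function has exactly one argument
  (several arguments are passed as a tree); \<open>Call f e\<close> runs the \<open>f\<close>-th function of the
  program on the value of \<open>e\<close>. In conditionals, \<open>Leaf\<close> is false and all else is true.
\<close>

datatype (lits: 'k) exp =
    Var nat
  | Lit 'k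
  | LeafE
  | NodeE "'k exp" "'k exp"
  | LeftE "'k exp"
  | RightE "'k exp"
  | Arith aop "'k exp" "'k exp"
  | LessE "'k exp" "'k exp"
  | IfE "'k exp" "'k exp" "'k exp"
  | LetE "'k exp" "'k exp"
  | Call nat "'k exp"

type_synonym prog = "real exp list"

text \<open>\<open>eval P \<rho> e v t\<close>: in environment \<open>\<rho>\<close>, the expression \<open>e\<close> evaluates to \<open>v\<close> in \<open>t\<close> steps.\<close>

inductive eval :: "prog \<Rightarrow> val list \<Rightarrow> real exp \<Rightarrow> val \<Rightarrow> nat \<Rightarrow> bool" for P where
  Var: "i < length \<rho> \<Longrightarrow> eval P \<rho> (Var i) (\<rho> ! i) 1"
| Lit: "eval P \<rho> (Lit r) (Num r) 1"
| LeafE: "eval P \<rho> LeafE Leaf 1"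
| NodeE: "eval P \<rho> e1 a s \<Longrightarrow> eval P \<rho> e2 b t \<Longrightarrow> eval P \<rho> (NodeE e1 e2) (Node a b) (s + t + 1)"
| LeftE: "eval P \<rho> e (Node a b) t \<Longrightarrow> eval P \<rho> (LeftE e) a (t + 1)"
| RightE: "eval P \<rho> e (Node a b) t \<Longrightarrow> eval P \<rho> (RightE e) b (t + 1)"
| Arith: "eval P \<rho> e1 (Num x) s \<Longrightarrow> eval P \<rho> e2 (Num y) t \<Longrightarrow>
    eval P \<rho> (Arith bop e1 e2) (Num (arith bop x y)) (s + t + 1)"
| LessE: "eval P \<rho> e1 (Num x) s \<Longrightarrow> eval P \<rho> e2 (Num y) t \<Longrightarrow>
    eval P \<rho> (LessE e1 e2) (if x < y then Num 1 else Leaf) (s + t + 1)"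
| IfE_True: "eval P \<rho> e1 b s \<Longrightarrow> b \<noteq> Leaf \<Longrightarrow> eval P \<rho> e2 v t \<Longrightarrow>
    eval P \<rho> (IfE e1 e2 e3) v (s + t + 1)"
| IfE_False: "eval P \<rho> e1 Leaf s \<Longrightarrow> eval P \<rho> e3 v t \<Longrightarrow> eval P \<rho> (IfE e1 e2 e3) v (s + t + 1)"
| LetE: "eval P \<rho> e1 a s \<Longrightarrow> eval P (a # \<rho>) e2 v t \<Longrightarrow> eval P \<rho> (LetE e1 e2) v (s + t + 1)"
| Call: "f < length P \<Longrightarrow> eval P \<rho> e a s \<Longrightarrow> eval P [a] (P ! f) v t \<Longrightarrow>
    eval P \<rho> (Call f e) v (s + t + 1)"

inductive_cases eval_elims:
  "eval P \<rho> (Var i) v t" "eval P \<rho> (Lit r) v t" "eval P \<rho> LeafE v t" "eval P \<rho> (NodeE e1 e2) v t"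
  "eval P \<rho> (LeftE e) v t" "eval P \<rho> (RightE e) v t" "eval P \<rho> (Arith bop e1 e2) v t"
  "eval P \<rho> (LessE e1 e2) v t" "eval P \<rho> (IfE e1 e2 e3) v t" "eval P \<rho> (LetE e1 e2) v t"
  "eval P \<rho> (Call f e) v t"

lemma eval_deterministic:
  assumes "eval P \<rho> e v t" "eval P \<rho> e v' t'"
  shows "v' = v \<and> t' = t"
  using assms
proof (induction arbitrary: v' t' rule: eval.induct)
  case Var
  from Var.prems show ?case
    by (rule eval_elims(1)) simp_all
next
  case Lit
  from Lit.prems show ?case
    by (rule eval_elims(2)) simp_all
next
  case LeafE
  from LeafE.prems show ?case
    by (rule eval_elims(3)) simp_all
next
  case NodeE
  from NodeE.prems show ?case
    by (rule eval_elims(4)) (metis NodeE.IH One_nat_def add_Suc_right add.right_neutral)+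
next
  case LeftE
  from LeftE.prems show ?case
    by (rule eval_elims(5)) (metis LeftE.IH val.inject One_nat_def add_Suc_right add.right_neutral)+
next
  case RightE
  from RightE.prems show ?case
    by (rule eval_elims(6)) (metis RightE.IH val.inject One_nat_def add_Suc_right add.right_neutral)+
next
  case Arith
  from Arith.prems show ?case
    by (rule eval_elims(7)) (metis Arith.IH val.inject One_nat_def add_Suc_right add.right_neutral)+
next
  case LessE
  from LessE.prems show ?case
    by (rule eval_elims(8)) (metis LessE.IH val.inject One_nat_def add_Suc_right add.right_neutral)+
next
  case IfE_True
  from IfE_True.prems show ?case
    by (rule eval_elims(9)) (metis IfE_True.IH IfE_True.hyps One_nat_def add_Suc_right add.right_neutral)+
next
  case IfE_False
  from IfE_False.prems show ?case
    by (rule eval_elims(9)) (metis IfE_False.IH One_nat_def add_Suc_right add.right_neutral)+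
next
  case LetE
  from LetE.prems show ?case
    by (rule eval_elims(10)) (metis LetE.IH One_nat_def add_Suc_right add.right_neutral)+
next
  case Call
  from Call.prems show ?case
    by (rule eval_elims(11)) (metis Call.IH One_nat_def add_Suc_right add.right_neutral)+
qed

definition runs :: "prog \<Rightarrow> val \<Rightarrow> val \<Rightarrow> nat \<Rightarrow> bool" where
  "runs P inp out t \<longleftrightarrow> P \<noteq> [] \<and> eval P [inp] (hd P) out t"

text \<open>
  \<open>(1 - \<epsilon>) Z < Z' < (1 + \<epsilon>) Z\<close> is unsatisfiable for \<open>Z = 0\<close>; as usual, the output must then be exact.
\<close>

definition rel_approx :: "real \<Rightarrow> real \<Rightarrow> real \<Rightarrow> bool" where
  "rel_approx \<epsilon> Z Z' \<longleftrightarrow> (if Z = 0 then Z' = 0 else (1 - \<epsilon>) * Z < Z' \<and> Z' < (1 + \<epsilon>) * Z)"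

text \<open>
  \<open>I\<close> is the set of instances, \<open>enc\<close> their representation as data and \<open>Z\<close> the function to be
  computed. The program may only mention rational constants and the parameters \<open>K\<close> of the problem
  (arbitrary real constants could carry nonuniform advice). Since \<open>vsize\<close> is at least 1, every
  polynomial in the size and \<open>1 / \<epsilon>\<close> is dominated by some \<open>C * (size + 1 / \<epsilon>) ^ k\<close>.
\<close>

definition has_fptas :: "real set \<Rightarrow> 'i set \<Rightarrow> ('i \<Rightarrow> val) \<Rightarrow> ('i \<Rightarrow> real) \<Rightarrow> bool" where
  "has_fptas K I enc Z \<longleftrightarrow>
    (\<exists>P. (\<Union>e\<in>set P. lits e) \<subseteq> \<rat> \<union> K \<and>
      (\<exists>(C::real) (k::nat). \<forall>\<Omega>\<in>I. \<forall>\<epsilon>>0. \<exists>Z' t.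
        runs P (Node (Num \<epsilon>) (enc \<Omega>)) (Num Z') t \<and>
        rel_approx \<epsilon> (Z \<Omega>) Z' \<and>
        real t \<le> C * (real (vsize (enc \<Omega>)) + 1 / \<epsilon>) ^ k))"


section \<open>Weighted Holant problems\<close>

text \<open>
  The vertices are \<open>0, \<dots>, nverts - 1\<close> and the edges are the positions in the list of their
  endpoints, so parallel edges are allowed. The value 1 of \<open>{0,1}\<close> is \<open>True\<close>.
\<close>

record holant =
  nverts :: nat
  edges :: "(nat \<times> nat) list"
  fn :: "nat \<Rightarrow> bool list \<Rightarrow> real"
  weight :: "nat \<Rightarrow> real"

definition incident :: "holant \<Rightarrow> nat \<Rightarrow> nat list" where
  "incident \<Omega> v =
    filter (\<lambda>e. fst (edges \<Omega> ! e) = v \<or> snd (edges \<Omega> ! e) = v) [0..<length (edges \<Omega>)]"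

definition degree :: "holant \<Rightarrow> nat \<Rightarrow> nat" where
  "degree \<Omega> v = length (incident \<Omega> v)"

text \<open>Loops are excluded, so that the degree of \<open>v\<close> is the number of edges incident to \<open>v\<close>.\<close>

definition wf_holant :: "holant \<Rightarrow> bool" where
  "wf_holant \<Omega> \<longleftrightarrow>
    (\<forall>(u, v)\<in>set (edges \<Omega>). u < nverts \<Omega> \<and> v < nverts \<Omega> \<and> u \<noteq> v) \<and>
    (\<forall>v<nverts \<Omega>. \<forall>x. length x = degree \<Omega> v \<longrightarrow> 0 \<le> fn \<Omega> v x) \<and>
    (\<forall>e<length (edges \<Omega>). 0 \<le> weight \<Omega> e)"

definition partition_function :: "holant \<Rightarrow> real" where
  "partition_function \<Omega> =
    (\<Sum>\<sigma>\<in>{..<length (edges \<Omega>)} \<rightarrow>\<^sub>E (UNIV :: bool set).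
      (\<Prod>e<length (edges \<Omega>). weight \<Omega> e ^ of_bool (\<sigma> e)) *
      (\<Prod>v<nverts \<Omega>. fn \<Omega> v (map \<sigma> (incident \<Omega> v))))"

text \<open>
  A pair \<open>(d, F)\<close> stands for the restriction of \<open>F\<close> to \<open>{0,1}\<^sup>d\<close>, i.e. to lists of length \<open>d\<close>.
\<close>

type_synonym bfun = "nat \<times> (bool list \<Rightarrow> real)"

definition Holant :: "bfun set \<Rightarrow> real set \<Rightarrow> holant set" where
  "Holant \<F> \<Lambda> = {\<Omega>. wf_holant \<Omega> \<and>
    (\<forall>v<nverts \<Omega>. (degree \<Omega> v, fn \<Omega> v) \<in> \<F>) \<and>
    (\<forall>e<length (edges \<Omega>). weight \<Omega> e \<in> \<Lambda>)}"

definition symmetric :: "bfun \<Rightarrow> bool" where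
  "symmetric = (\<lambda>(d, F). \<forall>x y. length x = d \<longrightarrow> length y = d \<longrightarrow>
    count_list x True = count_list y True \<longrightarrow> F x = F y)"

text \<open>The entry \<open>f\<^sub>i\<close> of a symmetric function \<open>[f\<^sub>0, \<dots>, f\<^sub>d]\<close>.\<close>

definition entry :: "bfun \<Rightarrow> nat \<Rightarrow> real" where
  "entry = (\<lambda>(d, F) i. F (replicate i True @ replicate (d - i) False))"

definition fib :: "real \<Rightarrow> bfun set" where
  "fib c = {(d, F). symmetric (d, F) \<and> (\<forall>i\<le>d. 0 \<le> entry (d, F) i) \<and>
    (\<forall>i. i + 2 \<le> d \<longrightarrow> entry (d, F) (i + 2) = c * entry (d, F) (i + 1) + entry (d, F) i)}"

definition fib_ge :: "real \<Rightarrow> real \<Rightarrow> bfun set" where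
  "fib_ge c p = {(d, F) \<in> fib c. \<forall>i<d. entry (d, F) (i + 1) \<ge> p * entry (d, F) i}"

definition edge_weights :: "real \<Rightarrow> real \<Rightarrow> real set" where
  "edge_weights l1 l2 = {x. 0 \<le> x \<and> l1 \<le> x \<and> x \<le> l2}"

text \<open>
  Representation of instances with symmetric functions: each vertex contributes its list
  \<open>[f\<^sub>0, \<dots>, f\<^sub>d]\<close>, each edge its two endpoints and its weight. The size is linear in the number of
  vertices and edges.
\<close>

definition enc_list :: "('a \<Rightarrow> val) \<Rightarrow> 'a list \<Rightarrow> val" where
  "enc_list g xs = foldr (\<lambda>x. Node (g x)) xs Leaf"

definition enc_sym :: "holant \<Rightarrow> val" where
  "enc_sym \<Omega> = Node
    (enc_list (\<lambda>v. enc_list (\<lambda>i. Num (entry (degree \<Omega> v, fn \<Omega> v) i)) [0..<degree \<Omega> v + 1])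
      [0..<nverts \<Omega>])
    (enc_list (\<lambda>e. Node (Num (real (fst (edges \<Omega> ! e))))
        (Node (Num (real (snd (edges \<Omega> ! e)))) (Num (weight \<Omega> e))))
      [0..<length (edges \<Omega>)])"

end

theory Submission imports Defs begin

text \<open>
  Let \<open>x\<close> be the positive root of \<open>x\<^sup>2 = c x + 1\<close>. A Fibonacci function is a combination of the tensor
  powers of the orthogonal vectors \<open>(1, x)\<close> and \<open>(x, -1)\<close>, so the Holant instance is a two-spin system
  on the vertices. Its interaction is a multiple of the identity when all edge weights are 1, and its
  vertex weights satisfy \<open>\<bar>r\<bar> \<le> \<kappa> x ^ (2 - d)\<close> at degree \<open>d\<close>, where \<open>\<kappa> < 1\<close> depends only on \<open>p\<close> and \<open>c\<close>. A ratio of spin sums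
  with a set of edges pinned to the second or to the first spin obeys a recurrence with three
  recursive calls. Measured against \<open>x\<close> to the number of pinned edges, errors contract by a constant
  factor at every level when the edge weights are close to 1, so logarithmic depth suffices.
  The partition function is a product of such ratios over the vertices.

  Square roots are not available, so \<open>x\<close> is replaced by an iterate of \<open>g \<mapsto> c + 1 / g\<close>. Any real \<open>x\<close> gives
  the exact expansion of the Fibonacci functions with parameter \<open>x - 1 / x\<close>, and these are close
  to the given ones if that parameter is close to \<open>c\<close>.
\<close>

subsection \<open>Spin sums and their ratios\<close>

text \<open>The factor \<open>\<kappa>\<close> comes from \<open>p\<close>. At degree
  \<open>d > 0\<close>, \<open>spin_ratio x f * x ^ d\<close> is
  \<open>x * (x * f0 - f1) / (f0 + x * f1)\<close>, which reaches \<open>x ^ 2\<close> when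
  \<open>f1 = 0\<close>; the condition \<open>f1 \<ge> p * f0\<close> keeps it below
  \<open>\<kappa> * x ^ 2\<close> for all degrees at once. The yardstick is dictated by the branch
  in which a vertex takes the second spin. There \<open>k\<close> pinned edges are traded for
  \<open>D\<close> new ones, so the remaining ratio may grow by \<open>x ^ D / x ^ k\<close>. The
  vertex weight is at most \<open>\<kappa> * x ^ 2 / x ^ (k + D)\<close>, so the net factor is
  \<open>\<kappa> * x ^ 2 / x ^ (2 * k)\<close> times inner weights, which is at most about
  \<open>\<kappa>\<close> as soon as \<open>k \<ge> 1\<close>. Hence the recursion always branches
  at a vertex with a pinned edge. The other two branches carry a mixed weight and cost only a
  multiple of \<open>s\<close>, where \<open>\<kappa> = 1 - 10 * s\<close> leaves room for them. The
  factors of the partition function start at a vertex with \<open>k = 0\<close>, where this estimate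
  fails. A separate lower bound on the ratio is carried through the induction to keep these factors
  away from 0.\<close>

text \<open>
  In \<open>(v, r, g, b)\<close>, the vertex \<open>v\<close> has weight \<open>r\<close> for the second spin; \<open>g\<close> and \<open>b\<close> are the products of the
  mixed and of the inner weights of its pinned edges. As mixed weights are small,
  \<open>g < 1\<close> holds iff \<open>v\<close> has a pinned edge.
\<close>

type_synonym elem = "nat \<times> real \<times> real \<times> real"

text \<open>\<open>G\<close> weighs pairs with different spins, \<open>B\<close> pairs in the second
  spin, and pairs in the first spin have weight 1. Each triple carries the weights of both spins of
  its vertex, because the interactions with removed vertices are absorbed there.\<close>

function spin_sum :: "(nat \<Rightarrow> nat \<Rightarrow> real) \<Rightarrow> (nat \<Rightarrow> nat \<Rightarrow> real) \<Rightarrow> (nat \<times> real \<times> real) list \<Rightarrow> real" where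
  "spin_sum G B [] = 1"
| "spin_sum G B ((v, p, i) # L) =
    p * spin_sum G B (map (\<lambda>(w, p, i). (w, p, i * G v w)) L) +
    i * spin_sum G B (map (\<lambda>(w, p, i). (w, p * G v w, i * B v w)) L)"
  by pat_completeness auto
termination by (relation "measure (\<lambda>(_, _, L). length L)") auto

text \<open>
  After \<open>u\<close> has been removed: its edges are pinned to the first spin (\<open>upd_out\<close>), pinned to the second spin
  (\<open>upd_in\<close>), or pinned to the second spin while the formerly pinned edges are pinned to the first (\<open>upd_only\<close>).
\<close>

definition upd_out :: "(nat \<Rightarrow> nat \<Rightarrow> real) \<Rightarrow> nat \<Rightarrow> elem list \<Rightarrow> elem list" where
  "upd_out G u = map (\<lambda>(w, r, g, b). (w, r * G u w, g, b))"
definition upd_in :: "(nat \<Rightarrow> nat \<Rightarrow> real) \<Rightarrow> (nat \<Rightarrow> nat \<Rightarrow> real) \<Rightarrow> nat \<Rightarrow> elem list \<Rightarrow> elem list" where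
  "upd_in G B u = map (\<lambda>(w, r, g, b). (w, r, g * G u w, b * B u w))"
definition upd_only :: "(nat \<Rightarrow> nat \<Rightarrow> real) \<Rightarrow> (nat \<Rightarrow> nat \<Rightarrow> real) \<Rightarrow> nat \<Rightarrow> elem list \<Rightarrow> elem list" where
  "upd_only G B u = map (\<lambda>(w, r, g, b). (w, r * g, G u w, B u w))"

lemma length_upd [simp]:
  "length (upd_out G u L) = length L" "length (upd_in G B u L) = length L" "length (upd_only G B u L) = length L"
  by (simp_all add: upd_out_def upd_in_def upd_only_def)

text \<open>The numerator of the ratios: all pinned edges end in the second spin. In the denominator
  \<open>sum_out\<close> they end in the first spin, so a vertex in the first spin gets the factor 1
  and one in the second spin the factor \<open>g\<close>.\<close>

definition sum_in :: "(nat \<Rightarrow> nat \<Rightarrow> real) \<Rightarrow> (nat \<Rightarrow> nat \<Rightarrow> real) \<Rightarrow> elem list \<Rightarrow> real" where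
  "sum_in G B L = spin_sum G B (map (\<lambda>(v, r, g, b). (v, g, r * b)) L)"
definition sum_out :: "(nat \<Rightarrow> nat \<Rightarrow> real) \<Rightarrow> (nat \<Rightarrow> nat \<Rightarrow> real) \<Rightarrow> elem list \<Rightarrow> real" where
  "sum_out G B L = spin_sum G B (map (\<lambda>(v, r, g, b). (v, 1, r * g)) L)"

lemma sum_in_Nil [simp]: "sum_in G B [] = 1" and sum_out_Nil [simp]: "sum_out G B [] = 1"
  by (simp_all add: sum_in_def sum_out_def)

lemma sum_in_Cons:
  "sum_in G B ((u, r, g, b) # L) = g * sum_in G B (upd_out G u L) + r * b * sum_in G B (upd_in G B u L)"
  by (simp add: sum_in_def upd_out_def upd_in_def comp_def case_prod_unfold mult_ac)

lemma sum_out_Cons: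
  "sum_out G B ((u, r, g, b) # L) = sum_out G B (upd_out G u L) + r * g * sum_in G B (upd_only G B u L)"
  by (simp add: sum_in_def sum_out_def upd_out_def upd_only_def comp_def case_prod_unfold mult_ac)

text \<open>With pinned ends in the first spin, only the product of a vertex weight and its mixed
  weights matters, and it agrees in the three lists. The three ratios of the recurrence therefore
  share one denominator.\<close>

lemma sum_out_upd:
  "sum_out G B (upd_in G B u L) = sum_out G B (upd_out G u L)"
  "sum_out G B (upd_only G B u L) = sum_out G B (upd_out G u L)"
  by (simp_all add: sum_out_def upd_out_def upd_in_def upd_only_def comp_def case_prod_unfold mult_ac)

lemma spin_sum_swap:
  assumes "\<And>u v. G u v = G v u" "\<And>u v. B u v = B v u"
  shows "spin_sum G B (e1 # e2 # L) = spin_sum G B (e2 # e1 # L)"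
proof -
  obtain u p i v p' i' where e: "e1 = (u, p, i)" "e2 = (v, p', i')"
    by (metis prod_cases3)
  show ?thesis
    unfolding e
    using assms(1)[of u v] assms(2)[of u v]
    by (simp add: comp_def case_prod_unfold algebra_simps)
qed

text \<open>Allows the recurrence to be expanded at the vertex found by \<open>pick\<close> instead
  of the head of the list.\<close>

lemma spin_sum_move:
  assumes "\<And>u v. G u v = G v u" "\<And>u v. B u v = B v u"
  shows "spin_sum G B (xs @ e # ys) = spin_sum G B (e # xs @ ys)"
proof (induction "length xs" arbitrary: xs e ys)
  case 0
  then show ?case by simp
next
  case (Suc n)
  then obtain v p i xs' where xs: "xs = (v, p, i) # xs'" "length xs' = n"
    by (metis length_Suc_conv prod_cases3)
  have "spin_sum G B (xs @ e # ys) = spin_sum G B ((v, p, i) # e # xs' @ ys)"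
    using Suc.hyps(1) xs by simp
  then show ?case
    using spin_sum_swap[OF assms] xs by simp
qed

fun pick :: "elem list \<Rightarrow> (elem \<times> elem list) option" where
  "pick [] = None"
| "pick ((v, r, g, b) # L) = (if g < 1 then Some ((v, r, g, b), L)
    else case pick L of None \<Rightarrow> None | Some (e, L') \<Rightarrow> Some (e, (v, r, g, b) # L'))"

lemma pick_SomeD:
  "pick L = Some ((u, r, g, b), L') \<Longrightarrow> \<exists>xs ys. L = xs @ (u, r, g, b) # ys \<and> L' = xs @ ys \<and> g < 1"
proof (induction L arbitrary: L' rule: pick.induct)
  case (2 v r' g' b' L)
  show ?case
  proof (cases "g' < 1")
    case True
    then show ?thesis using "2.prems" by (intro exI[of _ "[]"] exI[of _ L]) auto
  next
    case False
    then obtain L'' where "pick L = Some ((u, r, g, b), L'')" "L' = (v, r', g', b') # L''"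
      using "2.prems" by (auto split: option.splits)
    with "2.IH"[OF False] show ?thesis
      by (metis append_Cons)
  qed
qed simp

lemma pick_NoneD: "pick L = None \<Longrightarrow> (v, r, g, b) \<in> set L \<Longrightarrow> \<not> g < 1"
  by (induction L rule: pick.induct) (auto split: if_splits option.splits)

text \<open>The recurrences of \<open>sum_in\<close> and \<open>sum_out\<close>, divided by their
  common denominator. Without pinned edges the ratio is exactly 1 at every depth; otherwise the
  truncation value 0 is off by no more than the a priori bound on the ratio.\<close>

primrec ratio :: "(nat \<Rightarrow> nat \<Rightarrow> real) \<Rightarrow> (nat \<Rightarrow> nat \<Rightarrow> real) \<Rightarrow> nat \<Rightarrow> elem list \<Rightarrow> real" where
  "ratio G B 0 L = (case pick L of None \<Rightarrow> 1 | Some _ \<Rightarrow> 0)"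
| "ratio G B (Suc l) L = (case pick L of None \<Rightarrow> 1 | Some ((u, r, g, b), L') \<Rightarrow>
    (g * ratio G B l (upd_out G u L') + r * b * ratio G B l (upd_in G B u L')) /
    (1 + r * g * ratio G B l (upd_only G B u L')))"

text \<open>Telescopes \<open>sum_out\<close> for lists without pinned edges: there
  \<open>g = 1\<close>, and dividing \<open>sum_out_Cons\<close> by the sum for the tail leaves
  \<open>1 + r * N\<close> with \<open>N\<close> the ratio after \<open>upd_only\<close>.\<close>

function chain_estimate :: "(nat \<Rightarrow> nat \<Rightarrow> real) \<Rightarrow> (nat \<Rightarrow> nat \<Rightarrow> real) \<Rightarrow> nat \<Rightarrow> elem list \<Rightarrow> real" where
  "chain_estimate G B l [] = 1"
| "chain_estimate G B l ((u, r, g, b) # L) = (1 + r * ratio G B l (upd_only G B u L)) * chain_estimate G B l (upd_out G u L)"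
  by pat_completeness auto
termination by (relation "measure (\<lambda>(_, _, _, L). length L)") auto

subsection \<open>A functional evaluator\<close>

text \<open>Calls are delegated to the parameter \<open>C\<close>, so the recursion is structural
  and needs no fuel. As a set of rewrite rules it lets the simplifier run a function body and count
  its steps.\<close>

primrec exec :: "(nat \<Rightarrow> val \<Rightarrow> (val \<times> nat) option) \<Rightarrow> real exp \<Rightarrow> val list \<Rightarrow> (val \<times> nat) option" where
  "exec C (Var i) \<rho> = (if i < length \<rho> then Some (\<rho> ! i, 1) else None)"
| "exec C (Lit r) \<rho> = Some (Num r, 1)"
| "exec C LeafE \<rho> = Some (Leaf, 1)"
| "exec C (NodeE e1 e2) \<rho> = (case exec C e1 \<rho> of Some (a, s) \<Rightarrow>
    (case exec C e2 \<rho> of Some (b, t) \<Rightarrow> Some (Node a b, s + t + 1) | _ \<Rightarrow> None) | _ \<Rightarrow> None)"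
| "exec C (LeftE e) \<rho> = (case exec C e \<rho> of Some (Node a b, t) \<Rightarrow> Some (a, t + 1) | _ \<Rightarrow> None)"
| "exec C (RightE e) \<rho> = (case exec C e \<rho> of Some (Node a b, t) \<Rightarrow> Some (b, t + 1) | _ \<Rightarrow> None)"
| "exec C (Arith bop e1 e2) \<rho> = (case exec C e1 \<rho> of Some (Num x, s) \<Rightarrow>
    (case exec C e2 \<rho> of Some (Num y, t) \<Rightarrow> Some (Num (arith bop x y), s + t + 1) | _ \<Rightarrow> None) | _ \<Rightarrow> None)"
| "exec C (LessE e1 e2) \<rho> = (case exec C e1 \<rho> of Some (Num x, s) \<Rightarrow>
    (case exec C e2 \<rho> of Some (Num y, t) \<Rightarrow> Some (if x < y then Num 1 else Leaf, s + t + 1) | _ \<Rightarrow> None) | _ \<Rightarrow> None)"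
| "exec C (IfE e1 e2 e3) \<rho> = (case exec C e1 \<rho> of Some (b, s) \<Rightarrow>
    (case (if b = Leaf then exec C e3 \<rho> else exec C e2 \<rho>) of Some (v, t) \<Rightarrow> Some (v, s + t + 1) | _ \<Rightarrow> None) | _ \<Rightarrow> None)"
| "exec C (LetE e1 e2) \<rho> = (case exec C e1 \<rho> of Some (a, s) \<Rightarrow>
    (case exec C e2 (a # \<rho>) of Some (v, t) \<Rightarrow> Some (v, s + t + 1) | _ \<Rightarrow> None) | _ \<Rightarrow> None)"
| "exec C (Call f e) \<rho> = (case exec C e \<rho> of Some (a, s) \<Rightarrow>
    (case C f a of Some (v, t) \<Rightarrow> Some (v, s + t + 1) | _ \<Rightarrow> None) | _ \<Rightarrow> None)"

definition result :: "prog \<Rightarrow> nat \<Rightarrow> val \<Rightarrow> (val \<times> nat) option" where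
  "result P f a = (if f < length P \<and> (\<exists>v t. eval P [a] (P ! f) v t)
    then Some (SOME (v, t). eval P [a] (P ! f) v t) else None)"

lemma result_SomeD:
  assumes "result P f a = Some (v, t)"
  shows "f < length P" "eval P [a] (P ! f) v t"
proof -
  show "f < length P" using assms by (auto simp: result_def split: if_splits)
  have "\<exists>y. case y of (v, t) \<Rightarrow> eval P [a] (P ! f) v t"
    using assms by (auto simp: result_def split: if_splits)
  then have "case (SOME (v, t). eval P [a] (P ! f) v t) of (v, t) \<Rightarrow> eval P [a] (P ! f) v t"
    by (rule someI_ex)
  then show "eval P [a] (P ! f) v t" using assms by (auto simp: result_def split: if_splits)
qed

lemma exec_sound: "exec (result P) e \<rho> = Some (v, t) \<Longrightarrow> eval P \<rho> e v t"
proof (induction e arbitrary: \<rho> v t)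
  case (NodeE e1 e2)
  from NodeE.prems show ?case
    by (auto split: option.splits val.splits simp del: One_nat_def add_Suc_right
        intro!: eval.NodeE NodeE.IH)
next
  case (LeftE e)
  from LeftE.prems show ?case
    by (auto split: option.splits val.splits simp del: One_nat_def add_Suc_right
        intro!: eval.LeftE LeftE.IH)
next
  case (RightE e)
  from RightE.prems show ?case
    by (auto split: option.splits val.splits simp del: One_nat_def add_Suc_right
        intro!: eval.RightE RightE.IH)
next
  case (Arith bop e1 e2)
  from Arith.prems show ?case
    by (auto split: option.splits val.splits simp del: One_nat_def add_Suc_right
        intro!: eval.Arith Arith.IH)
next
  case (LetE e1 e2)
  from LetE.prems show ?case
    by (auto split: option.splits val.splits simp del: One_nat_def add_Suc_right
        intro!: eval.LetE LetE.IH)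
next
  case (Call f e)
  from Call.prems show ?case
    by (auto split: option.splits val.splits simp del: One_nat_def add_Suc_right
        intro!: eval.Call Call.IH result_SomeD)
next
  case (LessE e1 e2)
  from LessE.prems obtain x y s t' where "exec (result P) e1 \<rho> = Some (Num x, s)"
    "exec (result P) e2 \<rho> = Some (Num y, t')" "v = (if x < y then Num 1 else Leaf)" "t = s + t' + 1"
    by (auto split: option.splits val.splits)
  then show ?case by (simp only:) (intro eval.LessE LessE.IH)
next
  case (IfE e1 e2 e3)
  then obtain b s t' where 1: "exec (result P) e1 \<rho> = Some (b, s)"
    "(if b = Leaf then exec (result P) e3 \<rho> else exec (result P) e2 \<rho>) = Some (v, t')" "t = s + t' + 1"
    by (auto split: option.splits)
  show ?case
  proof (cases "b = Leaf")
    case True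
    then show ?thesis using 1 IfE.IH unfolding 1(3) by (intro eval.IfE_False) auto
  next
    case False
    then show ?thesis using 1 IfE.IH unfolding 1(3) by (intro eval.IfE_True[where b = b]) auto
  qed
qed (auto split: if_splits simp del: One_nat_def intro: eval.intros)

lemma resultI:
  assumes "f < length P" "eval P [a] (P ! f) v t"
  shows "result P f a = Some (v, t)"
proof -
  have "\<exists>v t. eval P [a] (P ! f) v t" using assms by blast
  then have "result P f a = Some (fst (SOME (v, t). eval P [a] (P ! f) v t), snd (SOME (v, t). eval P [a] (P ! f) v t))"
    using assms(1) by (simp add: result_def)
  with result_SomeD(2)[OF this] eval_deterministic[OF assms(2)] show ?thesis by simp
qed

lemma exec_complete: "eval P \<rho> e v t \<Longrightarrow> exec (result P) e \<rho> = Some (v, t)"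
  by (induction rule: eval.induct) (simp_all add: resultI)

text \<open>Soundness and completeness of \<open>exec\<close> turn the inductive semantics into one
  equation per function, in which recursive calls stay folded as \<open>result\<close>. All cost
  proofs rewrite with it once and then use the induction hypothesis.\<close>

lemma result_unfold: "f < length P \<Longrightarrow> result P f a = exec (result P) (P ! f) [a]"
proof (cases "exec (result P) (P ! f) [a]")
  case None
  assume f: "f < length P"
  have "result P f a = None"
  proof (cases "result P f a")
    case (Some r)
    then show ?thesis using None exec_complete result_SomeD(2) by (cases r) fastforce
  qed
  then show ?thesis using None by simp
next
  case (Some r)
  assume "f < length P"
  with Some exec_sound[of P "P ! f" "[a]"] show ?thesis
    by (cases r) (auto intro: resultI)
qed

subsection \<open>The program\<close>

text \<open>The contraction of an edge of weight \<open>l\<close> with different basis vectors at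
  its ends, divided by the value \<open>1 + l * (x * x)\<close> for two first spins. Orthogonality
  makes it 0 at \<open>l = 1\<close>.\<close>

definition mixed_weight :: "real \<Rightarrow> real \<Rightarrow> real" where "mixed_weight x l = (1 - l) * x / (1 + l * (x * x))"
definition inner_weight :: "real \<Rightarrow> real \<Rightarrow> real" where "inner_weight x l = (x * x + l) / (1 + l * (x * x))"

definition joins :: "nat \<times> nat \<times> real \<Rightarrow> nat \<Rightarrow> nat \<Rightarrow> bool" where
  "joins = (\<lambda>(a, b, l) u w. a = u \<and> b = w \<or> a = w \<and> b = u)"

primrec pair_mixed :: "real \<Rightarrow> (nat \<times> nat \<times> real) list \<Rightarrow> nat \<Rightarrow> nat \<Rightarrow> real" where
  "pair_mixed x [] u w = 1"
| "pair_mixed x (e # es) u w = (if joins e u w then mixed_weight x (snd (snd e)) * pair_mixed x es u w else pair_mixed x es u w)"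

primrec pair_inner :: "real \<Rightarrow> (nat \<times> nat \<times> real) list \<Rightarrow> nat \<Rightarrow> nat \<Rightarrow> real" where
  "pair_inner x [] u w = 1"
| "pair_inner x (e # es) u w = (if joins e u w then inner_weight x (snd (snd e)) * pair_inner x es u w else pair_inner x es u w)"

text \<open>If both entries vanish, then so does \<open>spin_scale\<close>, and the junk value of \<open>spin_ratio\<close> is irrelevant.\<close>

definition spin_ratio :: "real \<Rightarrow> real list \<Rightarrow> real" where
  "spin_ratio x f = (case f of f0 # f1 # _ \<Rightarrow> x * (x * f0 - f1) / (f0 + x * f1) * (1 / x ^ (length f - 1)) | _ \<Rightarrow> 0)"

text \<open>With \<open>A\<close> this scale, \<open>r\<close> the spin ratio and \<open>d\<close>
  the degree, the equation \<open>f ! i = A * (x ^ i + r * x ^ (d - i) * (- 1) ^ i)\<close> is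
  solved for \<open>i = 0\<close> and \<open>i = 1\<close>. A vertex of degree 0 is put entirely
  into the first spin.\<close>

definition spin_scale :: "real \<Rightarrow> real list \<Rightarrow> real" where
  "spin_scale x f = (case f of [] \<Rightarrow> 0 | [f0] \<Rightarrow> f0 | f0 # f1 # _ \<Rightarrow> (f0 + x * f1) / (1 + x * x))"

primrec initial_state :: "real \<Rightarrow> nat \<Rightarrow> real list list \<Rightarrow> elem list" where
  "initial_state x i [] = []"
| "initial_state x i (f # fs) = (i, spin_ratio x f, 1, 1) # initial_state x (Suc i) fs"

text \<open>The first two products restore what was divided out of the vertices and edges to
  normalise the spin system.\<close>

definition estimate :: "real \<Rightarrow> nat \<Rightarrow> real list list \<Rightarrow> (nat \<times> nat \<times> real) list \<Rightarrow> real" where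
  "estimate x l fs es = prod_list (map (spin_scale x) fs) * prod_list (map (\<lambda>(a, b, w). 1 + w * (x * x)) es) *
    chain_estimate (pair_mixed x es) (pair_inner x es) l (initial_state x 0 fs)"

definition enc_edge :: "nat \<times> nat \<times> real \<Rightarrow> val" where
  "enc_edge = (\<lambda>(a, b, w). Node (Num (real a)) (Node (Num (real b)) (Num w)))"

definition enc_elem :: "elem \<Rightarrow> val" where
  "enc_elem = (\<lambda>(v, r, g, b). Node (Num (real v)) (Node (Num r) (Node (Num g) (Num b))))"

lemma enc_list_simps [simp]:
  "enc_list g [] = Leaf" "enc_list g (a # as) = Node (g a) (enc_list g as)"
  by (simp_all add: enc_list_def)

text \<open>Unary, so that the code can test and decrement it by tree operations alone.\<close>

definition enc_depth :: "nat \<Rightarrow> val" where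
  "enc_depth l = enc_list (\<lambda>_. Leaf) (replicate l ())"

lemma enc_depth_simps [simp]:
  "enc_depth 0 = Leaf" "enc_depth (Suc l) = Node Leaf (enc_depth l)"
  by (simp_all add: enc_depth_def)

abbreviation "V0 \<equiv> Var 0"
abbreviation "V1 \<equiv> Var 1"
abbreviation "V2 \<equiv> Var 2"
abbreviation "one \<equiv> Lit (1 :: real)"
abbreviation "LL e \<equiv> LeftE (LeftE e)"
abbreviation "LR e \<equiv> LeftE (RightE e)"
abbreviation "RL e \<equiv> RightE (LeftE e)"
abbreviation "RR e \<equiv> RightE (RightE e)"
abbreviation "add \<equiv> Arith Add"
abbreviation "sub \<equiv> Arith Sub"
abbreviation "mul \<equiv> Arith Mul"
abbreviation "quot \<equiv> Arith Div"

definition len_code :: "real exp" where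
  "len_code = IfE V0 (add one (Call 1 (RightE V0))) (Lit 0)"

text \<open>A logarithm without transcendental operations: it counts the factors \<open>q\<close>
  that bring the argument down to at most 1.\<close>

definition depth_code :: "real \<Rightarrow> real exp" where
  "depth_code q = IfE (LessE one V0) (NodeE LeafE (Call 2 (mul V0 (Lit q)))) LeafE"

definition iter_code :: "real \<Rightarrow> real exp" where
  "iter_code c = IfE (LeftE V0)
    (Call 3 (NodeE (RL V0) (add (Lit c) (quot one (RightE V0))))) (RightE V0)"

text \<open>The list is a unary exponent. \<open>spin_ratio_code\<close> passes the tail of the
  entries, whose length is the degree.\<close>

definition pow_code :: "real exp" where
  "pow_code = IfE (RightE V0) (quot (Call 4 (NodeE (LeftE V0) (RR V0))) (LeftE V0)) one"

definition initial_state_code :: "real exp" where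
  "initial_state_code = IfE (RR V0)
    (NodeE (NodeE (LR V0) (NodeE (Call 6 (NodeE (LeftE V0) (LeftE (RR V0)))) (NodeE one one)))
      (Call 5 (NodeE (LeftE V0) (NodeE (add one (LR V0)) (RightE (RR V0))))))
    LeafE"

definition spin_ratio_code :: "real exp" where
  "spin_ratio_code = IfE (RR V0)
    (mul (quot (mul (LeftE V0) (sub (mul (LeftE V0) (LR V0)) (LeftE (RR V0))))
          (add (LR V0) (mul (LeftE V0) (LeftE (RR V0)))))
      (Call 4 (NodeE (LeftE V0) (RR V0))))
    (Lit 0)"

definition spin_scale_code :: "real exp" where
  "spin_scale_code = IfE (RR V0)
    (quot (add (LR V0) (mul (LeftE V0) (LeftE (RR V0)))) (add one (mul (LeftE V0) (LeftE V0))))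
    (LR V0)"

definition prodA_code :: "real exp" where
  "prodA_code = IfE (RightE V0)
    (mul (Call 7 (NodeE (LeftE V0) (LR V0))) (Call 8 (NodeE (LeftE V0) (RR V0)))) one"

definition prodM_code :: "real exp" where
  "prodM_code = IfE (RightE V0)
    (mul (add one (mul (RR (LR V0)) (mul (LeftE V0) (LeftE V0)))) (Call 9 (NodeE (LeftE V0) (RR V0)))) one"

text \<open>The product of two squared distances vanishes iff the edge joins the two vertices.\<close>

definition sq_dist :: "real exp \<Rightarrow> real exp \<Rightarrow> real exp \<Rightarrow> real exp \<Rightarrow> real exp" where
  "sq_dist a u b w = add (mul (sub a u) (sub a u)) (mul (sub b w) (sub b w))"

definition pair_code :: "real exp" where
  "pair_code = IfE (RL V0)
    (LetE (Call 10 (NodeE (NodeE (LL V0) (RightE (RL V0))) (RightE V0)))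
      (LetE (LeftE (RL V1))
        (IfE (LessE (Lit 0)
            (mul (sq_dist (LeftE V0) (LR V2) (LR V0) (RR V2)) (sq_dist (LeftE V0) (RR V2) (LR V0) (LR V2))))
          V1
          (LetE (LL V2) (LetE (RR V1)
            (NodeE
              (mul (quot (mul (sub one V0) V1) (add one (mul V0 (mul V1 V1)))) (LeftE (Var 3)))
              (mul (quot (add (mul V1 V1) V0) (add one (mul V0 (mul V1 V1)))) (RightE (Var 3)))))))))
    (NodeE one one)"

text \<open>All three updates are made in one pass, since they need the same pair weights and each
  of these costs a scan of the edges.\<close>

definition upd_code :: "real exp" where
  "upd_code = IfE (RR V0)
    (LetE (Call 10 (NodeE (LeftE V0) (NodeE (LR V0) (LL (RR V0)))))
      (LetE (Call 11 (NodeE (LeftE V1) (NodeE (LR V1) (RightE (RR V1)))))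
        (LetE (LeftE (RR V2))
          (NodeE
            (NodeE (NodeE (LeftE V0) (NodeE (mul (LR V0) (LeftE V2)) (RR V0))) (LeftE V1))
            (NodeE
              (NodeE (NodeE (LeftE V0) (NodeE (LR V0)
                  (NodeE (mul (LeftE (RR V0)) (LeftE V2)) (mul (RightE (RR V0)) (RightE V2))))) (LR V1))
              (NodeE (NodeE (LeftE V0) (NodeE (mul (LR V0) (LeftE (RR V0)))
                  (NodeE (LeftE V2) (RightE V2)))) (RR V1)))))))
    (NodeE LeafE (NodeE LeafE LeafE))"

definition pick_code :: "real exp" where
  "pick_code = IfE V0
    (IfE (LessE (LeftE (RR (LeftE V0))) one) V0
      (LetE (Call 12 (RightE V0))
        (IfE V0 (NodeE (LeftE V0) (NodeE (LeftE V1) (RightE V0))) LeafE)))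
    LeafE"

definition ratio_code :: "real exp" where
  "ratio_code = LetE (Call 12 (RR V0))
    (IfE V0
      (IfE (LR V1)
        (LetE (Call 11 (NodeE (LeftE V1) (NodeE (LL V0) (RightE V0))))
          (LetE (LeftE V1)
            (quot
              (add (mul (LeftE (RR V0)) (Call 13 (NodeE (LeftE (Var 3)) (NodeE (RightE (LR (Var 3))) (LeftE V1)))))
                (mul (mul (LR V0) (RightE (RR V0)))
                  (Call 13 (NodeE (LeftE (Var 3)) (NodeE (RightE (LR (Var 3))) (LR V1))))))
              (add one (mul (mul (LR V0) (LeftE (RR V0)))
                  (Call 13 (NodeE (LeftE (Var 3)) (NodeE (RightE (LR (Var 3))) (RR V1)))))))))
        (Lit 0))
      one)"

definition chain_code :: "real exp" where
  "chain_code = IfE (RR V0)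
    (LetE (Call 11 (NodeE (LeftE V0) (NodeE (LL (RR V0)) (RightE (RR V0)))))
      (mul (add one (mul (LR (LeftE (RR V1))) (Call 13 (NodeE (LeftE V1) (NodeE (LR V1) (RR V0))))))
        (Call 14 (NodeE (LeftE V1) (NodeE (LR V1) (LeftE V0))))))
    one"

text \<open>One depth is both the number of iterations towards the root and the depth of the ratio
  recursion. It is logarithmic in the error budget
  \<open>K * (1 + n) * (1 + m) / min \<epsilon> 1\<close> for \<open>n\<close> vertices and
  \<open>m\<close> edges.\<close>

definition main_code :: "real \<Rightarrow> real \<Rightarrow> real exp" where
  "main_code c K =
    LetE (Call 2 (quot (mul (mul (Lit K) (add one (Call 1 (LR V0)))) (add one (Call 1 (RR V0))))
        (IfE (LessE (LeftE V0) one) (LeftE V0) one)))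
      (LetE (Call 3 (NodeE V0 (add one (Lit c))))
        (mul (mul (Call 8 (NodeE V0 (LR V2))) (Call 9 (NodeE V0 (RR V2))))
          (Call 14 (NodeE (NodeE V0 (RR V2)) (NodeE V1 (Call 5 (NodeE V0 (NodeE (Lit 0) (LR V2)))))))))"

definition prog :: "real \<Rightarrow> real \<Rightarrow> real \<Rightarrow> prog" where
  "prog c q K = [main_code c K, len_code, depth_code q, iter_code c, pow_code, initial_state_code, spin_ratio_code, spin_scale_code,
    prodA_code, prodM_code, pair_code, upd_code, pick_code, ratio_code, chain_code]"

lemmas code_defs = main_code_def len_code_def depth_code_def iter_code_def pow_code_def initial_state_code_def
  spin_ratio_code_def spin_scale_code_def prodA_code_def prodM_code_def pair_code_def upd_code_def pick_code_def
  ratio_code_def chain_code_def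

lemma lits_prog: "(\<Union>e\<in>set (prog c q K). lits e) = {0, 1, c, q, K}"
  by (auto simp: prog_def code_defs sq_dist_def)

context
  fixes c q K :: real
begin

abbreviation "run \<equiv> result (prog c q K)"

lemma run_unfold:
  "run 0 a = exec run (main_code c K) [a]" "run 1 a = exec run len_code [a]"
  "run 2 a = exec run (depth_code q) [a]" "run 3 a = exec run (iter_code c) [a]"
  "run 4 a = exec run pow_code [a]" "run 5 a = exec run initial_state_code [a]" "run 6 a = exec run spin_ratio_code [a]"
  "run 7 a = exec run spin_scale_code [a]" "run 8 a = exec run prodA_code [a]" "run 9 a = exec run prodM_code [a]"
  "run 10 a = exec run pair_code [a]" "run 11 a = exec run upd_code [a]" "run 12 a = exec run pick_code [a]"
  "run 13 a = exec run ratio_code [a]" "run 14 a = exec run chain_code [a]"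
  by (simp_all add: result_unfold prog_def)

definition computes :: "nat \<Rightarrow> val \<Rightarrow> val \<Rightarrow> nat \<Rightarrow> bool" where
  "computes f a v T \<longleftrightarrow> (\<exists>t\<le>T. run f a = Some (v, t))"

lemma computesE:
  assumes "computes f a v T"
  obtains t where "run f a = Some (v, t)" "t \<le> T"
  using assms by (auto simp: computes_def)

lemma run_len: "computes 1 (enc_list g as) (Num (real (length as))) (10 * (length as + 1))"
proof (induction as)
  case Nil
  show ?case unfolding computes_def run_unfold(2) by (simp add: len_code_def)
next
  case (Cons a as)
  then show ?case
    by (elim computesE, subst computes_def, subst run_unfold(2)) (simp add: len_code_def)
qed

text \<open>The first inequality will give the accuracy; the second, minimality of \<open>l\<close>,
  will bound the running time \<open>4 ^ l\<close>.\<close>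

lemma run_depth:
  assumes "0 < q" "q < 1"
  shows "\<exists>l. computes 2 (Num s) (enc_depth l) (20 * (l + 1)) \<and> q ^ l * s \<le> 1 \<and>
    (l = 0 \<or> 1 < q ^ (l - 1) * s)"
proof -
  \<comment> \<open>Termination is by induction on any \<open>N\<close> that is large enough; one
    exists because \<open>q ^ n * s\<close> tends to 0.\<close>
  have *: "\<exists>l. computes 2 (Num s) (enc_depth l) (20 * (l + 1)) \<and> q ^ l * s \<le> 1 \<and> (l = 0 \<or> 1 < q ^ (l - 1) * s)"
    if "q ^ N * s \<le> 1" for N s
    using that
  proof (induction N arbitrary: s)
    case 0
    then have "computes 2 (Num s) (enc_depth 0) (20 * (0 + 1))"
      unfolding computes_def run_unfold by (simp add: depth_code_def)
    with 0 show ?case by (intro exI[of _ 0]) auto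
  next
    case (Suc N)
    show ?case
    proof (cases "1 < s")
      case False
      then have "computes 2 (Num s) (enc_depth 0) (20 * (0 + 1))"
        unfolding computes_def run_unfold by (simp add: depth_code_def)
      with False show ?thesis by (intro exI[of _ 0]) auto
    next
      case True
      have "q ^ N * (s * q) \<le> 1" using Suc.prems by (simp add: mult_ac)
      from Suc.IH[OF this] obtain l where l: "computes 2 (Num (s * q)) (enc_depth l) (20 * (l + 1))"
        "q ^ l * (s * q) \<le> 1" "l = 0 \<or> 1 < q ^ (l - 1) * (s * q)" by blast
      from l(1) have "computes 2 (Num s) (enc_depth (Suc l)) (20 * (Suc l + 1))"
        by (elim computesE, subst computes_def, subst run_unfold(3)) (simp add: depth_code_def True)
      moreover have "1 < q ^ (Suc l - 1) * s" using l(3) True by (cases l) (auto simp: mult_ac)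
      ultimately show ?thesis using l(2) by (intro exI[of _ "Suc l"]) (auto simp: mult_ac)
    qed
  qed
  have "(\<lambda>n. q ^ n * s) \<longlonglongrightarrow> 0 * s"
    using assms by (intro tendsto_mult_right LIMSEQ_power_zero) auto
  then have "\<forall>\<^sub>F n in sequentially. q ^ n * s < 1" by (rule order_tendstoD) simp
  then obtain N where "q ^ N * s < 1" by (auto simp: eventually_sequentially)
  then show ?thesis using *[of N s] by simp
qed

lemma run_iter:
  "computes 3 (Node (enc_depth l) (Num g)) (Num (((\<lambda>g. c + 1 / g) ^^ l) g)) (30 * (l + 1))"
proof (induction l arbitrary: g)
  case 0
  show ?case unfolding computes_def run_unfold by (simp add: iter_code_def)
next
  case (Suc l)
  from Suc.IH[of "c + 1 / g"] show ?case
    by (elim computesE, subst computes_def, subst run_unfold(4))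
      (simp add: iter_code_def funpow_Suc_right del: funpow.simps(2))
qed

lemma run_pow: "computes 4 (Node (Num x) (enc_list g as)) (Num (1 / x ^ length as)) (20 * (length as + 1))"
proof (induction as)
  case Nil
  show ?case unfolding computes_def run_unfold by (simp add: pow_code_def)
next
  case (Cons a as)
  then show ?case
    by (elim computesE, subst computes_def, subst run_unfold(5)) (simp add: pow_code_def mult.commute)
qed

lemma run_spin_ratio:
  assumes "f \<noteq> []"
  shows "computes 6 (Node (Num x) (enc_list Num f)) (Num (spin_ratio x f)) (20 * length f + 60)"
proof -
  obtain f0 f' where f: "f = f0 # f'" using assms by (cases f) auto
  show ?thesis
  proof (cases f')
    case Nil
    then show ?thesis unfolding computes_def run_unfold by (simp add: spin_ratio_code_def spin_ratio_def f)
  next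
    case (Cons f1 f'')
    from run_pow[of x Num f'] show ?thesis
      unfolding f Cons
      by (elim computesE, subst computes_def, subst run_unfold(7)) (simp add: spin_ratio_code_def spin_ratio_def)
  qed
qed

lemma run_spin_scale:
  assumes "f \<noteq> []"
  shows "computes 7 (Node (Num x) (enc_list Num f)) (Num (spin_scale x f)) 60"
proof -
  obtain f0 f' where f: "f = f0 # f'" using assms by (cases f) auto
  show ?thesis
    unfolding computes_def run_unfold by (cases f') (simp_all add: spin_scale_code_def spin_scale_def f)
qed

lemma vsize_enc_list: "vsize (enc_list Num f) = 2 * length f + 1"
  by (induction f) auto

lemma run_initial_state:
  assumes "\<forall>f\<in>set fs. f \<noteq> []"
  shows "computes 5 (Node (Num x) (Node (Num (real i)) (enc_list (enc_list Num) fs)))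
    (enc_list enc_elem (initial_state x i fs)) (200 * vsize (enc_list (enc_list Num) fs))"
  using assms
proof (induction fs arbitrary: i)
  case Nil
  show ?case unfolding computes_def run_unfold by (simp add: initial_state_code_def)
next
  case (Cons f fs)
  then have "computes 5 (Node (Num x) (Node (Num (1 + real i)) (enc_list (enc_list Num) fs)))
    (enc_list enc_elem (initial_state x (Suc i) fs)) (200 * vsize (enc_list (enc_list Num) fs))"
    using Cons.IH[of "Suc i"] by simp
  moreover have "computes 6 (Node (Num x) (enc_list Num f)) (Num (spin_ratio x f)) (20 * length f + 60)"
    using Cons.prems by (intro run_spin_ratio) auto
  ultimately show ?case
    by (elim computesE, subst computes_def, subst run_unfold(6))
      (simp add: initial_state_code_def vsize_enc_list enc_elem_def)
qed

lemma run_prodA: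
  assumes "\<forall>f\<in>set fs. f \<noteq> []"
  shows "computes 8 (Node (Num x) (enc_list (enc_list Num) fs)) (Num (prod_list (map (spin_scale x) fs)))
    (100 * (length fs + 1))"
  using assms
proof (induction fs)
  case Nil
  show ?case unfolding computes_def run_unfold by (simp add: prodA_code_def)
next
  case (Cons f fs)
  then have "computes 7 (Node (Num x) (enc_list Num f)) (Num (spin_scale x f)) 60"
    by (intro run_spin_scale) auto
  moreover have "computes 8 (Node (Num x) (enc_list (enc_list Num) fs)) (Num (prod_list (map (spin_scale x) fs)))
    (100 * (length fs + 1))"
    using Cons by simp
  ultimately show ?case
    by (elim computesE, subst computes_def, subst run_unfold(9)) (simp add: prodA_code_def)
qed

lemma run_prodM:
  "computes 9 (Node (Num x) (enc_list enc_edge es))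
    (Num (prod_list (map (\<lambda>(a, b, w). 1 + w * (x * x)) es))) (100 * (length es + 1))"
proof (induction es)
  case Nil
  show ?case unfolding computes_def run_unfold by (simp add: prodM_code_def)
next
  case (Cons e es)
  then show ?case
    by (elim computesE, subst computes_def, subst run_unfold(10))
      (simp add: prodM_code_def enc_edge_def split: prod.splits)
qed

lemma sq_dist_pos:
  fixes a b u w :: nat
  shows "0 < ((real a - real u) * (real a - real u) + (real b - real w) * (real b - real w)) *
     ((real a - real w) * (real a - real w) + (real b - real u) * (real b - real u)) \<longleftrightarrow>
    \<not> joins (a, b, l) u w"
proof -
  have "0 < (r * r + t * t) \<longleftrightarrow> \<not> (r = 0 \<and> t = 0)" for r t :: real
    using sum_power2_gt_zero_iff[of r t] by (simp add: power2_eq_square)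
  moreover have "0 \<le> (r * r + t * t)" for r t :: real
    by simp
  ultimately show ?thesis
    unfolding zero_less_mult_iff joins_def by (auto simp: not_less[symmetric])
qed

lemma run_pair:
  "computes 10 (Node (Node (Num x) (enc_list enc_edge es)) (Node (Num (real u)) (Num (real w))))
    (Node (Num (pair_mixed x es u w)) (Num (pair_inner x es u w))) (300 * (length es + 1))"
proof (induction es)
  case Nil
  show ?case unfolding computes_def run_unfold by (simp add: pair_code_def)
next
  case (Cons e es)
  obtain a b l where e: "e = (a, b, l)" by (rule prod_cases3)
  from Cons show ?case
    unfolding e
    by (elim computesE, subst computes_def, subst run_unfold(11))
      (simp add: pair_code_def enc_edge_def sq_dist_def sq_dist_pos[of _ _ _ _ l] mixed_weight_def inner_weight_def numeral_3_eq_3)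
qed

lemma run_upd:
  "computes 11 (Node (Node (Num x) (enc_list enc_edge es)) (Node (Num (real u)) (enc_list enc_elem L)))
    (Node (enc_list enc_elem (upd_out (pair_mixed x es) u L))
      (Node (enc_list enc_elem (upd_in (pair_mixed x es) (pair_inner x es) u L))
        (enc_list enc_elem (upd_only (pair_mixed x es) (pair_inner x es) u L))))
    (500 * ((length es + 1) * (length L + 1)))"
proof (induction L)
  case Nil
  show ?case unfolding computes_def run_unfold by (simp add: upd_code_def upd_out_def upd_in_def upd_only_def)
next
  case (Cons e L)
  obtain v r g b where e: "e = (v, r, g, b)" by (rule prod_cases4)
  from Cons run_pair[of x es u v] show ?case
    unfolding e
    by (elim computesE, subst computes_def, subst run_unfold(12))
      (simp add: upd_code_def enc_elem_def upd_out_def upd_in_def upd_only_def)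
qed

definition enc_pick :: "(elem \<times> elem list) option \<Rightarrow> val" where
  "enc_pick r = (case r of None \<Rightarrow> Leaf | Some (e, L) \<Rightarrow> Node (enc_elem e) (enc_list enc_elem L))"

lemma run_pick: "computes 12 (enc_list enc_elem L) (enc_pick (pick L)) (50 * (length L + 1))"
proof (induction L)
  case Nil
  show ?case unfolding computes_def run_unfold by (simp add: pick_code_def enc_pick_def)
next
  case (Cons e L)
  obtain v r g b where e: "e = (v, r, g, b)" by (rule prod_cases4)
  from Cons show ?case
    unfolding e
    by (elim computesE, subst computes_def, subst run_unfold(13))
      (cases "pick L", auto simp: pick_code_def enc_elem_def enc_pick_def)
qed

text \<open>The three recursive calls use three quarters of the bound, and the last quarter pays for
  \<open>pick\<close>, the updates and the arithmetic. A common \<open>n\<close> bounds the lengths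
  of all lists, which only shrink.\<close>

lemma run_ratio:
  "length L \<le> n \<Longrightarrow>
    computes 13 (Node (Node (Num x) (enc_list enc_edge es)) (Node (enc_depth l) (enc_list enc_elem L)))
    (Num (ratio (pair_mixed x es) (pair_inner x es) l L)) (1000 * ((length es + 1) * (n + 1)) * 4 ^ l)"
proof (induction l arbitrary: L)
  case 0
  have "50 * (length L + 1) + 100 \<le> 1000 * ((length es + 1) * (n + 1))"
    using 0 by (simp add: algebra_simps)
  with run_pick[of L] show ?case
    by (elim computesE, subst computes_def, subst run_unfold(14))
      (cases "pick L", auto simp: ratio_code_def enc_pick_def)
next
  case (Suc l)
  define W where "W = (length es + 1) * (n + 1)"
  have W: "1 \<le> W" "length L + 1 \<le> W"
    using Suc.prems by (auto simp: W_def trans_le_add1)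
  show ?case
  proof (cases "pick L")
    case None
    define Z where "Z = W * 4 ^ l"
    have Z: "1000 * W * 4 ^ Suc l = 4000 * Z" "W \<le> Z" by (simp_all add: Z_def)
    from run_pick[of L] None show ?thesis
      unfolding W_def[symmetric] Z(1) using W Z(2)
      by (elim computesE, subst computes_def, subst run_unfold(14))
        (simp add: ratio_code_def enc_pick_def)
  next
    case (Some p)
    then obtain u r g b L' where p: "pick L = Some ((u, r, g, b), L')"
      by (metis prod_cases3 surj_pair)
    then obtain xs ys where L: "L = xs @ (u, r, g, b) # ys" "L' = xs @ ys"
      using pick_SomeD by blast
    then have n: "length L' + 1 \<le> n" using Suc.prems by simp
    define X where "X = (length es + 1) * (length L' + 1)"
    have LW: "X \<le> W" unfolding W_def X_def using n by (intro mult_left_mono) auto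
    define Z where "Z = W * 4 ^ l"
    have Z: "1000 * W * 4 ^ Suc l = 4000 * Z" "1000 * W * 4 ^ l = 1000 * Z" "W \<le> Z" by (simp_all add: Z_def)
    note IH = Suc.IH[folded W_def, of "upd_out (pair_mixed x es) u L'"]
       Suc.IH[folded W_def, of "upd_in (pair_mixed x es) (pair_inner x es) u L'"]
       Suc.IH[folded W_def, of "upd_only (pair_mixed x es) (pair_inner x es) u L'"]
    have "computes 13 (Node (Node (Num x) (enc_list enc_edge es)) (Node (enc_depth l) (enc_list enc_elem (upd_out (pair_mixed x es) u L'))))
        (Num (ratio (pair_mixed x es) (pair_inner x es) l (upd_out (pair_mixed x es) u L'))) (1000 * Z)"
      "computes 13 (Node (Node (Num x) (enc_list enc_edge es)) (Node (enc_depth l) (enc_list enc_elem (upd_in (pair_mixed x es) (pair_inner x es) u L'))))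
        (Num (ratio (pair_mixed x es) (pair_inner x es) l (upd_in (pair_mixed x es) (pair_inner x es) u L'))) (1000 * Z)"
      "computes 13 (Node (Node (Num x) (enc_list enc_edge es)) (Node (enc_depth l) (enc_list enc_elem (upd_only (pair_mixed x es) (pair_inner x es) u L'))))
        (Num (ratio (pair_mixed x es) (pair_inner x es) l (upd_only (pair_mixed x es) (pair_inner x es) u L'))) (1000 * Z)"
      using IH n unfolding length_upd Z(2) by linarith+
    with run_pick[of L] run_upd[of x es u L', folded X_def] LW W Z(3)
    show ?thesis
      unfolding p W_def[symmetric] Z(1)
      by (elim computesE, subst computes_def, subst run_unfold(14))
        (simp add: ratio_code_def enc_pick_def enc_elem_def p numeral_3_eq_3)
  qed
qed

lemma run_chain:
  "length L \<le> n \<Longrightarrow>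
    computes 14 (Node (Node (Num x) (enc_list enc_edge es)) (Node (enc_depth l) (enc_list enc_elem L)))
    (Num (chain_estimate (pair_mixed x es) (pair_inner x es) l L)) (2000 * ((length es + 1) * (n + 1)) * 4 ^ l * (length L + 1))"
proof (induction "length L" arbitrary: L)
  case 0
  define X where "X = (length es + 1) * (n + 1) * 4 ^ l * (length L + 1)"
  have "X \<noteq> 0" by (simp add: X_def)
  then have "5 \<le> 2000 * X" by linarith
  then have "5 \<le> 2000 * ((length es + 1) * (n + 1)) * 4 ^ l * (length L + 1)"
    by (simp only: X_def mult.assoc)
  with 0 show ?case unfolding computes_def run_unfold by (simp add: chain_code_def)
next
  case (Suc k)
  then obtain u r g b L' where L: "L = (u, r, g, b) # L'" "length L' = k"
    by (metis length_Suc_conv prod_cases4)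
  define W where "W = (length es + 1) * (n + 1)"
  have W: "1 \<le> W" by (simp add: W_def)
  define X where "X = (length es + 1) * (length L' + 1)"
  define Z where "Z = W * 4 ^ l"
  have Z: "2000 * W * 4 ^ l = 2000 * Z" "1000 * W * 4 ^ l = 1000 * Z" "W \<le> Z" by (simp_all add: Z_def)
  have "X \<le> W"
    unfolding W_def X_def using Suc.prems L by (intro mult_left_mono) auto
  moreover have "computes 14 (Node (Node (Num x) (enc_list enc_edge es)) (Node (enc_depth l) (enc_list enc_elem (upd_out (pair_mixed x es) u L'))))
      (Num (chain_estimate (pair_mixed x es) (pair_inner x es) l (upd_out (pair_mixed x es) u L'))) (2000 * Z * (length L' + 1))"
  proof -
    have "k = length (upd_out (pair_mixed x es) u L')" "length (upd_out (pair_mixed x es) u L') \<le> n"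
      using L Suc.prems by simp_all
    from Suc.hyps(1)[OF this] show ?thesis by (simp only: W_def[symmetric] Z(1) length_upd)
  qed
  moreover have "computes 13 (Node (Node (Num x) (enc_list enc_edge es)) (Node (enc_depth l) (enc_list enc_elem (upd_only (pair_mixed x es) (pair_inner x es) u L'))))
        (Num (ratio (pair_mixed x es) (pair_inner x es) l (upd_only (pair_mixed x es) (pair_inner x es) u L'))) (1000 * Z)"
    using Suc.prems L run_ratio[of "upd_only (pair_mixed x es) (pair_inner x es) u L'" n x es l] unfolding W_def[symmetric] Z(2) by simp
  ultimately show ?case
    using run_upd[of x es u L', folded X_def] W Z(3)
    unfolding L(1) W_def[symmetric] Z(1)
    by (elim computesE, subst computes_def, subst run_unfold(15))
      (simp add: chain_code_def enc_elem_def)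
qed

lemma length_less_vsize: "length as < vsize (enc_list g as)"
  by (induction as) auto

text \<open>The cube has one factor for the edges scanned per pair weight, one for the vertices in a
  list and one for the factors of the chain.\<close>

lemma run_main:
  fixes fs es \<epsilon>
  defines "s \<equiv> K * (1 + real (length fs)) * (1 + real (length es)) / (if \<epsilon> < 1 then \<epsilon> else 1)"
  defines "I \<equiv> Node (enc_list (enc_list Num) fs) (enc_list enc_edge es)"
  assumes q: "0 < q" "q < 1" and fs: "\<forall>f\<in>set fs. f \<noteq> []"
  shows "\<exists>l. computes 0 (Node (Num \<epsilon>) I) (Num (estimate (((\<lambda>g. c + 1 / g) ^^ l) (1 + c)) l fs es))
     (10000 * vsize I ^ 3 * 4 ^ l) \<and> q ^ l * s \<le> 1 \<and> (l = 0 \<or> 1 < q ^ (l - 1) * s)"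
proof -
  obtain l where l: "computes 2 (Num s) (enc_depth l) (20 * (l + 1))" "q ^ l * s \<le> 1" 
    "l = 0 \<or> 1 < q ^ (l - 1) * s" using run_depth[OF q] by blast
  define x where "x = ((\<lambda>g. c + 1 / g) ^^ l) (1 + c)"
  define n where "n = length fs"
  define m where "m = length es"
  define S where "S = vsize I"
  have S: "n + 1 \<le> S" "m + 1 \<le> S" "vsize (enc_list (enc_list Num) fs) \<le> S" "1 \<le> S"
    using length_less_vsize[of fs "enc_list Num"] length_less_vsize[of es enc_edge]
    by (auto simp: S_def I_def n_def m_def)
  have "length (initial_state x i fs) = length fs" for i by (induction fs arbitrary: i) auto
  then have "computes 14 (Node (Node (Num x) (enc_list enc_edge es)) (Node (enc_depth l) (enc_list enc_elem (initial_state x 0 fs))))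
    (Num (chain_estimate (pair_mixed x es) (pair_inner x es) l (initial_state x 0 fs))) (2000 * ((m + 1) * (n + 1)) * 4 ^ l * (n + 1))"
    using run_chain[of "initial_state x 0 fs" n x es l] by (simp add: n_def m_def)
  moreover have "2000 * ((m + 1) * (n + 1)) * 4 ^ l * (n + 1) \<le> 2000 * (S * S) * 4 ^ l * S"
    using S by (intro mult_le_mono le_refl)
  moreover have "\<dots> = 2000 * (S ^ 3 * 4 ^ l)" by (simp add: power3_eq_cube)
  moreover have "S * 1 * 1 \<le> S * S ^ 2 * 4 ^ l" using S by (intro mult_le_mono) auto
  then have "S \<le> S ^ 3 * 4 ^ l" by (simp add: power2_eq_square power3_eq_cube)
  moreover have "l + 1 \<le> S ^ 3 * 4 ^ l"
  proof -
    have "l < 4 ^ l" by (rule power_gt_expt) simp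
    moreover have "1 * 4 ^ l \<le> S ^ 3 * 4 ^ l" using S by (intro mult_le_mono) auto
    ultimately show ?thesis by linarith
  qed
  moreover have "(if \<epsilon> < 1 then \<epsilon> else 1) * s = K * (1 + real n) * (1 + real m)" if "\<epsilon> \<noteq> 0"
    using that by (simp add: s_def n_def m_def)
  moreover note l(1) run_iter[of l "1 + c", folded x_def] run_len[of "enc_list Num" fs] run_len[of enc_edge es]
    run_prodA[OF fs, of x] run_prodM[of x es] run_initial_state[OF fs, of x 0]
  ultimately have "computes 0 (Node (Num \<epsilon>) I) (Num (estimate x l fs es)) (10000 * (S ^ 3 * 4 ^ l))"
    using S unfolding I_def s_def
    apply (elim computesE)
    apply (subst computes_def)
    apply (subst run_unfold(1))
    apply (cases "\<epsilon> < 1")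
    apply (simp_all add: main_code_def estimate_def n_def[symmetric] m_def[symmetric] add.commute)
    done
  then show ?thesis using l unfolding S_def x_def by (auto simp: mult.assoc)
qed

end

subsection \<open>The holographic expansion\<close>

definition pair_weight :: "(nat \<Rightarrow> nat \<Rightarrow> real) \<Rightarrow> (nat \<Rightarrow> nat \<Rightarrow> real) \<Rightarrow> nat \<Rightarrow> nat \<Rightarrow> bool \<Rightarrow> bool \<Rightarrow> real" where
  "pair_weight G B u w p p' = (if p \<and> p' then B u w else if p \<or> p' then G u w else 1)"

primrec pair_prod :: "(nat \<Rightarrow> nat \<Rightarrow> real) \<Rightarrow> nat list \<Rightarrow> real" where
  "pair_prod f [] = 1"
| "pair_prod f (u # vs) = (\<Prod>w\<leftarrow>vs. f u w) * pair_prod f vs"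

lemma pair_prod_mult: "pair_prod (\<lambda>u w. f u w * g u w) vs = pair_prod f vs * pair_prod g vs"
proof (induction vs)
  case (Cons u vs)
  have "(\<Prod>w\<leftarrow>ws. f u w * g u w) = (\<Prod>w\<leftarrow>ws. f u w) * (\<Prod>w\<leftarrow>ws. g u w)" for ws
    by (induction ws) (auto simp: mult_ac)
  with Cons show ?case by simp
qed simp

lemma pair_prod_1: "(\<And>u w. u \<in> set vs \<Longrightarrow> w \<in> set vs \<Longrightarrow> f u w = 1) \<Longrightarrow> pair_prod f vs = 1"
proof (induction vs)
  case (Cons u vs)
  have "(\<Prod>w\<leftarrow>ws. f u w) = 1" if "set ws \<subseteq> set vs" for ws
    using that Cons.prems by (induction ws) auto
  with Cons show ?case by simp
qed simp

lemma prod_list_single: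
  "distinct ws \<Longrightarrow> b \<in> set ws \<Longrightarrow> (\<Prod>w\<leftarrow>ws. if w = b then c else 1) = (c :: real)"
proof (induction ws)
  case (Cons w ws)
  have "(\<Prod>w\<leftarrow>ws. if w = b then c else 1) = 1" if "b \<notin> set ws" for ws
    using that by (induction ws) auto
  with Cons show ?case by auto
qed simp

text \<open>An edge counts exactly once, when the earlier of its endpoints is the head of the
  list.\<close>

lemma pair_prod_single:
  assumes "distinct vs" "a \<in> set vs" "b \<in> set vs" "a \<noteq> b"
  shows "pair_prod (\<lambda>u w. if joins (a, b, l) u w then c else 1) vs = c"
  using assms
proof (induction vs)
  case (Cons u vs)
  consider "u = a" | "u = b" | "u \<noteq> a" "u \<noteq> b" by blast
  then show ?case
  proof cases
    case 1
    have "pair_prod (\<lambda>u w. if joins (a, b, l) u w then c else 1) vs = 1"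
      using Cons.prems 1 by (intro pair_prod_1) (auto simp: joins_def)
    moreover have "(\<Prod>w\<leftarrow>vs. if joins (a, b, l) u w then c else 1) = (\<Prod>w\<leftarrow>vs. if w = b then c else 1)"
      using Cons.prems 1 by (intro arg_cong[where f = prod_list] map_cong) (auto simp: joins_def)
    ultimately show ?thesis using Cons.prems 1 by (simp add: prod_list_single)
  next
    case 2
    have "pair_prod (\<lambda>u w. if joins (a, b, l) u w then c else 1) vs = 1"
      using Cons.prems 2 by (intro pair_prod_1) (auto simp: joins_def)
    moreover have "(\<Prod>w\<leftarrow>vs. if joins (a, b, l) u w then c else 1) = (\<Prod>w\<leftarrow>vs. if w = a then c else 1)"
      using Cons.prems 2 by (intro arg_cong[where f = prod_list] map_cong) (auto simp: joins_def)
    ultimately show ?thesis using Cons.prems 2 by (simp add: prod_list_single)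
  next
    case 3
    have "(\<Prod>w\<leftarrow>ws. if joins (a, b, l) u w then c else 1) = 1" for ws
      using 3 by (induction ws) (auto simp: joins_def)
    with 3 Cons show ?thesis by simp
  qed
qed simp

definition spin_edge_weight :: "real \<Rightarrow> real \<Rightarrow> bool \<Rightarrow> bool \<Rightarrow> real" where
  "spin_edge_weight x l p p' = (if p \<and> p' then inner_weight x l else if p \<or> p' then mixed_weight x l else 1)"

text \<open>Adding an edge changes the weight of a single pair, so the product over pairs, in which
  parallel edges are merged, regroups into a product over edges.\<close>

lemma pair_prod_edges:
  assumes "distinct vs" "\<forall>(a, b, l)\<in>set es. a \<in> set vs \<and> b \<in> set vs \<and> a \<noteq> b"
  shows "pair_prod (\<lambda>u w. pair_weight (pair_mixed x es) (pair_inner x es) u w (s u) (s w)) vs =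
    (\<Prod>(a, b, l)\<leftarrow>es. spin_edge_weight x l (s a) (s b))"
  using assms(2)
proof (induction es)
  case Nil
  show ?case by (simp add: pair_weight_def pair_prod_1)
next
  case (Cons e es)
  obtain a b l where e: "e = (a, b, l)" by (rule prod_cases3)
  have eq: "(\<lambda>u w. pair_weight (pair_mixed x (e # es)) (pair_inner x (e # es)) u w (s u) (s w)) =
      (\<lambda>u w. (if joins (a, b, l) u w then spin_edge_weight x l (s a) (s b) else 1) *
      pair_weight (pair_mixed x es) (pair_inner x es) u w (s u) (s w))"
    by (intro ext) (auto simp: pair_weight_def e spin_edge_weight_def joins_def)
  show ?case
    unfolding eq pair_prod_mult using Cons assms(1) by (simp add: e pair_prod_single)
qed

lemma sum_PiE_insert:
  assumes "u \<notin> A" "finite A"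
  shows "(\<Sum>s\<in>insert u A \<rightarrow>\<^sub>E (UNIV :: bool set). f s) =
    (\<Sum>s\<in>A \<rightarrow>\<^sub>E UNIV. f (s(u := False)) + f (s(u := True)))"
proof -
  have "(\<Sum>s\<in>insert u A \<rightarrow>\<^sub>E (UNIV :: bool set). f s) =
    (\<Sum>p\<in>UNIV \<times> (A \<rightarrow>\<^sub>E UNIV). f (case p of (y, g) \<Rightarrow> g(u := y)))"
    unfolding PiE_insert_eq using inj_combinator[of u A "\<lambda>_. UNIV"] assms
    by (subst sum.reindex) (auto simp: comp_def)
  also have "\<dots> = (\<Sum>y\<in>UNIV. \<Sum>g\<in>A \<rightarrow>\<^sub>E UNIV. f (g(u := y)))"
    by (simp add: sum.cartesian_product case_prod_unfold)
  also have "\<dots> = (\<Sum>s\<in>A \<rightarrow>\<^sub>E UNIV. f (s(u := False)) + f (s(u := True)))"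
    by (simp add: UNIV_bool sum.distrib)
  finally show ?thesis .
qed

lemma pair_prod_upd:
  "u \<notin> set vs \<Longrightarrow> pair_prod (\<lambda>v w. f v w ((s(u := t)) v) ((s(u := t)) w)) vs = pair_prod (\<lambda>v w. f v w (s v) (s w)) vs"
proof (induction vs)
  case (Cons v vs)
  have "(\<Prod>w\<leftarrow>ws. f v w ((s(u := t)) v) ((s(u := t)) w)) = (\<Prod>w\<leftarrow>ws. f v w (s v) (s w))" if "u \<notin> set ws" for ws
    using that Cons.prems by (induction ws) auto
  with Cons show ?case by simp
qed simp

text \<open>The induction has to generalise over \<open>h\<close>, since fixing the spin of
  \<open>u\<close> multiplies the remaining vertex weights by its interactions.\<close>

lemma spin_sum_expand:
  assumes "distinct vs"
  shows "spin_sum G B (map (\<lambda>v. (v, h v False, h v True)) vs) =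
    (\<Sum>s\<in>set vs \<rightarrow>\<^sub>E UNIV. (\<Prod>v\<in>set vs. h v (s v)) * pair_prod (\<lambda>u w. pair_weight G B u w (s u) (s w)) vs)"
  using assms
proof (induction vs arbitrary: h)
  case Nil
  then show ?case by simp
next
  case (Cons u vs)
  then have u: "u \<notin> set vs" "distinct vs" by auto
  have 1: "spin_sum G B (map (\<lambda>v. (v, h v False, h v True)) (u # vs)) =
      h u False * spin_sum G B (map (\<lambda>v. (v, h v False * pair_weight G B u v False False, h v True * pair_weight G B u v False True)) vs) +
      h u True * spin_sum G B (map (\<lambda>v. (v, h v False * pair_weight G B u v True False, h v True * pair_weight G B u v True True)) vs)"
    by (simp add: comp_def pair_weight_def)
  have pl: "(\<Prod>w\<leftarrow>vs. f w) = (\<Prod>w\<in>set vs. f w)" for f :: "nat \<Rightarrow> real"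
    using u(2) by (simp add: prod.distinct_set_conv_list)
  have 2: "h u t * ((\<Prod>v\<in>set vs. h v (s v) * pair_weight G B u v t (s v)) * pair_prod (\<lambda>u w. pair_weight G B u w (s u) (s w)) vs) =
      (\<Prod>v\<in>set (u # vs). h v ((s(u := t)) v)) *
      pair_prod (\<lambda>v w. pair_weight G B v w ((s(u := t)) v) ((s(u := t)) w)) (u # vs)" for s t
  proof -
    have "(\<Prod>v\<in>set (u # vs). h v ((s(u := t)) v)) = h u t * (\<Prod>v\<in>set vs. h v (s v))"
      using u by (auto intro!: prod.cong)
    moreover have "(\<Prod>w\<leftarrow>vs. pair_weight G B u w ((s(u := t)) u) ((s(u := t)) w)) = (\<Prod>v\<in>set vs. pair_weight G B u v t (s v))"
      unfolding pl using u by (intro prod.cong) auto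
    ultimately show ?thesis
      using pair_prod_upd[OF u(1), of "pair_weight G B" s t] by (simp add: prod.distrib mult_ac)
  qed
  show ?case
    unfolding 1 Cons.IH[OF u(2), of "\<lambda>v p. h v p * pair_weight G B u v False p"]
      Cons.IH[OF u(2), of "\<lambda>v p. h v p * pair_weight G B u v True p"]
    unfolding sum_distrib_left 2 list.set(2)
    by (subst sum_PiE_insert[OF u(1)]) (simp_all add: sum.distrib)
qed

definition basis_vec :: "real \<Rightarrow> bool \<Rightarrow> bool \<Rightarrow> real" where
  "basis_vec x p b = (if p then (if b then - 1 else x) else (if b then x else 1))"

lemma basis_vec_contract:
  assumes "0 \<le> l"
  shows "basis_vec x p False * basis_vec x p' False + l * (basis_vec x p True * basis_vec x p' True) = (1 + l * (x * x)) * spin_edge_weight x l p p'"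
proof -
  have "0 \<le> l * (x * x)" using assms by simp
  then have "1 + l * (x * x) \<noteq> 0" by linarith
  then have "(1 + l * (x * x)) * mixed_weight x l = (1 - l) * x" "(1 + l * (x * x)) * inner_weight x l = x * x + l"
    by (simp_all add: mixed_weight_def inner_weight_def)
  then show ?thesis
    by (cases p; cases p') (simp_all add: basis_vec_def spin_edge_weight_def, simp_all add: algebra_simps)
qed

text \<open>Every vertex function is expanded into its two tensor powers, indexed by the spin. Each
  \<open>\<sigma> e\<close> then meets only the two vectors at the ends of \<open>e\<close>, so
  after exchanging the sums the inner one factorises into edge contractions.\<close>

lemma holographic:
  fixes es :: "(nat \<times> nat \<times> real) list" and r :: "nat \<Rightarrow> real"
  assumes es: "\<forall>(a, b, l)\<in>set es. a < n \<and> b < n \<and> a \<noteq> b \<and> 0 \<le> l"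
  defines "inc \<equiv> \<lambda>v. filter (\<lambda>e. fst (es ! e) = v \<or> fst (snd (es ! e)) = v) [0..<length es]"
  shows "(\<Sum>\<sigma>\<in>{..<length es} \<rightarrow>\<^sub>E (UNIV :: bool set). (\<Prod>e<length es. snd (snd (es ! e)) ^ of_bool (\<sigma> e)) *
      (\<Prod>v<n. (\<Prod>e\<leftarrow>inc v. basis_vec x False (\<sigma> e)) + r v * (\<Prod>e\<leftarrow>inc v. basis_vec x True (\<sigma> e)))) =
    (\<Prod>(a, b, l)\<leftarrow>es. 1 + l * (x * x)) * spin_sum (pair_mixed x es) (pair_inner x es) (map (\<lambda>v. (v, 1, r v)) [0..<n])"
proof -
  define m where "m = length es"
  define h where "h v p = (if p then r v else 1)" for v p
  define w where "w e = snd (snd (es ! e))" for e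
  define src where "src e = fst (es ! e)" for e
  define dst where "dst e = fst (snd (es ! e))" for e
  have es': "src e < n" "dst e < n" "src e \<noteq> dst e" "0 \<le> w e" if "e < m" for e
    using es nth_mem[of e es] that by (auto simp: src_def dst_def w_def m_def case_prod_unfold)
  have inc: "(\<Prod>e\<leftarrow>inc v. f e) = (\<Prod>e<m. if src e = v \<or> dst e = v then f e else 1)" for v and f :: "nat \<Rightarrow> real"
  proof -
    have "(\<Prod>e\<leftarrow>inc v. f e) = (\<Prod>e\<in>set (inc v). f e)"
      by (subst prod.distinct_set_conv_list) (simp_all add: inc_def)
    also have "\<dots> = (\<Prod>e\<in>{e \<in> {..<m}. src e = v \<or> dst e = v}. f e)"
      by (intro prod.cong) (auto simp: inc_def src_def dst_def m_def)
    also have "\<dots> = (\<Prod>e<m. if src e = v \<or> dst e = v then f e else 1)"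
      by (rule prod.inter_filter) simp
    finally show ?thesis .
  qed
  \<comment> \<open>Edges have two distinct endpoints, so each edge contributes exactly two vector
    entries.\<close>
  have ends: "(\<Prod>v<n. \<Prod>e<m. if src e = v \<or> dst e = v then f v e else 1) = (\<Prod>e<m. f (src e) e * f (dst e) e)"
    for f :: "nat \<Rightarrow> nat \<Rightarrow> real"
  proof -
    have "(\<Prod>v<n. if src e = v \<or> dst e = v then f v e else 1) = f (src e) e * f (dst e) e" if "e < m" for e
    proof -
      have "(\<Prod>v<n. if src e = v \<or> dst e = v then f v e else 1) = (\<Prod>v\<in>{v \<in> {..<n}. src e = v \<or> dst e = v}. f v e)"
        by (rule prod.inter_filter[symmetric]) simp
      also have "{v \<in> {..<n}. src e = v \<or> dst e = v} = {src e, dst e}" using es'[OF that] by auto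
      finally show ?thesis using es'[OF that] by simp
    qed
    then show ?thesis by (subst prod.swap) simp
  qed
  have vert: "(\<Prod>v<n. (\<Prod>e\<leftarrow>inc v. basis_vec x False (\<sigma> e)) + r v * (\<Prod>e\<leftarrow>inc v. basis_vec x True (\<sigma> e))) =
      (\<Sum>s\<in>{..<n} \<rightarrow>\<^sub>E UNIV. (\<Prod>v<n. h v (s v)) * (\<Prod>e<m. basis_vec x (s (src e)) (\<sigma> e) * basis_vec x (s (dst e)) (\<sigma> e)))" for \<sigma>
  proof -
    have "(\<Prod>v<n. (\<Prod>e\<leftarrow>inc v. basis_vec x False (\<sigma> e)) + r v * (\<Prod>e\<leftarrow>inc v. basis_vec x True (\<sigma> e))) =
        (\<Prod>v<n. \<Sum>p\<in>UNIV. h v p * (\<Prod>e\<leftarrow>inc v. basis_vec x p (\<sigma> e)))"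
      by (simp add: UNIV_bool h_def add.commute)
    also have "\<dots> = (\<Sum>s\<in>{..<n} \<rightarrow>\<^sub>E UNIV. \<Prod>v<n. h v (s v) * (\<Prod>e\<leftarrow>inc v. basis_vec x (s v) (\<sigma> e)))"
      by (rule prod_sum_PiE) auto
    finally show ?thesis
      by (simp only: inc ends[of "\<lambda>v e. basis_vec x (_ v) (\<sigma> e)"] prod.distrib)
  qed
  have edge: "(\<Sum>\<sigma>\<in>{..<m} \<rightarrow>\<^sub>E UNIV. (\<Prod>e<m. w e ^ of_bool (\<sigma> e)) *
        (\<Prod>e<m. basis_vec x (s (src e)) (\<sigma> e) * basis_vec x (s (dst e)) (\<sigma> e))) =
      (\<Prod>e<m. 1 + w e * (x * x)) * (\<Prod>e<m. spin_edge_weight x (w e) (s (src e)) (s (dst e)))" for s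
  proof -
    have "(\<Prod>e<m. 1 + w e * (x * x)) * (\<Prod>e<m. spin_edge_weight x (w e) (s (src e)) (s (dst e))) =
        (\<Prod>e<m. \<Sum>b\<in>UNIV. w e ^ of_bool b * (basis_vec x (s (src e)) b * basis_vec x (s (dst e)) b))"
      unfolding prod.distrib[symmetric]
      by (intro prod.cong refl) (simp add: UNIV_bool basis_vec_contract[symmetric] es' add.commute)
    also have "\<dots> = (\<Sum>\<sigma>\<in>{..<m} \<rightarrow>\<^sub>E UNIV. \<Prod>e<m. w e ^ of_bool (\<sigma> e) * (basis_vec x (s (src e)) (\<sigma> e) * basis_vec x (s (dst e)) (\<sigma> e)))"
      by (rule prod_sum_PiE) auto
    finally show ?thesis by (simp add: prod.distrib)
  qed
  have pl: "(\<Prod>(a, b, l)\<leftarrow>es. f a b l) = (\<Prod>e<m. f (src e) (dst e) (w e))" for f :: "nat \<Rightarrow> nat \<Rightarrow> real \<Rightarrow> real"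
  proof -
    have "(\<Prod>(a, b, l)\<leftarrow>es. f a b l) = (\<Prod>e\<leftarrow>[0..<m]. f (src e) (dst e) (w e))"
      unfolding m_def src_def dst_def w_def
      by (subst map_nth[symmetric, of es]) (simp add: comp_def case_prod_unfold)
    also have "\<dots> = (\<Prod>e<m. f (src e) (dst e) (w e))"
      using prod.distinct_set_conv_list[OF distinct_upt, of "\<lambda>e. f (src e) (dst e) (w e)" 0 m]
      by (simp add: atLeast0LessThan)
    finally show ?thesis .
  qed
  have "(\<Sum>\<sigma>\<in>{..<m} \<rightarrow>\<^sub>E UNIV. (\<Prod>e<m. w e ^ of_bool (\<sigma> e)) *
      (\<Prod>v<n. (\<Prod>e\<leftarrow>inc v. basis_vec x False (\<sigma> e)) + r v * (\<Prod>e\<leftarrow>inc v. basis_vec x True (\<sigma> e)))) =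
    (\<Sum>s\<in>{..<n} \<rightarrow>\<^sub>E UNIV. (\<Prod>v<n. h v (s v)) * (\<Sum>\<sigma>\<in>{..<m} \<rightarrow>\<^sub>E UNIV. (\<Prod>e<m. w e ^ of_bool (\<sigma> e)) *
        (\<Prod>e<m. basis_vec x (s (src e)) (\<sigma> e) * basis_vec x (s (dst e)) (\<sigma> e))))"
    unfolding vert sum_distrib_left by (subst sum.swap) (simp add: mult_ac)
  also have "\<dots> = (\<Prod>e<m. 1 + w e * (x * x)) * (\<Sum>s\<in>{..<n} \<rightarrow>\<^sub>E UNIV. (\<Prod>v<n. h v (s v)) *
      (\<Prod>e<m. spin_edge_weight x (w e) (s (src e)) (s (dst e))))"
    unfolding edge sum_distrib_left by (simp add: mult_ac)
  also have "(\<Sum>s\<in>{..<n} \<rightarrow>\<^sub>E UNIV. (\<Prod>v<n. h v (s v)) * (\<Prod>e<m. spin_edge_weight x (w e) (s (src e)) (s (dst e)))) =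
      spin_sum (pair_mixed x es) (pair_inner x es) (map (\<lambda>v. (v, h v False, h v True)) [0..<n])"
    unfolding spin_sum_expand[OF distinct_upt]
    using es by (subst pair_prod_edges) (auto simp: pl atLeast0LessThan)
  finally show ?thesis by (simp add: pl m_def w_def h_def)
qed

subsection \<open>Correlation decay\<close>

text \<open>\<open>m u v\<close> counts parallel edges, over which pair weights are products; hence
  the powers. All slack is measured by \<open>s\<close>: mixed weights are below
  \<open>s / x ^ 2\<close>, inner weights at most \<open>1 + s \<le> x ^ 2\<close>, and the gap
  \<open>1 - \<kappa> = 10 * s\<close> exceeds the sum of all losses.\<close>

locale spin_system =
  fixes G B :: "nat \<Rightarrow> nat \<Rightarrow> real" and m :: "nat \<Rightarrow> nat \<Rightarrow> nat" and x \<gamma> \<beta> \<kappa> s :: real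
  assumes sym: "G u v = G v u" "B u v = B v u" "m u v = m v u" "m u u = 0"
    and G_le: "\<bar>G u v\<bar> \<le> \<gamma> ^ m u v" and B_ge: "0 \<le> B u v" and B_le: "B u v \<le> \<beta> ^ m u v"
    and triv: "m u v = 0 \<Longrightarrow> G u v = 1" "m u v = 0 \<Longrightarrow> B u v = 1"
    and x1: "1 < x" and s0: "0 < s" "s < 1 / 10" and kap: "\<kappa> = 1 - 10 * s"
    and xs: "1 + s \<le> x\<^sup>2" and gam: "0 \<le> \<gamma>" "\<gamma> * x\<^sup>2 \<le> s" and bet: "0 \<le> \<beta>" "\<beta> \<le> 1 + s"
begin

definition deg :: "elem list \<Rightarrow> nat \<Rightarrow> nat" where
  "deg L v = sum_list (map (m v \<circ> fst) L)"

text \<open>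
  Here \<open>k\<close> edges of the vertex are pinned and \<open>D\<close> lead to other remaining vertices. The one-sided bounds keep
  \<open>1 + r N\<close> away from 0 at the first vertex of a component, where \<open>\<bar>r N\<bar>\<close> need not be small.
\<close>

definition elem_ok :: "nat \<Rightarrow> nat \<Rightarrow> elem \<Rightarrow> bool" where
  "elem_ok k D = (\<lambda>(v, r, g, b).
    \<bar>r\<bar> * x ^ (k + D) \<le> \<kappa> * x\<^sup>2 \<and> - 1 \<le> r * x ^ (k + D) \<and> (k + D = 0 \<longrightarrow> - \<kappa> \<le> r) \<and>
    \<bar>g\<bar> \<le> \<gamma> ^ k \<and> (k = 0 \<longrightarrow> g = 1 \<and> b = 1) \<and> 0 \<le> b \<and> b \<le> \<beta> ^ k)"

definition state_ok :: "(nat \<Rightarrow> nat) \<Rightarrow> elem list \<Rightarrow> bool" where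
  "state_ok k L \<longleftrightarrow> (\<forall>e\<in>set L. elem_ok (k (fst e)) (deg L (fst e)) e)"

definition pend :: "(nat \<Rightarrow> nat) \<Rightarrow> elem list \<Rightarrow> nat" where
  "pend k L = sum_list (map (k \<circ> fst) L)"

lemma state_ok_move: "state_ok k (xs @ e # ys) = state_ok k (e # xs @ ys)"
  by (auto simp: state_ok_def deg_def add_ac)

lemma pend_move: "pend k (xs @ e # ys) = pend k (e # xs @ ys)"
  by (simp add: pend_def)

lemma sum_move:
  "sum_in G B (xs @ e # ys) = sum_in G B (e # xs @ ys)" "sum_out G B (xs @ e # ys) = sum_out G B (e # xs @ ys)"
  by (simp_all add: sum_in_def sum_out_def spin_sum_move sym)

lemma gam_small: "\<gamma> \<le> s" "\<gamma> < 1"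
proof -
  have "1 \<le> x\<^sup>2" using xs s0 by linarith
  then have "\<gamma> * 1 \<le> \<gamma> * x\<^sup>2" using gam(1) by (simp only: mult_left_mono)
  then show "\<gamma> \<le> s" "\<gamma> < 1" using gam s0 by linarith+
qed

text \<open>A single pinned edge suffices: its \<open>\<gamma>\<close> absorbs \<open>x ^ 2\<close>.
  In the third bound one \<open>\<beta>\<close> costs \<open>1 + s\<close>, and each of the others
  is at most \<open>x ^ 2\<close>.\<close>

lemma gam_pow:
  assumes "0 < n"
  shows "\<gamma> ^ n \<le> s * x ^ n" "x\<^sup>2 * \<gamma> ^ n \<le> s * x ^ n" "\<beta> ^ n * x\<^sup>2 \<le> (1 + s) * x ^ (2 * n)"
proof -
  have 3: "\<gamma> ^ n \<le> \<gamma>"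
    using power_decreasing[of 1 n "\<gamma>"] gam gam_small assms by simp
  have 4: "1 \<le> x ^ n" using x1 by simp
  have "s * 1 \<le> s * x ^ n" using s0 4 by (intro mult_left_mono) auto
  then show "\<gamma> ^ n \<le> s * x ^ n"
    using 3 gam_small by linarith
  show "x\<^sup>2 * \<gamma> ^ n \<le> s * x ^ n"
  proof -
    have "x\<^sup>2 * \<gamma> ^ n \<le> x\<^sup>2 * \<gamma>" using 3 by (intro mult_left_mono) auto
    also have "\<dots> \<le> s * 1" using gam by (simp add: mult.commute)
    also have "\<dots> \<le> s * x ^ n" using s0 4 by (intro mult_left_mono) auto
    finally show ?thesis .
  qed
  show "\<beta> ^ n * x\<^sup>2 \<le> (1 + s) * x ^ (2 * n)"
  proof -
    obtain k where n: "n = Suc k" using assms by (cases n) auto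
    have "\<beta> ^ k \<le> (x\<^sup>2) ^ k" using bet xs by (intro power_mono) auto
    then have "\<beta> * \<beta> ^ k * x\<^sup>2 \<le> (1 + s) * (x\<^sup>2) ^ k * x\<^sup>2"
      using bet s0 by (intro mult_mono) auto
    then show ?thesis by (simp add: n power_mult power_add power2_eq_square power_mult_distrib mult_ac)
  qed
qed

text \<open>For a vertex that loses \<open>n\<close> edges and receives their mixed weight
  \<open>h\<close> in return. If \<open>n > 0\<close>, the bound
  \<open>x ^ 2 * \<gamma> ^ n \<le> s * x ^ n\<close> makes the new weight at most
  \<open>\<kappa> * s\<close> on the yardstick, which gives all three conditions at once.\<close>

lemma elem_ok_scale:
  assumes "\<bar>r\<bar> * x ^ (k + D) \<le> \<kappa> * x\<^sup>2" "- 1 \<le> r * x ^ (k + D)" "k + D = 0 \<longrightarrow> - \<kappa> \<le> r"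
    and "\<bar>h\<bar> \<le> \<gamma> ^ n" "n = 0 \<longrightarrow> h = 1" "k + D = E + n"
  shows "\<bar>r * h\<bar> * x ^ E \<le> \<kappa> * x\<^sup>2 \<and> - 1 \<le> r * h * x ^ E \<and> (E = 0 \<longrightarrow> - \<kappa> \<le> r * h)"
proof (cases "n = 0")
  case True
  then show ?thesis using assms by simp
next
  case False
  then have n: "0 < n" by simp
  have k0: "0 < \<kappa>" "\<kappa> < 1" using kap s0 by auto
  have xp: "0 < x ^ i" for i using x1 by simp
  have "\<bar>r * h\<bar> * x ^ E * x ^ n = (\<bar>r\<bar> * x ^ (E + n)) * \<bar>h\<bar>"
    by (simp add: abs_mult power_add mult_ac)
  also have "\<dots> \<le> (\<kappa> * x\<^sup>2) * \<gamma> ^ n"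
    using assms(1,4,6) k0 gam(1) mult_mono[of "\<bar>r\<bar> * x ^ (E + n)" "\<kappa> * x\<^sup>2" "\<bar>h\<bar>" "\<gamma> ^ n"] by simp
  also have "\<dots> \<le> \<kappa> * (s * x ^ n)"
    using gam_pow(2)[OF n] k0 by (simp add: mult.assoc)
  finally have "\<bar>r * h\<bar> * x ^ E * x ^ n \<le> (\<kappa> * s) * x ^ n" by simp
  then have 1: "\<bar>r * h\<bar> * x ^ E \<le> \<kappa> * s"
    using xp[of n] by simp
  have 2: "\<kappa> * s \<le> \<kappa> * 1" "\<kappa> * 1 \<le> \<kappa> * x\<^sup>2"
    using k0 s0 xs by (intro mult_left_mono; linarith)+
  have "- (\<bar>r * h\<bar> * x ^ E) \<le> r * h * x ^ E"
    using mult_right_mono[of "- \<bar>r * h\<bar>" "r * h" "x ^ E"] xp[of E] by (simp add: abs_ge_minus_self minus_le_iff)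
  moreover have "E = 0 \<Longrightarrow> - \<kappa> \<le> r * h"
    using 1 2 by (auto simp: abs_le_iff)
  ultimately show ?thesis
    using 1 2 k0 by linarith
qed

text \<open>\<open>upd_in\<close> turns free edges into pinned ones, so \<open>k + D\<close> is
  unchanged. The edges to \<open>u\<close> in \<open>upd_out\<close> and the old pinned edges in
  \<open>upd_only\<close> disappear and leave a mixed weight in \<open>r\<close>, which is the
  situation of \<open>elem_ok_scale\<close>.\<close>

lemma state_ok_upd:
  assumes "state_ok k ((u, r, g, b) # L)"
  shows "state_ok k (upd_out G u L)" "state_ok (\<lambda>v. k v + m u v) (upd_in G B u L)" "state_ok (m u) (upd_only G B u L)"
proof -
  have i: "elem_ok (k v) (m u v + deg L v) (v, r', g', b')" if "(v, r', g', b') \<in> set L" for v r' g' b'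
  proof -
    have "elem_ok (k v) (deg ((u, r, g, b) # L) v) (v, r', g', b')"
      using assms that unfolding state_ok_def by (metis fst_conv list.set_intros(2))
    then show ?thesis by (simp add: deg_def sym(3)[of v u])
  qed
  have deg: "deg (upd_out G u L) = deg L" "deg (upd_in G B u L) = deg L" "deg (upd_only G B u L) = deg L"
    by (auto simp: deg_def upd_out_def upd_in_def upd_only_def comp_def case_prod_unfold)
  show "state_ok k (upd_out G u L)"
    unfolding state_ok_def deg
  proof
    fix e assume "e \<in> set (upd_out G u L)"
    then obtain v r' g' b' where *: "(v, r', g', b') \<in> set L" "e = (v, r' * G u v, g', b')"
      by (auto simp: upd_out_def)
    note i = i[OF *(1), unfolded elem_ok_def prod.case]
    show "elem_ok (k (fst e)) (deg L (fst e)) e"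
    proof -
      have "\<bar>r' * G u v\<bar> * x ^ (k v + deg L v) \<le> \<kappa> * x\<^sup>2 \<and> - 1 \<le> r' * G u v * x ^ (k v + deg L v) \<and>
          (k v + deg L v = 0 \<longrightarrow> - \<kappa> \<le> r' * G u v)"
        by (rule elem_ok_scale[of r' "k v" "m u v + deg L v" _ "m u v"]) (use i G_le triv in auto)
      with i show ?thesis unfolding elem_ok_def *(2) prod.case fst_conv
        by - (elim conjE, intro conjI; (assumption | (rule impI, simp)))
    qed
  qed
  show "state_ok (m u) (upd_only G B u L)"
    unfolding state_ok_def deg
  proof
    fix e assume "e \<in> set (upd_only G B u L)"
    then obtain v r' g' b' where *: "(v, r', g', b') \<in> set L" "e = (v, r' * g', G u v, B u v)"
      by (auto simp: upd_only_def)
    note i = i[OF *(1), unfolded elem_ok_def prod.case]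
    show "elem_ok (m u (fst e)) (deg L (fst e)) e"
    proof -
      have "\<bar>r' * g'\<bar> * x ^ (m u v + deg L v) \<le> \<kappa> * x\<^sup>2 \<and> - 1 \<le> r' * g' * x ^ (m u v + deg L v) \<and>
          (m u v + deg L v = 0 \<longrightarrow> - \<kappa> \<le> r' * g')"
        by (rule elem_ok_scale[of r' "k v" "m u v + deg L v" _ "k v"]) (use i in auto)
      with G_le[of u v] triv[of u v] B_ge[of u v] B_le[of u v]
      show ?thesis unfolding elem_ok_def *(2) prod.case fst_conv
        by - (elim conjE, intro conjI; (assumption | (rule impI, simp)))
    qed
  qed
  show "state_ok (\<lambda>v. k v + m u v) (upd_in G B u L)"
    unfolding state_ok_def deg
  proof
    fix e assume "e \<in> set (upd_in G B u L)"
    then obtain v r' g' b' where *: "(v, r', g', b') \<in> set L" "e = (v, r', g' * G u v, b' * B u v)"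
      by (auto simp: upd_in_def)
    note i = i[OF *(1), unfolded elem_ok_def prod.case]
    have "\<bar>g' * G u v\<bar> \<le> \<gamma> ^ k v * \<gamma> ^ m u v"
      unfolding abs_mult using i G_le gam by (intro mult_mono) auto
    moreover have "b' * B u v \<le> \<beta> ^ k v * \<beta> ^ m u v"
      using i B_le B_ge bet by (intro mult_mono) auto
    ultimately show "elem_ok (k (fst e) + m u (fst e)) (deg L (fst e)) e"
      using i triv[of u v] B_ge[of u v] unfolding elem_ok_def *(2) prod.case fst_conv power_add add.assoc
      by auto
  qed
qed

lemma pend_upd:
  "pend k (upd_out G u L) = pend k L" "pend (\<lambda>v. k v + m u v) (upd_in G B u L) = pend k L + deg L u"
  "pend (m u) (upd_only G B u L) = deg L u"
  by (auto simp: pend_def deg_def upd_out_def upd_in_def upd_only_def comp_def case_prod_unfold sum_list_addf)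

lemma pick_pend:
  assumes "state_ok k L"
  shows "pick L = None \<Longrightarrow> pend k L = 0"
    "pick L = Some ((u, r, g, b), L') \<Longrightarrow> 0 < k u"
proof -
  have *: "k v = 0 \<longleftrightarrow> \<not> g < 1" if "(v, r, g, b) \<in> set L" for v r g b
  proof -
    have i: "\<bar>g\<bar> \<le> \<gamma> ^ k v" "k v = 0 \<longrightarrow> g = 1"
      using assms that by (force simp: state_ok_def elem_ok_def)+
    have "k v \<noteq> 0 \<Longrightarrow> \<gamma> ^ k v < 1"
      using gam gam_small by (simp add: power_less_one_iff)
    then show ?thesis using i by force
  qed
  show "pick L = None \<Longrightarrow> pend k L = 0"
    using * pick_NoneD by (fastforce simp: pend_def)
  show "pick L = Some ((u, r, g, b), L') \<Longrightarrow> 0 < k u"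
    using *[of u r g b] pick_SomeD[of L u r g b L'] by auto
qed

lemma sum_in_eq_sum_out: 
  assumes "state_ok k L" "pend k L = 0"
  shows "sum_in G B L = sum_out G B L"
proof -
  have "map (\<lambda>(v, r, g, b). (v, g, r * b)) L = map (\<lambda>(v, r, g, b). (v, 1, r * g)) L"
    using assms by (force simp: state_ok_def elem_ok_def pend_def)
  then show ?thesis by (simp only: sum_in_def sum_out_def)
qed

section \<open>One step of the recurrence at a vertex with a pinned edge\<close>

context
  fixes u k D K :: nat and r g b :: real
  assumes i: "elem_ok k D (u, r, g, b)" and k: "0 < k" "k \<le> K"
begin

lemma i': "\<bar>r\<bar> * x ^ k * x ^ D \<le> \<kappa> * x\<^sup>2" "- 1 \<le> r * x ^ k * x ^ D" "\<bar>g\<bar> \<le> \<gamma> ^ k" "0 \<le> b" "b \<le> \<beta> ^ k"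
  using i by (auto simp: elem_ok_def power_add mult_ac)

lemma xp: "0 < x ^ n" using x1 by simp

lemma xK: "x ^ K = x ^ (K - k) * x ^ k"
  using k by (simp flip: power_add)

lemma kap01: "0 < \<kappa>" "\<kappa> < 1" using kap s0 by auto

lemma bnd1: 
  assumes "\<bar>N\<bar> \<le> e * x ^ (K - k)"
  shows "\<bar>g * N\<bar> \<le> s * e * x ^ K" "\<bar>g * N\<bar> * x\<^sup>2 \<le> s * e * x ^ K"
proof -
  have e: "0 \<le> e * x ^ (K - k)" using assms by linarith
  have 1: "\<bar>g * N\<bar> \<le> \<gamma> ^ k * (e * x ^ (K - k))"
    unfolding abs_mult using assms i'(3) gam by (intro mult_mono) auto
  also have "\<dots> \<le> (s * x ^ k) * (e * x ^ (K - k))"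
    using gam_pow(1)[OF k(1)] e by (intro mult_right_mono) auto
  finally show "\<bar>g * N\<bar> \<le> s * e * x ^ K" by (simp add: xK mult_ac)
  have "\<bar>g * N\<bar> * x\<^sup>2 \<le> \<gamma> ^ k * (e * x ^ (K - k)) * x\<^sup>2"
    using 1 by (intro mult_right_mono) auto
  also have "\<dots> = (x\<^sup>2 * \<gamma> ^ k) * (e * x ^ (K - k))" by simp
  also have "\<dots> \<le> (s * x ^ k) * (e * x ^ (K - k))"
    using gam_pow(2)[OF k(1)] e by (intro mult_right_mono) auto
  finally show "\<bar>g * N\<bar> * x\<^sup>2 \<le> s * e * x ^ K" by (simp add: xK mult_ac)
qed

text \<open>The dominant branch: the bound on \<open>r\<close> pays for the \<open>D\<close> newly
  pinned edges, and \<open>\<beta> ^ k * x ^ 2\<close> is charged to the \<open>k\<close> pinned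
  edges that disappear and the \<open>k\<close> in the bound on \<open>r\<close>.\<close>

lemma bnd2: 
  assumes "\<bar>N\<bar> \<le> e * x ^ (K - k + D)"
  shows "\<bar>r * b * N\<bar> \<le> \<kappa> * (1 + s) * e * x ^ K"
proof -
  have e: "0 \<le> e * x ^ (K - k + D)" using assms by linarith
  then have e0: "0 \<le> e" using xp[of "K - k + D"] by (simp add: zero_le_mult_iff)
  have "\<bar>r * b * N\<bar> * x ^ k \<le> \<bar>r\<bar> * \<beta> ^ k * (e * x ^ (K - k + D)) * x ^ k"
    unfolding abs_mult using assms i'(4,5) bet xp x1
    by (intro mult_right_mono mult_mono) auto
  also have "\<dots> = (\<bar>r\<bar> * x ^ k * x ^ D) * (\<beta> ^ k * e * x ^ (K - k))"
    by (simp add: power_add)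
  also have "\<dots> \<le> (\<kappa> * x\<^sup>2) * (\<beta> ^ k * e * x ^ (K - k))"
    using i'(1) bet e0 xp[of "K - k"] by (intro mult_right_mono) auto
  also have "\<dots> = (\<beta> ^ k * x\<^sup>2) * (\<kappa> * e * x ^ (K - k))" by simp
  also have "\<dots> \<le> ((1 + s) * x ^ (2 * k)) * (\<kappa> * e * x ^ (K - k))"
    using gam_pow(3)[OF k(1)] e0 xp[of "K - k"] kap01 by (intro mult_right_mono) auto
  also have "\<dots> = (\<kappa> * (1 + s) * e * x ^ K) * x ^ k"
    by (simp add: xK mult_2 power_add)
  finally show ?thesis using xp[of k] by simp
qed

lemma bnd3: 
  assumes "\<bar>N\<bar> \<le> e * x ^ D"
  shows "\<bar>r * g * N\<bar> \<le> s * e"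
proof -
  have e: "0 \<le> e * x ^ D" using assms by linarith
  then have e0: "0 \<le> e" using xp[of "D"] by (simp add: zero_le_mult_iff)
  have "\<bar>r * g * N\<bar> * x ^ k \<le> \<bar>r\<bar> * \<gamma> ^ k * (e * x ^ D) * x ^ k"
    unfolding abs_mult using assms i'(3) gam xp x1
    by (intro mult_right_mono mult_mono) auto
  also have "\<dots> = (\<bar>r\<bar> * x ^ k * x ^ D) * (\<gamma> ^ k * e)"
    by simp
  also have "\<dots> \<le> (\<kappa> * x\<^sup>2) * (\<gamma> ^ k * e)"
    using i'(1) gam e0 by (intro mult_right_mono) auto
  also have "\<dots> = (x\<^sup>2 * \<gamma> ^ k) * (\<kappa> * e)" by simp
  also have "\<dots> \<le> (s * x ^ k) * (1 * e)"
    using gam_pow(2)[OF k(1)] e0 kap01 s0 xp[of k] by (intro mult_mono[OF _ mult_right_mono]) auto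
  also have "\<dots> = (s * e) * x ^ k" by simp
  finally show ?thesis using xp[of k] by simp
qed

text \<open>For \<open>r \<ge> 0\<close> the lower bound on \<open>N\<close> suffices because
  \<open>(1 + 4 * s) * \<kappa> \<le> 1\<close>. For \<open>r < 0\<close> the bound on the absolute
  value of \<open>N\<close> is used, with \<open>- 1 \<le> r * x ^ (k + D)\<close> saving the factor
  \<open>\<kappa> * x ^ 2\<close>.\<close>

lemma bnd4: 
  assumes "\<bar>N\<bar> \<le> x ^ (K - k + D)" "- (1 + 4 * s) * x ^ (K - k + D) \<le> N * x\<^sup>2"
  shows "- (1 + s) * x ^ K \<le> r * b * N * x\<^sup>2"
proof (cases "0 \<le> r")
  case True
  have "(- (1 + 4 * s) * x ^ (K - k + D)) * (r * b * x ^ k) \<le> (N * x\<^sup>2) * (r * b * x ^ k)"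
    using assms True i' xp[of k] by (intro mult_right_mono) auto
  moreover have "r * x ^ k * x ^ D * (b * x ^ (K - k) * (1 + 4 * s)) \<le> \<kappa> * x\<^sup>2 * (\<beta> ^ k * x ^ (K - k) * (1 + 4 * s))"
    by (rule mult_mono) (use i' True xp[of "K - k"] kap01 s0 in \<open>auto intro!: mult_right_mono\<close>)
  moreover have "(\<kappa> * (1 + 4 * s) * x ^ (K - k)) * (\<beta> ^ k * x\<^sup>2) \<le>
     (1 * x ^ (K - k)) * ((1 + s) * (x ^ k * x ^ k))"
    using gam_pow(3)[OF k(1), unfolded mult_2 power_add] xp[of "K - k"] kap01 s0 bet 
    by (intro mult_mono[OF mult_right_mono]) (auto simp: kap algebra_simps)
  ultimately have "(- (1 + s) * x ^ K) * x ^ k \<le> (r * b * N * x\<^sup>2) * x ^ k"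
    by (simp add: xK mult_2 power_add algebra_simps)
  then show ?thesis using xp[of k] by simp
next
  case False
  have "\<bar>r * b * N\<bar> * x ^ k \<le> (- r) * \<beta> ^ k * (x ^ (K - k + D)) * x ^ k"
    unfolding abs_mult using assms(1) i'(4,5) bet xp x1 False
    by (intro mult_right_mono mult_mono) (auto simp: mult_le_0_iff)
  also have "\<dots> = (- (r * x ^ k * x ^ D)) * (\<beta> ^ k * x ^ (K - k))"
    by (simp add: power_add)
  also have "\<dots> \<le> 1 * (\<beta> ^ k * x ^ (K - k))"
    using i'(2) bet xp[of "K - k"] by (intro mult_right_mono) auto
  finally have "\<bar>r * b * N\<bar> * x ^ k * x\<^sup>2 \<le> (\<beta> ^ k * x ^ (K - k)) * x\<^sup>2"
    by (intro mult_right_mono) auto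
  also have "\<dots> = (\<beta> ^ k * x\<^sup>2) * x ^ (K - k)" by simp
  also have "\<dots> \<le> ((1 + s) * x ^ (2 * k)) * x ^ (K - k)"
    using gam_pow(3)[OF k(1)] xp[of "K - k"] by (intro mult_right_mono) auto
  also have "\<dots> = ((1 + s) * x ^ K) * x ^ k"
    by (simp add: xK mult_2 power_add)
  finally have "(\<bar>r * b * N\<bar> * x\<^sup>2) * x ^ k \<le> ((1 + s) * x ^ K) * x ^ k"
    by (simp add: mult_ac)
  then have "\<bar>r * b * N\<bar> * x\<^sup>2 \<le> (1 + s) * x ^ K" using xp[of k] by simp
  moreover have "- \<bar>r * b * N\<bar> * x\<^sup>2 \<le> r * b * N * x\<^sup>2" by (intro mult_right_mono) auto
  ultimately show ?thesis unfolding mult_minus_left by (meson minus_le_iff order.trans)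
qed

lemma denom:
  assumes "\<bar>N3\<bar> \<le> x ^ D"
  shows "1 - s \<le> 1 + r * g * N3"
  using bnd3[of N3 1] assms by (auto simp: abs_le_iff)

text \<open>The numerator is at most \<open>s + \<kappa> * (1 + s) \<le> 1 - 8 * s\<close> on the
  yardstick; a denominator of at least \<open>1 - s\<close> gives back one \<open>s\<close>.\<close>

lemma ratio_le:
  assumes "\<bar>N1\<bar> \<le> x ^ (K - k)" "\<bar>N2\<bar> \<le> x ^ (K - k + D)" "\<bar>N3\<bar> \<le> x ^ D"
  shows "\<bar>(g * N1 + r * b * N2) / (1 + r * g * N3)\<bar> \<le> (1 - 7 * s) * x ^ K"
proof -
  have d: "1 - s \<le> 1 + r * g * N3" using denom assms by simp
  have "\<bar>g * N1 + r * b * N2\<bar> \<le> (s + \<kappa> * (1 + s)) * x ^ K"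
    using bnd1(1)[of N1 1] bnd2[of N2 1] assms by (simp add: algebra_simps)
  also have "\<dots> \<le> ((1 - 7 * s) * (1 - s)) * x ^ K"
    using xp[of K] s0 by (intro mult_right_mono) (auto simp: kap algebra_simps)
  also have "\<dots> \<le> ((1 - 7 * s) * (1 + r * g * N3)) * x ^ K"
    using xp[of K] s0 d by (intro mult_right_mono mult_left_mono) auto
  finally show ?thesis
    using d s0 by (simp add: abs_divide pos_divide_le_eq mult_ac)
qed

text \<open>The constant reproduces itself: \<open>bnd4\<close> turns \<open>1 + 4 * s\<close> into
  \<open>1 + s\<close>, the branch with \<open>g\<close> adds \<open>s\<close>, and the denominator
  costs less than the remaining \<open>2 * s\<close>.\<close>

lemma ratio_ge:
  assumes "\<bar>N1\<bar> \<le> x ^ (K - k)" "\<bar>N2\<bar> \<le> x ^ (K - k + D)" "\<bar>N3\<bar> \<le> x ^ D"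
    "- (1 + 4 * s) * x ^ (K - k + D) \<le> N2 * x\<^sup>2"
  shows "- (1 + 4 * s) * x ^ K \<le> (g * N1 + r * b * N2) / (1 + r * g * N3) * x\<^sup>2"
proof -
  have d: "1 - s \<le> 1 + r * g * N3" using denom assms by simp
  have "- (g * N1 * x\<^sup>2) \<le> s * x ^ K"
    using bnd1(2)[of N1 1] assms(1) abs_ge_minus_self[of "g * N1 * x\<^sup>2"] by (simp add: abs_mult)
  then have "- ((g * N1 + r * b * N2) * x\<^sup>2) \<le> (1 + 2 * s) * x ^ K"
    using bnd4[of N2] assms by (simp add: algebra_simps)
  also have "\<dots> \<le> ((1 + 4 * s) * (1 - s)) * x ^ K"
  proof (intro mult_right_mono)
    have "s * s \<le> 1 / 10 * s" using s0 by (intro mult_right_mono) auto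
    then show "1 + 2 * s \<le> (1 + 4 * s) * (1 - s)" using s0 by (simp add: algebra_simps)
  qed (use xp[of K] in auto)
  also have "\<dots> \<le> ((1 + 4 * s) * (1 + r * g * N3)) * x ^ K"
    using xp[of K] s0 d by (intro mult_right_mono mult_left_mono) auto
  finally have "- (((1 + 4 * s) * (1 + r * g * N3)) * x ^ K) \<le> (g * N1 + r * b * N2) * x\<^sup>2"
    by linarith
  then have "- (1 + 4 * s) * x ^ K * (1 + r * g * N3) \<le> (g * N1 + r * b * N2) * x\<^sup>2"
    by (simp only: mult_minus_left mult_ac)
  then show ?thesis
    using d s0 by (simp add: pos_le_divide_eq)
qed

lemma ratio_err:
  assumes N: "\<bar>N1\<bar> \<le> x ^ (K - k)" "\<bar>N2\<bar> \<le> x ^ (K - k + D)" "\<bar>N3\<bar> \<le> x ^ D"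
    and M: "\<bar>M3\<bar> \<le> x ^ D"
    and e: "\<bar>N1 - M1\<bar> \<le> e * x ^ (K - k)" "\<bar>N2 - M2\<bar> \<le> e * x ^ (K - k + D)" "\<bar>N3 - M3\<bar> \<le> e * x ^ D"
  shows "\<bar>(g * N1 + r * b * N2) / (1 + r * g * N3) - (g * M1 + r * b * M2) / (1 + r * g * M3)\<bar> \<le>
    (1 - 6 * s) * e * x ^ K"
proof -
  define N where "N = (g * N1 + r * b * N2) / (1 + r * g * N3)"
  define M where "M = (g * M1 + r * b * M2) / (1 + r * g * M3)"
  have d: "1 - s \<le> 1 + r * g * N3" "1 - s \<le> 1 + r * g * M3" using denom assms by simp_all
  have e0: "0 \<le> e" using e(3) xp[of D] by (smt (verit) zero_le_mult_iff abs_ge_zero)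
  have Nle: "\<bar>N\<bar> \<le> x ^ K"
    using ratio_le[OF N] xp[of K] s0 mult_right_mono[of "1 - 7 * s" 1 "x ^ K"] unfolding N_def by linarith
  have eqs: "N * (1 + r * g * N3) = g * N1 + r * b * N2" "M * (1 + r * g * M3) = g * M1 + r * b * M2"
    using d s0 by (auto simp: N_def M_def)
  \<comment> \<open>Subtracting the cross-multiplied equations makes the three errors enter
    linearly. The third is multiplied by the bounded quantity \<open>N\<close>, so it costs only
    another \<open>s\<close>.\<close>
  have "(N - M) * (1 + r * g * M3) =
      g * (N1 - M1) + r * b * (N2 - M2) - r * g * (N3 - M3) * N"
    using eqs by algebra
  then have "\<bar>N - M\<bar> * \<bar>1 + r * g * M3\<bar> \<le> \<bar>g * (N1 - M1)\<bar> + \<bar>r * b * (N2 - M2)\<bar> + \<bar>r * g * (N3 - M3) * N\<bar>"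
    unfolding abs_mult[symmetric] by linarith
  also have "\<dots> \<le> s * e * x ^ K + \<kappa> * (1 + s) * e * x ^ K + (s * e) * x ^ K"
  proof -
    have "\<bar>r * g * (N3 - M3)\<bar> * \<bar>N\<bar> \<le> (s * e) * x ^ K"
      using bnd3[OF e(3)] Nle e0 s0 by (intro mult_mono) auto
    then show ?thesis
      using bnd1(1)[OF e(1)] bnd2[OF e(2)] unfolding abs_mult[of "r * g * (N3 - M3)" N] by linarith
  qed
  also have "\<dots> = (2 * s + \<kappa> * (1 + s)) * (e * x ^ K)" by (simp add: algebra_simps)
  also have "\<dots> \<le> ((1 - 6 * s) * (1 - s)) * (e * x ^ K)"
    using xp[of K] s0 e0 by (intro mult_right_mono) (auto simp: kap algebra_simps)
  also have "\<dots> \<le> ((1 - 6 * s) * \<bar>1 + r * g * M3\<bar>) * (e * x ^ K)"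
    using xp[of K] s0 d e0 by (intro mult_right_mono mult_left_mono) auto
  finally have "\<bar>N - M\<bar> * \<bar>1 + r * g * M3\<bar> \<le> ((1 - 6 * s) * e * x ^ K) * \<bar>1 + r * g * M3\<bar>"
    by (simp add: mult_ac)
  moreover have "0 < \<bar>1 + r * g * M3\<bar>" using d s0 by linarith
  ultimately have "\<bar>N - M\<bar> \<le> (1 - 6 * s) * e * x ^ K" by (simp only: mult_le_cancel_right_pos)
  then show ?thesis by (simp add: N_def M_def)
qed

end

lemma xpos: "0 < x ^ n" using x1 by simp

text \<open>Each case uses its own one-sided bound: the lower bound on \<open>N\<close> for
  \<open>r \<ge> 0\<close>, the bound \<open>- \<kappa> \<le> r\<close> for an isolated vertex, and
  otherwise the gap \<open>1 - 7 * s\<close> with \<open>- 1 \<le> r * x ^ D\<close>. The smallest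
  margin comes from \<open>(1 + 4 * s) * \<kappa> \<le> 1 - 6 * s\<close>.\<close>

lemma root_ge:
  assumes "elem_ok 0 D (u, r, g, b)" "\<bar>N\<bar> \<le> x ^ D" "0 < D \<longrightarrow> \<bar>N\<bar> \<le> (1 - 7 * s) * x ^ D"
    "- (1 + 4 * s) * x ^ D \<le> N * x\<^sup>2" "D = 0 \<longrightarrow> N = 1"
  shows "6 * s \<le> 1 + r * N"
proof -
  have r: "\<bar>r\<bar> * x ^ D \<le> \<kappa> * x\<^sup>2" "- 1 \<le> r * x ^ D" "D = 0 \<longrightarrow> - \<kappa> \<le> r"
    using assms(1) by (auto simp: elem_ok_def)
  consider "0 \<le> r" | "r < 0" "D = 0" | "r < 0" "0 < D" by linarith
  then show ?thesis
  proof cases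
    case 1
    have "(1 + 4 * s) * (r * x ^ D) \<le> (1 + 4 * s) * (\<kappa> * x\<^sup>2)"
      using r(1) 1 s0 by (intro mult_left_mono) auto
    moreover have "r * (- (1 + 4 * s) * x ^ D) \<le> r * (N * x\<^sup>2)"
      using assms(4) 1 by (intro mult_left_mono) auto
    ultimately have "- ((1 + 4 * s) * \<kappa>) * x\<^sup>2 \<le> (r * N) * x\<^sup>2"
      by (simp add: algebra_simps)
    then have "- ((1 + 4 * s) * \<kappa>) \<le> r * N"
      using xpos[of 2] by (simp only: mult_le_cancel_right_pos)
    moreover have "(1 + 4 * s) * \<kappa> \<le> 1 - 6 * s"
      by (simp add: kap algebra_simps)
    ultimately show ?thesis by linarith
  next
    case 2
    then show ?thesis using r assms(5) kap s0 by simp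
  next
    case 3
    have "\<bar>r * N\<bar> \<le> (- r) * ((1 - 7 * s) * x ^ D)"
      using 3 assms(3) by (simp add: abs_mult)
    also have "\<dots> = (- (r * x ^ D)) * (1 - 7 * s)" by simp
    also have "\<dots> \<le> 1 * (1 - 7 * s)"
      using r(2) s0 by (intro mult_right_mono) auto
    finally show ?thesis using s0 by (simp add: abs_le_iff)
  qed
qed

text \<open>The invariant of the induction. The gap and the lower bound serve the two signs of
  \<open>r\<close> in \<open>root_ge\<close>; the gap is conditional because without pinned edges
  the ratio is 1.\<close>

definition ratio_bounded :: "(nat \<Rightarrow> nat) \<Rightarrow> elem list \<Rightarrow> bool" where
  "ratio_bounded k L \<longleftrightarrow> 0 < sum_out G B L \<and> \<bar>sum_in G B L / sum_out G B L\<bar> \<le> x ^ pend k L \<and>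
    (0 < pend k L \<longrightarrow> \<bar>sum_in G B L / sum_out G B L\<bar> \<le> (1 - 7 * s) * x ^ pend k L) \<and>
    - (1 + 4 * s) * x ^ pend k L \<le> sum_in G B L / sum_out G B L * x\<^sup>2"

lemma ratio_Cons:
  fixes L u
  defines "Q \<equiv> sum_out G B (upd_out G u L)"
  assumes "Q \<noteq> 0"
  shows "sum_in G B ((u, r, g, b) # L) / sum_out G B ((u, r, g, b) # L) =
      (g * (sum_in G B (upd_out G u L) / sum_out G B (upd_out G u L)) +
       r * b * (sum_in G B (upd_in G B u L) / sum_out G B (upd_in G B u L))) /
      (1 + r * g * (sum_in G B (upd_only G B u L) / sum_out G B (upd_only G B u L)))"
proof -
  have "sum_in G B ((u, r, g, b) # L) = Q * (g * (sum_in G B (upd_out G u L) / Q) + r * b * (sum_in G B (upd_in G B u L) / Q))"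
    "sum_out G B ((u, r, g, b) # L) = Q * (1 + r * g * (sum_in G B (upd_only G B u L) / Q))"
    using assms by (auto simp: sum_in_Cons sum_out_Cons field_simps)
  then show ?thesis using assms by (simp add: sum_out_upd)
qed

lemma state_ok_ConsD: "state_ok k ((u, r, g, b) # L) \<Longrightarrow> elem_ok (k u) (deg L u) (u, r, g, b)"
  by (simp add: state_ok_def deg_def sym)

text \<open>Positivity holds for any head, by \<open>root_ge\<close> without and by
  \<open>denom\<close> with pinned edges. The bounds on the ratio need a pinned edge at the
  head.\<close>

lemma ratio_bounded_Cons:
  assumes state_ok: "state_ok k ((u, r, g, b) # L)"
    and IH: "\<And>k' L'. length L' = length L \<Longrightarrow> state_ok k' L' \<Longrightarrow> ratio_bounded k' L'"
  shows "0 < sum_out G B ((u, r, g, b) # L)" "0 < k u \<Longrightarrow> ratio_bounded k ((u, r, g, b) # L)"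
proof -
  note i = state_ok_ConsD[OF state_ok]
  have b: "ratio_bounded k (upd_out G u L)" "ratio_bounded (\<lambda>v. k v + m u v) (upd_in G B u L)" "ratio_bounded (m u) (upd_only G B u L)"
    using state_ok_upd[OF state_ok] by (auto intro!: IH)
  note b = b[unfolded ratio_bounded_def pend_upd]
  have O: "0 < sum_out G B (upd_out G u L)" using b by blast
  have O': "sum_out G B ((u, r, g, b) # L) = sum_out G B (upd_out G u L) * (1 + r * g * (sum_in G B (upd_only G B u L) / sum_out G B (upd_only G B u L)))"
    using O by (simp add: sum_out_Cons sum_out_upd field_simps)
  show pos: "0 < sum_out G B ((u, r, g, b) # L)"
  proof (cases "k u = 0")
    case True
    have "deg L u = 0 \<longrightarrow> sum_in G B (upd_only G B u L) / sum_out G B (upd_only G B u L) = 1"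
      using sum_in_eq_sum_out[OF state_ok_upd(3)[OF state_ok]] b by (simp add: pend_upd)
    then have "6 * s \<le> 1 + r * (sum_in G B (upd_only G B u L) / sum_out G B (upd_only G B u L))"
      using b i True by (intro root_ge[of "deg L u" u r g b]) auto
    moreover have "g = 1" using i True by (simp add: elem_ok_def)
    ultimately show ?thesis using O s0 unfolding O' by (intro mult_pos_pos) auto
  next
    case False
    have "1 - s \<le> 1 + r * g * (sum_in G B (upd_only G B u L) / sum_out G B (upd_only G B u L))"
      using b False by (intro denom[OF i, of "k u"]) auto
    then show ?thesis using O s0 by (simp add: O')
  qed
  define K where "K = pend k ((u, r, g, b) # L)"
  have K: "k u \<le> K" "pend k L = K - k u" by (auto simp: K_def pend_def)
  note b = b[unfolded K(2)]
  show "ratio_bounded k ((u, r, g, b) # L)" if u: "0 < k u"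
    unfolding ratio_bounded_def K_def[symmetric]
  proof (intro conjI impI)
    note rc = ratio_Cons[OF less_imp_neq[OF O, symmetric]]
    show 1: "\<bar>sum_in G B ((u, r, g, b) # L) / sum_out G B ((u, r, g, b) # L)\<bar> \<le> (1 - 7 * s) * x ^ K"
      unfolding rc using b by - (rule ratio_le[OF i u K(1)], (elim conjE, assumption)+)
    then show "\<bar>sum_in G B ((u, r, g, b) # L) / sum_out G B ((u, r, g, b) # L)\<bar> \<le> x ^ K"
      using mult_right_mono[of "1 - 7 * s" 1 "x ^ K"] s0 xpos[of K] by linarith
    show "- (1 + 4 * s) * x ^ K \<le> sum_in G B ((u, r, g, b) # L) / sum_out G B ((u, r, g, b) # L) * x\<^sup>2"
      unfolding rc using b by - (rule ratio_ge[OF i u K(1)], (elim conjE, assumption)+)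
  qed fact
qed

lemma ratio_bounded: "state_ok k L \<Longrightarrow> ratio_bounded k L"
proof (induction "length L" arbitrary: k L)
  case 0
  moreover have "- 1 - 4 * s \<le> x\<^sup>2" using s0 xs by linarith
  ultimately show ?case using s0 x1 by (simp add: ratio_bounded_def pend_def)
next
  case (Suc n)
  have *: "0 < sum_out G B ((u, r, g, b) # L')" "0 < k u \<Longrightarrow> ratio_bounded k ((u, r, g, b) # L')"
    if "state_ok k ((u, r, g, b) # L')" "length L' = n" for u r g b L'
    using ratio_bounded_Cons[OF that(1)] Suc.hyps(1) that(2) by auto
  have pos: "0 < sum_out G B L"
    using Suc.hyps(2) Suc.prems *(1) by (cases L) auto
  show ?case
  proof (cases "pick L")
    case None
    then have "pend k L = 0" using pick_pend Suc.prems by blast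
    moreover have "1 \<le> x\<^sup>2" using xs s0 by linarith
    ultimately show ?thesis using sum_in_eq_sum_out[of k L] Suc.prems pos s0 by (simp add: ratio_bounded_def)
  next
    case (Some p)
    then obtain u r g b L' where p: "pick L = Some ((u, r, g, b), L')"
      by (metis prod_cases3 surj_pair)
    then obtain xs ys where L: "L = xs @ (u, r, g, b) # ys" "L' = xs @ ys"
      using pick_SomeD by blast
    have "0 < k u" using p pick_pend Suc.prems by blast
    moreover have "state_ok k ((u, r, g, b) # L')" using Suc.prems by (simp add: L state_ok_move)
    ultimately have "ratio_bounded k ((u, r, g, b) # L')" using Suc.hyps(2) L by (intro *(2)) auto
    then show ?thesis unfolding ratio_bounded_def L sum_move pend_move .
  qed
qed

text \<open>The bound on the computed ratio is proved along with its error, since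
  \<open>ratio_err\<close> needs it to keep the computed denominator away from 0.\<close>

lemma ratio_approx:
  assumes "state_ok k L"
  shows "\<bar>ratio G B l L\<bar> \<le> x ^ pend k L \<and>
    \<bar>sum_in G B L / sum_out G B L - ratio G B l L\<bar> \<le> (1 - 6 * s) ^ l * x ^ pend k L"
  using assms
proof (induction l arbitrary: k L)
  case 0
  then show ?case
    using ratio_bounded[OF 0] pick_pend(1)[OF 0] sum_in_eq_sum_out[OF 0] x1
    by (auto split: option.splits simp: ratio_bounded_def)
next
  case (Suc l)
  note b = ratio_bounded[OF Suc.prems]
  show ?case
  proof (cases "pick L")
    case None
    then show ?thesis 
      using pick_pend(1)[OF Suc.prems] sum_in_eq_sum_out[OF Suc.prems] b s0 by (simp add: ratio_bounded_def)
  next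
    case (Some p)
    then obtain u r g b L' where p: "pick L = Some ((u, r, g, b), L')"
      by (metis prod_cases3 surj_pair)
    then obtain xs ys where L: "L = xs @ (u, r, g, b) # ys" "L' = xs @ ys"
      using pick_SomeD by blast
    have u: "0 < k u" using p pick_pend Suc.prems by blast
    have state_ok: "state_ok k ((u, r, g, b) # L')" using Suc.prems by (simp add: L state_ok_move)
    have eq: "sum_in G B L / sum_out G B L = sum_in G B ((u, r, g, b) # L') / sum_out G B ((u, r, g, b) # L')"
      by (simp add: L sum_move)
    define K where "K = pend k L"
    have K: "k u \<le> K" "pend k L' = K - k u" by (auto simp: K_def L pend_def)
    note i = state_ok_ConsD[OF state_ok]
    note B = state_ok_upd[OF state_ok, THEN ratio_bounded, unfolded ratio_bounded_def pend_upd K(2)]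
    note IH = Suc.IH[OF state_ok_upd(1)[OF state_ok]] Suc.IH[OF state_ok_upd(2)[OF state_ok]] Suc.IH[OF state_ok_upd(3)[OF state_ok]]
    note IH = IH[unfolded pend_upd K(2)]
    have O: "sum_out G B (upd_out G u L') \<noteq> 0" using B by auto
    have ratio: "ratio G B (Suc l) L = (g * ratio G B l (upd_out G u L') + r * b * ratio G B l (upd_in G B u L')) /
        (1 + r * g * ratio G B l (upd_only G B u L'))"
      by (simp add: p)
    have "\<bar>ratio G B (Suc l) L\<bar> \<le> (1 - 7 * s) * x ^ K"
      unfolding ratio using IH by - (rule ratio_le[OF i u K(1)], (elim conjE, assumption)+)
    then have "\<bar>ratio G B (Suc l) L\<bar> \<le> x ^ K"
      using mult_right_mono[of "1 - 7 * s" 1 "x ^ K"] s0 xpos[of K] by linarith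
    moreover have "\<bar>sum_in G B L / sum_out G B L - ratio G B (Suc l) L\<bar> \<le> (1 - 6 * s) * (1 - 6 * s) ^ l * x ^ K"
      unfolding ratio eq ratio_Cons[OF O] using IH B by - (rule ratio_err[OF i u K(1)], (elim conjE, assumption)+)
    ultimately show ?thesis unfolding K_def by simp
  qed
qed

text \<open>A factor \<open>1 + r * N\<close> has absolute error at most
  \<open>x ^ 2 * (1 - 6 * s) ^ l\<close>, and by \<open>root_ge\<close> it is at least
  \<open>6 * s\<close>. The quotient \<open>\<xi>\<close> thus bounds the relative error per
  vertex.\<close>

lemma chain_estimate_approx:
  assumes "state_ok (\<lambda>_. 0) L" and \<xi>: "\<xi> = x\<^sup>2 * (1 - 6 * s) ^ l / (6 * s)" "\<xi> \<le> 1"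
  shows "(1 - \<xi>) ^ length L * sum_out G B L \<le> chain_estimate G B l L" "chain_estimate G B l L \<le> (1 + \<xi>) ^ length L * sum_out G B L"
proof -
  have "(1 - \<xi>) ^ length L * sum_out G B L \<le> chain_estimate G B l L \<and> chain_estimate G B l L \<le> (1 + \<xi>) ^ length L * sum_out G B L"
    using assms(1)
  proof (induction "length L" arbitrary: L)
    case 0
    then show ?case by simp
  next
    case (Suc n)
    then obtain u r g b L' where L: "L = (u, r, g, b) # L'" "length L' = n"
      by (metis length_Suc_conv prod_cases4)
    note state_ok = Suc.prems[unfolded L]
    note i = state_ok_ConsD[OF state_ok]
    note B = state_ok_upd[OF state_ok, THEN ratio_bounded, unfolded ratio_bounded_def pend_upd]
    have IH: "(1 - \<xi>) ^ n * sum_out G B (upd_out G u L') \<le> chain_estimate G B l (upd_out G u L')"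
      "chain_estimate G B l (upd_out G u L') \<le> (1 + \<xi>) ^ n * sum_out G B (upd_out G u L')"
      using Suc.hyps(1)[of "upd_out G u L'"] L state_ok_upd(1)[OF state_ok] by auto
    define N where "N = sum_in G B (upd_only G B u L') / sum_out G B (upd_only G B u L')"
    define M where "M = ratio G B l (upd_only G B u L')"
    have O: "0 < sum_out G B (upd_out G u L')" using B by blast
    have "g = 1" using i by (simp add: elem_ok_def)
    then have O': "sum_out G B L = sum_out G B (upd_out G u L') * (1 + r * N)"
      using O by (simp add: L sum_out_Cons sum_out_upd field_simps N_def)
    have "deg L' u = 0 \<longrightarrow> N = 1"
      using sum_in_eq_sum_out[OF state_ok_upd(3)[OF state_ok]] B by (simp add: pend_upd N_def)
    then have ge: "6 * s \<le> 1 + r * N"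
      unfolding N_def using B i by (intro root_ge[of "deg L' u" u r g b]) auto
    have \<xi>0: "0 \<le> \<xi>" using s0 \<xi> by simp
    have "\<bar>N - M\<bar> \<le> (1 - 6 * s) ^ l * x ^ deg L' u"
      using ratio_approx[OF state_ok_upd(3)[OF state_ok], of l] by (simp add: pend_upd N_def M_def)
    then have "\<bar>r * (N - M)\<bar> \<le> \<bar>r\<bar> * ((1 - 6 * s) ^ l * x ^ deg L' u)"
      unfolding abs_mult by (intro mult_left_mono) auto
    also have "\<dots> = (\<bar>r\<bar> * x ^ deg L' u) * (1 - 6 * s) ^ l" by simp
    also have "\<dots> \<le> (1 * x\<^sup>2) * (1 - 6 * s) ^ l"
    proof (intro mult_right_mono)
      have "\<kappa> * x\<^sup>2 \<le> 1 * x\<^sup>2" using kap s0 by (intro mult_right_mono) auto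
      then show "\<bar>r\<bar> * x ^ deg L' u \<le> 1 * x\<^sup>2" using i by (simp add: elem_ok_def)
    qed (use s0 in auto)
    also have "\<dots> = \<xi> * (6 * s)" using s0 by (simp add: \<xi>)
    also have "\<dots> \<le> \<xi> * (1 + r * N)" using ge \<xi>0 by (intro mult_left_mono) auto
    finally have r: "\<bar>r * (N - M)\<bar> \<le> \<xi> * (1 + r * N)" .
    have lo: "(1 - \<xi>) * (1 + r * N) \<le> 1 + r * M" and hi: "1 + r * M \<le> (1 + \<xi>) * (1 + r * N)"
      using r by (auto simp: abs_le_iff algebra_simps)
    have p: "0 \<le> (1 - \<xi>) * (1 + r * N)" using ge s0 \<xi>(2) by simp
    have chain_estimate: "chain_estimate G B l L = (1 + r * M) * chain_estimate G B l (upd_out G u L')" by (simp add: L M_def)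
    have pn: "0 \<le> (1 - \<xi>) ^ n * sum_out G B (upd_out G u L')" using \<xi>(2) O by simp
    have "((1 - \<xi>) * (1 + r * N)) * ((1 - \<xi>) ^ n * sum_out G B (upd_out G u L')) \<le> chain_estimate G B l L"
      unfolding chain_estimate using lo IH(1) p pn by (intro mult_mono) auto
    moreover have "chain_estimate G B l L \<le> ((1 + \<xi>) * (1 + r * N)) * ((1 + \<xi>) ^ n * sum_out G B (upd_out G u L'))"
      unfolding chain_estimate using hi IH(2) p lo pn IH(1) by (intro mult_mono) auto
    ultimately show ?case unfolding O' using L by (simp add: mult_ac)
  qed
  then show "(1 - \<xi>) ^ length L * sum_out G B L \<le> chain_estimate G B l L" "chain_estimate G B l L \<le> (1 + \<xi>) ^ length L * sum_out G B L"
    by auto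
qed

end

subsection \<open>Perturbed Fibonacci functions\<close>

text \<open>For nonnegative \<open>f\<close> and positive \<open>x\<close> this is the Fibonacci
  function with parameter \<open>x - 1 / x\<close> that starts with the first two entries of
  \<open>f\<close>.\<close>

definition twist :: "real \<Rightarrow> real list \<Rightarrow> nat \<Rightarrow> real" where
  "twist x f i = spin_scale x f * (x ^ i + spin_ratio x f * (x ^ (length f - 1 - i) * (- 1) ^ i))"

lemma twist_singleton: "twist x [f0] 0 = f0"
  by (simp add: twist_def spin_scale_def spin_ratio_def)

text \<open>Removes the degree: \<open>x\<close> and \<open>- 1 / x\<close> are the two roots of the
  recurrence with parameter \<open>x - 1 / x\<close>.\<close>

lemma twist_closed:
  assumes f: "f = f0 # f1 # f'" and nn: "0 \<le> f0" "0 \<le> f1" and x: "0 < x" and i: "i < length f"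
  shows "twist x f i = (f0 + x * f1) / (1 + x * x) * x ^ i + x * (x * f0 - f1) / (1 + x * x) * (- 1 / x) ^ i"
proof (cases "f0 + x * f1 = 0")
  case True
  then have "f0 = 0" "f1 = 0" using nn x by (auto simp: add_nonneg_eq_0_iff)
  then show ?thesis by (simp add: f twist_def spin_scale_def)
next
  case False
  define d where "d = length f - 1"
  have "x ^ d = x ^ (d - i) * x ^ i" using i by (simp add: d_def flip: power_add)
  moreover have "x ^ i * (- 1 / x) ^ i = (- 1) ^ i"
    unfolding power_mult_distrib[symmetric] using x by simp
  ultimately have A: "x ^ (d - i) * (- 1) ^ i = x ^ d * (- 1 / x) ^ i"
    by (simp only: mult.assoc)
  have B: "spin_scale x f * (spin_ratio x f * x ^ d) = x * (x * f0 - f1) / (1 + x * x)"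
    using False x by (simp add: spin_scale_def spin_ratio_def f d_def)
  have "twist x f i = spin_scale x f * x ^ i + spin_scale x f * (spin_ratio x f * x ^ d) * (- 1 / x) ^ i"
    unfolding twist_def d_def[symmetric] A by (simp add: distrib_left mult.assoc)
  then show ?thesis unfolding B by (simp add: spin_scale_def f)
qed

text \<open>The two sequences agree at 0 and 1, and their parameters differ by a factor between
  \<open>1 - \<eta>\<close> and \<open>1 + \<eta>\<close>. As no entry of \<open>f\<close> is
  negative, each step of the recurrence adds at most one such factor.\<close>

lemma twist_near:
  assumes f: "f \<noteq> []" "\<And>i. i < length f \<Longrightarrow> 0 \<le> f ! i"
    and rec: "\<And>i. i + 2 < length f \<Longrightarrow> f ! (i + 2) = c * f ! (i + 1) + f ! i"
    and x: "0 < x" and c: "0 < c" and \<eta>: "0 \<le> \<eta>" "\<eta> \<le> 1" "\<bar>x - 1 / x - c\<bar> \<le> c * \<eta>"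
    and i: "i < length f"
  shows "(1 - \<eta>) ^ i * f ! i \<le> twist x f i" "twist x f i \<le> (1 + \<eta>) ^ i * f ! i"
proof -
  have "(1 - \<eta>) ^ i * f ! i \<le> twist x f i \<and> twist x f i \<le> (1 + \<eta>) ^ i * f ! i"
  proof (cases "length f = 1")
    case True
    then obtain f0 where "f = [f0]" by (auto simp: length_Suc_conv)
    then show ?thesis using i twist_singleton by simp
  next
    case False
    then obtain f0 f1 f' where ff: "f = f0 # f1 # f'"
      using f(1) by (metis One_nat_def length_Cons list.exhaust list.size(3))
    have nn: "0 \<le> f0" "0 \<le> f1" using f(2)[of 0] f(2)[of 1] by (auto simp: ff)
    note cl = twist_closed[OF ff nn x]
    define a where "a = (f0 + x * f1) / (1 + x * x)"
    define b where "b = x * (x * f0 - f1) / (1 + x * x)"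
    have pos: "1 + x * x > 0" using x by (simp add: add_pos_pos)
    have t: "twist x f i = a * x ^ i + b * (- 1 / x) ^ i" if "i < length f" for i
      using cl[OF that] by (simp add: a_def b_def)
    have t0: "twist x f 0 = f ! 0"
    proof -
      have "a + b = (f0 * (1 + x * x)) / (1 + x * x)"
        unfolding a_def b_def add_divide_distrib[symmetric] by (simp add: algebra_simps)
      then show ?thesis using pos t[of 0] by (simp add: ff)
    qed
    have t1: "twist x f 1 = f ! 1"
    proof -
      have "b * (- 1 / x) = - ((x * f0 - f1) / (1 + x * x))" using x by (simp add: b_def)
      then have "a * x + b * (- 1 / x) = (f1 * (1 + x * x)) / (1 + x * x)"
        unfolding a_def times_divide_eq_left minus_divide_left
        by (simp only: add_divide_distrib[symmetric]) (simp add: algebra_simps)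
      then show ?thesis using pos t[of 1] by (simp add: ff)
    qed
    have t2: "twist x f (i + 2) = (x - 1 / x) * twist x f (i + 1) + twist x f i" if "i + 2 < length f" for i
    proof -
      have "x ^ (i + 2) = (x - 1 / x) * x ^ (i + 1) + x ^ i"
        using x by (simp add: field_simps)
      moreover have "(- 1 / x) ^ (i + 2) = (x - 1 / x) * (- 1 / x) ^ (i + 1) + (- 1 / x) ^ i"
        using x by (simp add: field_simps)
      ultimately show ?thesis using that by (simp only: t less_imp_le_nat) (simp add: t algebra_simps)
    qed
    have ct: "(1 - \<eta>) * c \<le> x - 1 / x" "x - 1 / x \<le> (1 + \<eta>) * c"
      using \<eta>(3) by (auto simp: abs_le_iff algebra_simps)
    have ct0: "0 \<le> (1 - \<eta>) * c" using \<eta> c by simp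
    show ?thesis using i
    proof (induction i rule: less_induct)
      case (less i)
      consider "i = 0" | "i = 1" | k where "i = k + 2" by (metis One_nat_def add_2_eq_Suc' not0_implies_Suc)
      then show ?case
      proof cases
        case 1
        then show ?thesis using t0 by simp
      next
        case 2
        have "0 \<le> f ! 1" using f(2) less.prems 2 by simp
        then have "0 \<le> \<eta> * f ! 1" using \<eta>(1) by simp
        then show ?thesis using t1 2 by (simp add: algebra_simps)
      next
        case (3 k)
        have IH: "(1 - \<eta>) ^ (k + 1) * f ! (k + 1) \<le> twist x f (k + 1)" "twist x f (k + 1) \<le> (1 + \<eta>) ^ (k + 1) * f ! (k + 1)"
          "(1 - \<eta>) ^ k * f ! k \<le> twist x f k" "twist x f k \<le> (1 + \<eta>) ^ k * f ! k"
          using less.IH[of "k + 1"] less.IH[of k] less.prems 3 by auto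
        have n: "0 \<le> f ! (k + 1)" "0 \<le> f ! k" using f(2) less.prems 3 by auto
        have lo: "((1 - \<eta>) * c) * ((1 - \<eta>) ^ (k + 1) * f ! (k + 1)) \<le> (x - 1 / x) * twist x f (k + 1)"
          using ct ct0 IH(1) n \<eta> by (intro mult_mono) auto
        have hi: "(x - 1 / x) * twist x f (k + 1) \<le> ((1 + \<eta>) * c) * ((1 + \<eta>) ^ (k + 1) * f ! (k + 1))"
          using ct ct0 IH n \<eta> c by (intro mult_mono) (auto intro: order_trans[of _ "(1 - \<eta>) ^ (k + 1) * f ! (k + 1)"])
        have "(1 - \<eta>) ^ (k + 2) \<le> (1 - \<eta>) ^ k" using \<eta> by (intro power_decreasing) auto
        then have lo': "(1 - \<eta>) ^ (k + 2) * f ! k \<le> (1 - \<eta>) ^ k * f ! k" using n by (intro mult_right_mono) auto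
        have "(1 + \<eta>) ^ k \<le> (1 + \<eta>) ^ (k + 2)" using \<eta> by (intro power_increasing) auto
        then have hi': "(1 + \<eta>) ^ k * f ! k \<le> (1 + \<eta>) ^ (k + 2) * f ! k" using n by (intro mult_right_mono) auto
        have fi: "f ! (k + 2) = c * f ! (k + 1) + f ! k" using rec[of k] less.prems 3 by simp
        have ti: "twist x f i = (x - 1 / x) * twist x f (k + 1) + twist x f k" using t2[of k] less.prems 3 by simp
        have "(1 - \<eta>) ^ i * f ! i = ((1 - \<eta>) * c) * ((1 - \<eta>) ^ (k + 1) * f ! (k + 1)) + (1 - \<eta>) ^ (k + 2) * f ! k"
          "(1 + \<eta>) ^ i * f ! i = ((1 + \<eta>) * c) * ((1 + \<eta>) ^ (k + 1) * f ! (k + 1)) + (1 + \<eta>) ^ (k + 2) * f ! k"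
          unfolding 3 fi by (simp_all add: algebra_simps)
        then show ?thesis using lo hi lo' hi' IH ti by linarith
      qed
    qed
  qed
  then show "(1 - \<eta>) ^ i * f ! i \<le> twist x f i" "twist x f i \<le> (1 + \<eta>) ^ i * f ! i" by auto
qed

lemma spin_scale_nonneg:
  assumes "\<And>i. i < length f \<Longrightarrow> 0 \<le> f ! i" "0 < x"
  shows "0 \<le> spin_scale x f"
proof (cases f)
  case (Cons f0 g)
  then show ?thesis using assms(1)[of 0] assms(1)[of 1] assms(2)
    by (cases g) (simp_all add: spin_scale_def)
qed (simp add: spin_scale_def)

text \<open>Let \<open>N = f0 + x * f1\<close>. If \<open>f1 \<le> x * f0\<close>, then
  \<open>N \<ge> (1 + p * x) * f0\<close> and the last condition on \<open>\<kappa>\<close> applies;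
  otherwise \<open>x * f1 \<le> N\<close> and the condition \<open>1 \<le> \<kappa> * x ^ 2\<close>
  does.\<close>

lemma spin_ratio_bounds:
  assumes "f \<noteq> []" "\<And>i. i < length f \<Longrightarrow> 0 \<le> f ! i" "1 < length f \<Longrightarrow> p * f ! 0 \<le> f ! 1"
    and p: "0 < p" and x: "0 < x" and k: "0 < \<kappa>" "1 \<le> \<kappa> * x\<^sup>2" "1 \<le> \<kappa> * (1 + p * x)"
  shows "\<bar>spin_ratio x f\<bar> * x ^ (length f - 1) \<le> \<kappa> * x\<^sup>2" "- 1 \<le> spin_ratio x f * x ^ (length f - 1)"
    "length f = 1 \<longrightarrow> - \<kappa> \<le> spin_ratio x f"
proof -
  obtain f0 g where f: "f = f0 # g" using assms(1) by (cases f) auto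
  have "\<bar>spin_ratio x f\<bar> * x ^ (length f - 1) \<le> \<kappa> * x\<^sup>2 \<and> - 1 \<le> spin_ratio x f * x ^ (length f - 1) \<and> (length f = 1 \<longrightarrow> - \<kappa> \<le> spin_ratio x f)"
  proof (cases g)
    case Nil
    then show ?thesis using k by (simp add: f spin_ratio_def)
  next
    case (Cons f1 f')
    have nn: "0 \<le> f0" "0 \<le> f1" "p * f0 \<le> f1" using assms(2)[of 0] assms(2)[of 1] assms(3) by (auto simp: f Cons)
    show ?thesis
    proof (cases "f0 + x * f1 = 0")
      case True
      then show ?thesis using k by (simp add: f Cons spin_ratio_def)
    next
      case False
      define N where "N = f0 + x * f1"
      have N: "0 < N" using False nn x by (simp add: N_def order_less_le)
      have v: "spin_ratio x f * x ^ (length f - 1) = x * (x * f0 - f1) / N"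
        using x by (simp add: spin_ratio_def f Cons N_def)
      have xf1: "0 \<le> x * f1" "0 \<le> x * f0" using nn x by auto
      have "x * \<bar>x * f0 - f1\<bar> \<le> \<kappa> * x\<^sup>2 * N"
      proof (cases "f1 \<le> x * f0")
        case True
        have "x * f0 \<le> (\<kappa> * (1 + p * x)) * (x * f0)"
          using mult_right_mono[OF k(3) xf1(2)] by simp
        also have "\<dots> = \<kappa> * x * (f0 + x * (p * f0))" by (simp add: algebra_simps)
        also have "\<dots> \<le> \<kappa> * x * N"
          unfolding N_def using nn k x by (intro mult_left_mono add_left_mono) auto
        finally have "x * f0 - f1 \<le> \<kappa> * x * N" using nn by linarith
        then have "x * (x * f0 - f1) \<le> x * (\<kappa> * x * N)" using x by (intro mult_left_mono) auto
        then show ?thesis using True by (simp add: power2_eq_square mult_ac)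
      next
        case False
        have "x * (f1 - x * f0) \<le> x * f1" using xf1 x by (intro mult_left_mono) auto
        also have "\<dots> \<le> (\<kappa> * x\<^sup>2) * (x * f1)" using mult_right_mono[OF k(2) xf1(1)] by simp
        also have "\<dots> \<le> (\<kappa> * x\<^sup>2) * N" unfolding N_def using nn k by (intro mult_left_mono) auto
        finally show ?thesis using False by simp
      qed
      then have 1: "\<bar>spin_ratio x f * x ^ (length f - 1)\<bar> \<le> \<kappa> * x\<^sup>2"
        unfolding v using N x by (simp add: abs_mult pos_divide_le_eq)
      have "0 \<le> x * (x * f0)" using xf1 x by simp
      then have "- N \<le> x * (x * f0 - f1)" unfolding N_def right_diff_distrib using nn by linarith
      then have 2: "- 1 \<le> spin_ratio x f * x ^ (length f - 1)"
        unfolding v using N by (simp add: pos_le_divide_eq)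
      show ?thesis using 1 2 x by (simp add: abs_mult f Cons)
    qed
  qed
  then show "\<bar>spin_ratio x f\<bar> * x ^ (length f - 1) \<le> \<kappa> * x\<^sup>2" "- 1 \<le> spin_ratio x f * x ^ (length f - 1)"
    "length f = 1 \<longrightarrow> - \<kappa> \<le> spin_ratio x f" by auto
qed

definition edge_count :: "(nat \<times> nat \<times> real) list \<Rightarrow> nat \<Rightarrow> nat \<Rightarrow> nat" where
  "edge_count es u w = length (filter (\<lambda>e. joins e u w) es)"

lemma joins_sym: "joins e u w = joins e w u"
  by (cases e) (auto simp: joins_def)

text \<open>An edge at \<open>v\<close> is counted once, at its other endpoint. This identifies
  \<open>deg\<close> of the initial state with the degree.\<close>

lemma sum_edge_count:
  assumes "\<forall>(a, b, l)\<in>set es. a < n \<and> b < n \<and> a \<noteq> b"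
  shows "(\<Sum>w\<leftarrow>[0..<n]. edge_count es v w) = length (filter (\<lambda>e. fst e = v \<or> fst (snd e) = v) es)"
  using assms
proof (induction es)
  case Nil
  show ?case by (simp add: edge_count_def)
next
  case (Cons e es)
  obtain a b l where e: "e = (a, b, l)" by (rule prod_cases3)
  have ab: "a < n" "b < n" "a \<noteq> b" using Cons.prems by (auto simp: e)
  have "(\<Sum>w\<leftarrow>[0..<n]. edge_count (e # es) v w) = (\<Sum>w\<leftarrow>[0..<n]. of_bool (joins e v w) + edge_count es v w)"
    by (intro arg_cong[where f = sum_list] map_cong) (auto simp: edge_count_def)
  also have "\<dots> = (\<Sum>w\<leftarrow>[0..<n]. of_bool (joins e v w)) + (\<Sum>w\<leftarrow>[0..<n]. edge_count es v w)"
    by (rule sum_list_addf)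
  also have "(\<Sum>w\<leftarrow>[0..<n]. of_bool (joins e v w)) = (\<Sum>w<n. of_bool (joins e v w) :: nat)"
    by (simp add: interv_sum_list_conv_sum_set_nat atLeast0LessThan)
  also have "\<dots> = card {w. w < n \<and> joins e v w}"
    by (simp add: of_bool_def sum.If_cases Collect_conj_eq[symmetric] lessThan_def)
  also have "{w. w < n \<and> joins e v w} = (if a = v then {b} else if b = v then {a} else {})"
    using ab by (auto simp: joins_def e)
  finally show ?case using Cons by (auto simp: e)
qed

text \<open>Supplies \<open>\<gamma> = \<theta> * x\<close> and
  \<open>\<beta> = 1 + \<theta> * x ^ 2\<close> for the spin system. The excess of the inner weight
  over 1 is \<open>(x * x - 1) * (1 - l)\<close> divided by a number that is at least 1.\<close>

lemma edge_weight_bounds: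
  assumes "0 \<le> l" "\<bar>l - 1\<bar> \<le> \<theta>" "1 \<le> x"
  shows "\<bar>mixed_weight x l\<bar> \<le> \<theta> * x" "0 \<le> inner_weight x l" "inner_weight x l \<le> 1 + \<theta> * x\<^sup>2"
proof -
  have D: "1 \<le> 1 + l * (x * x)" using assms by simp
  have "\<bar>mixed_weight x l\<bar> = \<bar>1 - l\<bar> * x / (1 + l * (x * x))"
    using D assms by (simp add: mixed_weight_def abs_mult)
  also have "\<dots> \<le> (\<bar>1 - l\<bar> * x) / 1"
    by (rule divide_left_mono) (use D assms in \<open>auto intro: add_pos_nonneg\<close>)
  also have "\<dots> \<le> \<theta> * x" using assms by (auto intro!: mult_right_mono)
  finally show "\<bar>mixed_weight x l\<bar> \<le> \<theta> * x" .
  show "0 \<le> inner_weight x l" using D assms by (auto simp: inner_weight_def intro!: divide_nonneg_nonneg)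
  have \<theta>: "0 \<le> \<theta>" using assms by linarith
  have xx: "1 \<le> x * x" using assms(3) mult_mono[of 1 x 1 x] by simp
  have "x * x + l \<le> (1 + \<theta> * (x * x)) * (1 + l * (x * x))"
  proof -
    have "(x * x - 1) * (1 - l) \<le> (x * x - 1) * \<theta>" using xx assms by (intro mult_left_mono) auto
    then have "(x * x - 1) * (1 - l) \<le> \<theta> * (x * x)" using \<theta> by (simp add: algebra_simps)
    moreover have "0 \<le> \<theta> * (x * x) * (l * (x * x))" using \<theta> assms by simp
    ultimately show ?thesis by (simp add: algebra_simps)
  qed
  then show "inner_weight x l \<le> 1 + \<theta> * x\<^sup>2" using D by (simp add: inner_weight_def pos_divide_le_eq power2_eq_square)
qed

lemma pair_bounds:
  assumes "\<forall>(a, b, l)\<in>set es. \<bar>mixed_weight x l\<bar> \<le> \<gamma> \<and> 0 \<le> inner_weight x l \<and> inner_weight x l \<le> \<beta>" "0 \<le> \<gamma>" "0 \<le> \<beta>"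
  shows "\<bar>pair_mixed x es u w\<bar> \<le> \<gamma> ^ edge_count es u w" "0 \<le> pair_inner x es u w" "pair_inner x es u w \<le> \<beta> ^ edge_count es u w"
proof -
  have "\<bar>pair_mixed x es u w\<bar> \<le> \<gamma> ^ edge_count es u w \<and> 0 \<le> pair_inner x es u w \<and> pair_inner x es u w \<le> \<beta> ^ edge_count es u w"
    using assms(1)
  proof (induction es)
    case (Cons e es)
    then show ?case using assms(2,3)
      by (auto simp: edge_count_def abs_mult case_prod_unfold intro!: mult_mono mult_nonneg_nonneg)
  qed (simp add: edge_count_def)
  then show "\<bar>pair_mixed x es u w\<bar> \<le> \<gamma> ^ edge_count es u w" "0 \<le> pair_inner x es u w" "pair_inner x es u w \<le> \<beta> ^ edge_count es u w"
    by auto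
qed

lemma pair_trivial: "edge_count es u w = 0 \<Longrightarrow> pair_mixed x es u w = 1" "edge_count es u w = 0 \<Longrightarrow> pair_inner x es u w = 1"
  by (induction es) (auto simp: edge_count_def split: if_splits)

lemma pair_sym: "pair_mixed x es u w = pair_mixed x es w u" "pair_inner x es u w = pair_inner x es w u"
  by (induction es) (simp_all add: joins_sym[of _ u w])

lemma initial_state_eq: "initial_state x i fs = map (\<lambda>j. (i + j, spin_ratio x (fs ! j), 1, 1)) [0..<length fs]"
proof (induction fs arbitrary: i)
  case (Cons f fs)
  have "[0..<length (f # fs)] = 0 # map Suc [0..<length fs]" by (simp add: map_Suc_upt upt_conv_Cons del: upt_Suc)
  then show ?case by (simp add: Cons comp_def del: upt_Suc)
qed simp

section \<open>Iterates towards the positive root\<close>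

context
  fixes c :: real
  assumes c: "0 < c"
begin

abbreviation iterate :: "nat \<Rightarrow> real" where "iterate l \<equiv> ((\<lambda>g. c + 1 / g) ^^ l) (1 + c)"

text \<open>The map is decreasing and sends \<open>1 + c\<close> to the left end of the interval;
  the left end is at least 1, so nothing in the interval is sent beyond
  \<open>1 + c\<close>.\<close>

lemma iterate_bounds: "c + 1 / (1 + c) \<le> iterate l \<and> iterate l \<le> 1 + c"
proof (induction l)
  case 0
  have "1 / (1 + c) \<le> 1" using c by simp
  then show ?case by simp
next
  case (Suc l)
  have ge1: "1 \<le> c + 1 / (1 + c)" using c by (simp add: field_simps)
  then have g: "1 \<le> iterate l" using Suc by linarith
  have "1 / (1 + c) \<le> 1 / iterate l" using Suc g by (intro divide_left_mono) auto
  moreover have "1 / iterate l \<le> 1" using g by simp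
  ultimately show ?case by simp
qed

lemma iterate_gt1: "1 < c + 1 / (1 + c)" using c by (simp add: field_simps)

text \<open>One iteration divides the residual \<open>g - 1 / g - c\<close> by
  \<open>- (c * g + 1)\<close>, and \<open>c * g + 1 \<ge> 1 + c\<close>.\<close>

lemma iterate_error: "\<bar>iterate l - 1 / iterate l - c\<bar> \<le> c * (1 / (1 + c)) ^ l"
proof (induction l)
  case 0
  have "1 + c - 1 / (1 + c) - c = c / (1 + c)" using c by (simp add: field_simps)
  moreover have "0 \<le> c / (1 + c)" "c / (1 + c) \<le> c" using c by (simp_all add: field_simps)
  ultimately show ?case by simp
next
  case (Suc l)
  define g where "g = iterate l"
  have g: "1 < g" using iterate_bounds[of l] iterate_gt1 by (simp add: g_def)
  have g': "iterate (Suc l) = c + 1 / g" by (simp add: g_def)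
  have pos: "0 < c * g + 1" using g c by (simp add: add_pos_pos)
  have "c + 1 / g = (c * g + 1) / g" using g by (simp add: field_simps)
  then have "c + 1 / g - 1 / (c + 1 / g) - c = 1 / g - g / (c * g + 1)" using g by simp
  also have "\<dots> = ((c * g + 1) - g * g) / (g * (c * g + 1))"
    using g pos by (simp add: diff_divide_distrib)
  also have "\<dots> = - ((g * g - 1 - c * g) / (g * (c * g + 1)))"
    unfolding minus_divide_left by simp
  also have "g * g - 1 - c * g = g * (g - 1 / g - c)"
    using g by (simp add: algebra_simps)
  also have "g * (g - 1 / g - c) / (g * (c * g + 1)) = (g - 1 / g - c) / (c * g + 1)"
    using g by simp
  finally have "\<bar>c + 1 / g - 1 / (c + 1 / g) - c\<bar> = \<bar>g - 1 / g - c\<bar> / (c * g + 1)"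
    using pos by simp
  also have "\<dots> \<le> (c * (1 / (1 + c)) ^ l) / (1 + c)"
    using Suc g c unfolding g_def[symmetric] by (intro frac_le) auto
  finally show ?case unfolding g' by simp
qed

end

subsection \<open>Accuracy of the estimate\<close>

definition sym_entries :: "holant \<Rightarrow> nat \<Rightarrow> real list" where
  "sym_entries \<Omega> v = map (\<lambda>i. entry (degree \<Omega> v, fn \<Omega> v) i) [0..<degree \<Omega> v + 1]"

definition vert_list :: "holant \<Rightarrow> real list list" where
  "vert_list \<Omega> = map (sym_entries \<Omega>) [0..<nverts \<Omega>]"

definition edge_list :: "holant \<Rightarrow> (nat \<times> nat \<times> real) list" where
  "edge_list \<Omega> = map (\<lambda>e. (fst (edges \<Omega> ! e), snd (edges \<Omega> ! e), weight \<Omega> e)) [0..<length (edges \<Omega>)]"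

lemma enc_list_map: "enc_list g (map h xs) = enc_list (\<lambda>x. g (h x)) xs"
  by (induction xs) auto

lemma enc_sym_eq: "enc_sym \<Omega> = Node (enc_list (enc_list Num) (vert_list \<Omega>)) (enc_list enc_edge (edge_list \<Omega>))"
  by (simp add: enc_sym_def vert_list_def edge_list_def enc_list_map sym_entries_def enc_edge_def del: upt_Suc)

lemma length_lists [simp]:
  "length (vert_list \<Omega>) = nverts \<Omega>" "length (edge_list \<Omega>) = length (edges \<Omega>)"
  "length (sym_entries \<Omega> v) = degree \<Omega> v + 1"
  by (simp_all add: vert_list_def edge_list_def sym_entries_def del: upt_Suc)

lemma sym_entries_nth: "i \<le> degree \<Omega> v \<Longrightarrow> sym_entries \<Omega> v ! i = entry (degree \<Omega> v, fn \<Omega> v) i"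
  by (simp add: sym_entries_def nth_append del: upt_Suc)

lemma edge_list_nth: "e < length (edges \<Omega>) \<Longrightarrow> edge_list \<Omega> ! e = (fst (edges \<Omega> ! e), snd (edges \<Omega> ! e), weight \<Omega> e)"
  by (simp add: edge_list_def)

definition ones :: "holant \<Rightarrow> (nat \<Rightarrow> bool) \<Rightarrow> nat \<Rightarrow> nat" where
  "ones \<Omega> \<sigma> v = count_list (map \<sigma> (incident \<Omega> v)) True"

lemma ones_le: "ones \<Omega> \<sigma> v \<le> degree \<Omega> v"
  unfolding ones_def degree_def using count_le_length[of "map \<sigma> (incident \<Omega> v)" True] by simp

lemma count_list_replicate: "count_list (replicate k a) b = (if a = b then k else 0)"
  by (induction k) auto

lemma fn_eq:
  assumes "symmetric (degree \<Omega> v, fn \<Omega> v)"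
  shows "fn \<Omega> v (map \<sigma> (incident \<Omega> v)) = sym_entries \<Omega> v ! ones \<Omega> \<sigma> v"
proof -
  let ?i = "ones \<Omega> \<sigma> v" and ?d = "degree \<Omega> v"
  have "fn \<Omega> v (map \<sigma> (incident \<Omega> v)) = fn \<Omega> v (replicate ?i True @ replicate (?d - ?i) False)"
  proof -
    have "length (map \<sigma> (incident \<Omega> v)) = ?d" by (simp add: degree_def)
    moreover have "length (replicate ?i True @ replicate (?d - ?i) False) = ?d" using ones_le by simp
    moreover have "count_list (map \<sigma> (incident \<Omega> v)) True = count_list (replicate ?i True @ replicate (?d - ?i) False) True"
      by (simp add: count_list_replicate ones_def)
    ultimately show ?thesis using assms unfolding symmetric_def by simp
  qed
  then show ?thesis using ones_le by (simp add: sym_entries_nth entry_def)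
qed

lemma basis_vec_prod:
  "(\<Prod>e\<leftarrow>es. basis_vec x False (\<sigma> e)) = x ^ count_list (map \<sigma> es) True"
  "(\<Prod>e\<leftarrow>es. basis_vec x True (\<sigma> e)) = x ^ (length es - count_list (map \<sigma> es) True) * (- 1) ^ count_list (map \<sigma> es) True"
proof (induction es)
  case (Cons e es)
  have "count_list (map \<sigma> es) True \<le> length es" using count_le_length[of "map \<sigma> es" True] by simp
  with Cons show
    "(\<Prod>e\<leftarrow>e # es. basis_vec x False (\<sigma> e)) = x ^ count_list (map \<sigma> (e # es)) True"
    "(\<Prod>e\<leftarrow>e # es. basis_vec x True (\<sigma> e)) = x ^ (length (e # es) - count_list (map \<sigma> (e # es)) True) *
      (- 1) ^ count_list (map \<sigma> (e # es)) True"
    by (auto simp: basis_vec_def Suc_diff_le)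
qed simp_all

context
  fixes \<Omega> :: holant and c p \<theta> :: real
  assumes inst: "\<Omega> \<in> Holant (fib_ge c p) (edge_weights (1 - \<theta>) (1 + \<theta>))"
begin

lemma wf: "wf_holant \<Omega>" and fib: "v < nverts \<Omega> \<Longrightarrow> (degree \<Omega> v, fn \<Omega> v) \<in> fib_ge c p"
  and weights: "e < length (edges \<Omega>) \<Longrightarrow> 0 \<le> weight \<Omega> e \<and> \<bar>weight \<Omega> e - 1\<bar> \<le> \<theta>"
  using inst by (auto simp: Holant_def edge_weights_def)

lemma edge_list_wf: "\<forall>(a, b, l)\<in>set (edge_list \<Omega>). a < nverts \<Omega> \<and> b < nverts \<Omega> \<and> a \<noteq> b \<and> 0 \<le> l \<and> \<bar>l - 1\<bar> \<le> \<theta>"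
proof -
  have "fst (edges \<Omega> ! e) < nverts \<Omega> \<and> snd (edges \<Omega> ! e) < nverts \<Omega> \<and> fst (edges \<Omega> ! e) \<noteq> snd (edges \<Omega> ! e)"
    if "e < length (edges \<Omega>)" for e
    using wf nth_mem[OF that] unfolding wf_holant_def by (auto simp: case_prod_unfold)
  then show ?thesis using weights by (auto simp: edge_list_def)
qed

lemma entries:
  assumes v: "v < nverts \<Omega>"
  shows "i < length (sym_entries \<Omega> v) \<Longrightarrow> 0 \<le> sym_entries \<Omega> v ! i"
    "i + 2 < length (sym_entries \<Omega> v) \<Longrightarrow>
      sym_entries \<Omega> v ! (i + 2) = c * sym_entries \<Omega> v ! (i + 1) + sym_entries \<Omega> v ! i"
    "1 < length (sym_entries \<Omega> v) \<Longrightarrow> p * sym_entries \<Omega> v ! 0 \<le> sym_entries \<Omega> v ! 1"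
    "symmetric (degree \<Omega> v, fn \<Omega> v)"
  using fib[OF v] by (auto simp: fib_ge_def fib_def sym_entries_nth)

lemma degree_eq: "length (filter (\<lambda>e. fst e = v \<or> fst (snd e) = v) (edge_list \<Omega>)) = degree \<Omega> v"
  by (simp add: edge_list_def degree_def incident_def filter_map comp_def)

text \<open>Links the two approximations: the holographic expansion is exact for this sum, and the
  sum is close to the partition function when \<open>x\<close> is close to the root.\<close>

definition twisted :: "real \<Rightarrow> real" where
  "twisted x = (\<Sum>\<sigma>\<in>{..<length (edges \<Omega>)} \<rightarrow>\<^sub>E (UNIV :: bool set).
      (\<Prod>e<length (edges \<Omega>). weight \<Omega> e ^ of_bool (\<sigma> e)) *
      (\<Prod>v<nverts \<Omega>. twist x (sym_entries \<Omega> v) (ones \<Omega> \<sigma> v)))"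

lemma twisted_eq:
  "twisted x = prod_list (map (spin_scale x) (vert_list \<Omega>)) * (\<Prod>(a, b, l)\<leftarrow>edge_list \<Omega>. 1 + l * (x * x)) *
    sum_out (pair_mixed x (edge_list \<Omega>)) (pair_inner x (edge_list \<Omega>)) (initial_state x 0 (vert_list \<Omega>))"
proof -
  let ?n = "nverts \<Omega>" and ?m = "length (edges \<Omega>)" and ?E = "edge_list \<Omega>"
  have inc: "filter (\<lambda>e. fst (?E ! e) = v \<or> fst (snd (?E ! e)) = v) [0..<length ?E] = incident \<Omega> v" for v
    unfolding incident_def by (intro filter_cong) (auto simp: edge_list_nth)
  have spin_scale: "prod_list (map (spin_scale x) (vert_list \<Omega>)) = (\<Prod>v<?n. spin_scale x (sym_entries \<Omega> v))"
    using prod.distinct_set_conv_list[OF distinct_upt, of "\<lambda>v. spin_scale x (sym_entries \<Omega> v)" 0 ?n]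
    by (simp add: vert_list_def comp_def atLeast0LessThan)
  have "twist x (sym_entries \<Omega> v) (ones \<Omega> \<sigma> v) = spin_scale x (sym_entries \<Omega> v) *
      ((\<Prod>e\<leftarrow>incident \<Omega> v. basis_vec x False (\<sigma> e)) + spin_ratio x (sym_entries \<Omega> v) * (\<Prod>e\<leftarrow>incident \<Omega> v. basis_vec x True (\<sigma> e)))" for v \<sigma>
    by (simp add: twist_def basis_vec_prod ones_def degree_def)
  then have "twisted x = (\<Prod>v<?n. spin_scale x (sym_entries \<Omega> v)) * (\<Sum>\<sigma>\<in>{..<?m} \<rightarrow>\<^sub>E (UNIV :: bool set).
      (\<Prod>e<?m. weight \<Omega> e ^ of_bool (\<sigma> e)) *
      (\<Prod>v<?n. (\<Prod>e\<leftarrow>incident \<Omega> v. basis_vec x False (\<sigma> e)) + spin_ratio x (sym_entries \<Omega> v) * (\<Prod>e\<leftarrow>incident \<Omega> v. basis_vec x True (\<sigma> e))))"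
    unfolding twisted_def sum_distrib_left by (simp add: prod.distrib mult_ac)
  also have "(\<Sum>\<sigma>\<in>{..<?m} \<rightarrow>\<^sub>E (UNIV :: bool set).
      (\<Prod>e<?m. weight \<Omega> e ^ of_bool (\<sigma> e)) *
      (\<Prod>v<?n. (\<Prod>e\<leftarrow>incident \<Omega> v. basis_vec x False (\<sigma> e)) + spin_ratio x (sym_entries \<Omega> v) * (\<Prod>e\<leftarrow>incident \<Omega> v. basis_vec x True (\<sigma> e)))) =
    (\<Prod>(a, b, l)\<leftarrow>?E. 1 + l * (x * x)) *
      spin_sum (pair_mixed x ?E) (pair_inner x ?E) (map (\<lambda>v. (v, 1, spin_ratio x (sym_entries \<Omega> v))) [0..<?n])"
  proof -
    have "\<forall>(a, b, l)\<in>set ?E. a < ?n \<and> b < ?n \<and> a \<noteq> b \<and> 0 \<le> l" using edge_list_wf by auto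
    from holographic[OF this, of x "\<lambda>v. spin_ratio x (sym_entries \<Omega> v)", unfolded inc] show ?thesis
      by (simp add: edge_list_nth)
  qed
  also have "map (\<lambda>v. (v, 1, spin_ratio x (sym_entries \<Omega> v))) [0..<?n] =
      map (\<lambda>(v, r, g, b). (v, 1, r * g)) (initial_state x 0 (vert_list \<Omega>))"
    by (simp add: initial_state_eq vert_list_def)
  finally show ?thesis by (simp add: spin_scale sum_out_def mult_ac)
qed

text \<open>All configurations have nonnegative weight, so relative errors of the vertex functions
  pass to the sum. Each of them collects at most one factor per edge.\<close>

lemma twisted_near:
  assumes x: "0 < x" and c: "0 < c" and \<eta>: "0 \<le> \<eta>" "\<eta> \<le> 1" "\<bar>x - 1 / x - c\<bar> \<le> c * \<eta>"
  shows "(1 - \<eta>) ^ (nverts \<Omega> * length (edges \<Omega>)) * partition_function \<Omega> \<le> twisted x"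
    "twisted x \<le> (1 + \<eta>) ^ (nverts \<Omega> * length (edges \<Omega>)) * partition_function \<Omega>"
proof -
  let ?n = "nverts \<Omega>" and ?m = "length (edges \<Omega>)"
  define w where "w \<sigma> = (\<Prod>e<?m. weight \<Omega> e ^ of_bool (\<sigma> e))" for \<sigma> :: "nat \<Rightarrow> bool"
  define F where "F \<sigma> v = sym_entries \<Omega> v ! ones \<Omega> \<sigma> v" for \<sigma> v
  define T where "T \<sigma> v = twist x (sym_entries \<Omega> v) (ones \<Omega> \<sigma> v)" for \<sigma> v
  have Z: "partition_function \<Omega> = (\<Sum>\<sigma>\<in>{..<?m} \<rightarrow>\<^sub>E (UNIV :: bool set). w \<sigma> * (\<Prod>v<?n. F \<sigma> v))"
    unfolding partition_function_def w_def F_def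
    by (intro sum.cong refl arg_cong2[where f = "(*)"] prod.cong fn_eq) (auto intro: entries)
  have w0: "0 \<le> w \<sigma>" for \<sigma>
    unfolding w_def using weights by (intro prod_nonneg) auto
  have dm: "degree \<Omega> v \<le> ?m" for v
    unfolding degree_def incident_def by (metis length_filter_le length_upt diff_zero)
  have b: "0 \<le> F \<sigma> v \<and> (1 - \<eta>) ^ ?m * F \<sigma> v \<le> T \<sigma> v \<and> T \<sigma> v \<le> (1 + \<eta>) ^ ?m * F \<sigma> v" if v: "v < ?n" for \<sigma> v
  proof -
    have i: "ones \<Omega> \<sigma> v < length (sym_entries \<Omega> v)" using ones_le[of \<Omega> \<sigma> v] by simp
    have F0: "0 \<le> F \<sigma> v" unfolding F_def by (intro entries(1) v i)
    have ne: "sym_entries \<Omega> v \<noteq> []" by (metis length_lists(3) list.size(3) add_is_0 one_neq_zero)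
    have "(1 - \<eta>) ^ ones \<Omega> \<sigma> v * F \<sigma> v \<le> T \<sigma> v" "T \<sigma> v \<le> (1 + \<eta>) ^ ones \<Omega> \<sigma> v * F \<sigma> v"
      unfolding F_def T_def
      by (intro twist_near[OF ne entries(1,2)[OF v] x c \<eta> i]; assumption)+
    moreover have om: "ones \<Omega> \<sigma> v \<le> ?m" using ones_le dm le_trans by blast
    have "(1 - \<eta>) ^ ?m * F \<sigma> v \<le> (1 - \<eta>) ^ ones \<Omega> \<sigma> v * F \<sigma> v"
      using \<eta> F0 om by (intro mult_right_mono power_decreasing) auto
    moreover have "(1 + \<eta>) ^ ones \<Omega> \<sigma> v * F \<sigma> v \<le> (1 + \<eta>) ^ ?m * F \<sigma> v"
      using \<eta> F0 om by (intro mult_right_mono power_increasing) auto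
    ultimately show ?thesis using F0 by linarith
  qed
  have lo: "(1 - \<eta>) ^ (?n * ?m) * (\<Prod>v<?n. F \<sigma> v) \<le> (\<Prod>v<?n. T \<sigma> v)" for \<sigma>
  proof -
    have "(\<Prod>v<?n. (1 - \<eta>) ^ ?m * F \<sigma> v) \<le> (\<Prod>v<?n. T \<sigma> v)"
      using b \<eta> by (intro prod_mono) auto
    then show ?thesis by (simp add: prod.distrib power_mult[symmetric] mult.commute)
  qed
  have hi: "(\<Prod>v<?n. T \<sigma> v) \<le> (1 + \<eta>) ^ (?n * ?m) * (\<Prod>v<?n. F \<sigma> v)" for \<sigma>
  proof -
    have "0 \<le> T \<sigma> v" if "v < ?n" for v
    proof -
      have "0 \<le> (1 - \<eta>) ^ ?m * F \<sigma> v" using b[OF that] \<eta> by simp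
      then show ?thesis using b[OF that, of \<sigma>] by linarith
    qed
    then have "(\<Prod>v<?n. T \<sigma> v) \<le> (\<Prod>v<?n. (1 + \<eta>) ^ ?m * F \<sigma> v)"
      using b by (intro prod_mono) auto
    then show ?thesis by (simp add: prod.distrib power_mult[symmetric] mult.commute)
  qed
  show "(1 - \<eta>) ^ (?n * ?m) * partition_function \<Omega> \<le> twisted x"
    unfolding Z twisted_def sum_distrib_left w_def[symmetric] T_def[symmetric]
    using mult_left_mono[OF lo w0] by (intro sum_mono) (simp add: mult_ac)
  show "twisted x \<le> (1 + \<eta>) ^ (?n * ?m) * partition_function \<Omega>"
    unfolding Z twisted_def sum_distrib_left w_def[symmetric] T_def[symmetric]
    using mult_left_mono[OF hi w0] by (intro sum_mono) (simp add: mult_ac)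
qed

lemma partition_function_nonneg: "0 \<le> partition_function \<Omega>"
proof -
  have "0 \<le> fn \<Omega> v (map \<sigma> (incident \<Omega> v))" if "v < nverts \<Omega>" for v \<sigma>
    using wf that by (simp add: wf_holant_def degree_def)
  then show ?thesis
    unfolding partition_function_def using weights
    by (intro sum_nonneg mult_nonneg_nonneg prod_nonneg) auto
qed

text \<open>Two sources of error: \<open>\<xi>\<close> per vertex for the truncated recursion, and
  \<open>\<eta>\<close> per pair of a vertex and an edge for the inexact root.\<close>

lemma estimate_near:
  assumes c: "0 < c" and p: "0 < p" and x: "1 < x" "x \<le> X" and s: "0 < s" "s < 1 / 10"
    and \<theta>: "0 \<le> \<theta>" "\<theta> * X ^ 3 \<le> s" and \<kappa>: "\<kappa> = 1 - 10 * s" "1 \<le> \<kappa> * x\<^sup>2" "1 \<le> \<kappa> * (1 + p * x)"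
    and \<eta>: "0 \<le> \<eta>" "\<eta> \<le> 1" "\<bar>x - 1 / x - c\<bar> \<le> c * \<eta>"
    and \<xi>: "\<xi> = x\<^sup>2 * (1 - 6 * s) ^ l / (6 * s)" "\<xi> \<le> 1"
  shows "(1 - \<xi>) ^ nverts \<Omega> * (1 - \<eta>) ^ (nverts \<Omega> * length (edges \<Omega>)) * partition_function \<Omega> \<le>
      estimate x l (vert_list \<Omega>) (edge_list \<Omega>)"
    "estimate x l (vert_list \<Omega>) (edge_list \<Omega>) \<le>
      (1 + \<xi>) ^ nverts \<Omega> * (1 + \<eta>) ^ (nverts \<Omega> * length (edges \<Omega>)) * partition_function \<Omega>"
proof -
  let ?n = "nverts \<Omega>" and ?m = "length (edges \<Omega>)" and ?E = "edge_list \<Omega>"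
  have X: "\<theta> * x ^ 3 \<le> s"
    using mult_left_mono[OF power_mono[OF x(2), of 3] \<theta>(1)] x \<theta>(2) by linarith
  have "x ^ 2 \<le> x ^ 3" "1 \<le> x" using x by (auto intro: power_increasing)
  then have X2: "\<theta> * x\<^sup>2 \<le> s" using X mult_left_mono[of "x ^ 2" "x ^ 3" \<theta>] \<theta> by linarith
  have es: "\<forall>(a, b, l)\<in>set ?E. \<bar>mixed_weight x l\<bar> \<le> \<theta> * x \<and> 0 \<le> inner_weight x l \<and> inner_weight x l \<le> 1 + \<theta> * x\<^sup>2"
    using edge_list_wf edge_weight_bounds[of _ \<theta> x] x by fastforce
  have no_loop: "edge_count ?E u u = 0" for u
    using edge_list_wf by (fastforce simp: edge_count_def joins_def filter_empty_conv)
  have nn: "0 \<le> \<theta> * x" "0 \<le> 1 + \<theta> * x\<^sup>2" using \<theta> x by auto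
  note pb = pair_bounds[OF es nn]
  have xs: "1 + s \<le> x\<^sup>2"
  proof -
    have "(1 + s) * 1 \<le> (1 + s) * (\<kappa> * x\<^sup>2)" using s \<kappa> by (intro mult_left_mono) auto
    also have "\<dots> = ((1 + s) * \<kappa>) * x\<^sup>2" by simp
    also have "\<dots> \<le> 1 * x\<^sup>2" using s by (intro mult_right_mono) (auto simp: \<kappa> algebra_simps)
    finally show ?thesis by simp
  qed
  interpret spin_system "pair_mixed x ?E" "pair_inner x ?E" "edge_count ?E" x "\<theta> * x" "1 + \<theta> * x\<^sup>2" \<kappa> s
    using x s \<kappa> \<theta> X X2 pb nn xs pair_sym[of x ?E] pair_trivial[of ?E] no_loop
    by unfold_locales (auto simp: edge_count_def joins_sym power3_eq_cube power2_eq_square mult_ac)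
  let ?L = "initial_state x 0 (vert_list \<Omega>)"
  have L: "?L = map (\<lambda>v. (v, spin_ratio x (sym_entries \<Omega> v), 1, 1)) [0..<?n]"
    by (simp add: initial_state_eq vert_list_def)
  have deg: "deg ?L v = degree \<Omega> v" for v
  proof -
    have "deg ?L v = (\<Sum>w\<leftarrow>[0..<?n]. edge_count ?E v w)" by (simp add: deg_def L comp_def)
    also have "\<dots> = degree \<Omega> v"
      using edge_list_wf by (subst sum_edge_count) (auto simp: degree_eq)
    finally show ?thesis .
  qed
  have state_ok: "state_ok (\<lambda>_. 0) ?L"
    unfolding state_ok_def deg
  proof
    fix e assume "e \<in> set ?L"
    then obtain v where v: "v < ?n" "e = (v, spin_ratio x (sym_entries \<Omega> v), 1, 1)" by (auto simp: L)
    have k0: "0 < \<kappa>" using s \<kappa> by simp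
    have ne: "sym_entries \<Omega> v \<noteq> []" by (metis length_lists(3) list.size(3) add_is_0 one_neq_zero)
    have x0: "0 < x" using x by simp
    note vb = spin_ratio_bounds[OF ne entries(1,3)[OF v(1)] p x0 k0 \<kappa>(2,3)]
    from vb show "elem_ok 0 (degree \<Omega> (fst e)) e"
      unfolding v(2) elem_ok_def by simp
  qed
  note Z = chain_estimate_approx[OF state_ok \<xi>]
  have len: "length ?L = ?n" by (simp add: L)
  define P where "P = prod_list (map (spin_scale x) (vert_list \<Omega>)) * (\<Prod>(a, b, l)\<leftarrow>?E. 1 + l * (x * x))"
  have scale_nonneg: "0 \<le> spin_scale x (sym_entries \<Omega> v)" if "v < ?n" for v
    using x by (intro spin_scale_nonneg entries(1)[OF that]) auto
  have "0 \<le> prod_list (map (spin_scale x) (vert_list \<Omega>))"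
    unfolding vert_list_def using scale_nonneg by (intro prod_list_nonneg) auto
  moreover have "0 \<le> (\<Prod>(a, b, l)\<leftarrow>?E. 1 + l * (x * x))"
    using edge_list_wf by (intro prod_list_nonneg) auto
  ultimately have P0: "0 \<le> P" by (simp add: P_def)
  have A: "estimate x l (vert_list \<Omega>) ?E = P * chain_estimate (pair_mixed x ?E) (pair_inner x ?E) l ?L"
    by (simp add: estimate_def P_def)
  have T: "twisted x = P * sum_out (pair_mixed x ?E) (pair_inner x ?E) ?L"
    by (simp add: twisted_eq P_def)
  have x0: "0 < x" using x by simp
  note tn = twisted_near[OF x0 c \<eta>]
  have \<xi>0: "0 \<le> \<xi>" using s by (simp add: \<xi>(1))
  have "(1 - \<xi>) ^ ?n * ((1 - \<eta>) ^ (?n * ?m) * partition_function \<Omega>) \<le> (1 - \<xi>) ^ ?n * twisted x"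
    using tn(1) \<xi>(2) by (intro mult_left_mono) auto
  also have "\<dots> \<le> estimate x l (vert_list \<Omega>) ?E"
    using mult_left_mono[OF Z(1)[unfolded len] P0] by (simp add: A T mult_ac)
  finally show "(1 - \<xi>) ^ ?n * (1 - \<eta>) ^ (?n * ?m) * partition_function \<Omega> \<le> estimate x l (vert_list \<Omega>) ?E"
    by (simp add: mult_ac)
  have "estimate x l (vert_list \<Omega>) ?E \<le> (1 + \<xi>) ^ ?n * twisted x"
    using mult_left_mono[OF Z(2)[unfolded len] P0] by (simp add: A T mult_ac)
  also have "\<dots> \<le> (1 + \<xi>) ^ ?n * ((1 + \<eta>) ^ (?n * ?m) * partition_function \<Omega>)"
    using tn(2) \<xi>0 by (intro mult_left_mono) auto
  finally show "estimate x l (vert_list \<Omega>) ?E \<le> (1 + \<xi>) ^ ?n * (1 + \<eta>) ^ (?n * ?m) * partition_function \<Omega>"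
    by (simp add: mult_ac)
qed

end

lemma product_bounds:
  assumes "0 \<le> \<xi>" "\<xi> \<le> 1" "0 \<le> \<eta>" "\<eta> \<le> 1" "real n * \<xi> + real k * \<eta> \<le> \<delta> / 4" "0 < \<delta>" "\<delta> \<le> 1"
  shows "1 - \<delta> / 4 \<le> (1 - \<xi>) ^ n * (1 - \<eta>) ^ k" "(1 + \<xi>) ^ n * (1 + \<eta>) ^ k \<le> 1 + \<delta> / 2"
proof -
  define a where "a = real n * \<xi>"
  define b where "b = real k * \<eta>"
  have ab: "0 \<le> a" "0 \<le> b" "a + b \<le> \<delta> / 4" using assms by (auto simp: a_def b_def)
  have "1 - a \<le> (1 - \<xi>) ^ n" "1 - b \<le> (1 - \<eta>) ^ k"
    using Bernoulli_inequality[of "- \<xi>" n] Bernoulli_inequality[of "- \<eta>" k] assms by (auto simp: a_def b_def)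
  moreover have "0 \<le> 1 - b" using ab assms by linarith
  ultimately have ge: "(1 - a) * (1 - b) \<le> (1 - \<xi>) ^ n * (1 - \<eta>) ^ k"
    using assms by (intro mult_mono) auto
  have "0 \<le> a * b" using ab by simp
  moreover have "(1 - a) * (1 - b) = 1 - (a + b) + a * b" by (simp add: algebra_simps)
  ultimately have "1 - \<delta> / 4 \<le> (1 - a) * (1 - b)" using ab(3) by linarith
  with ge show "1 - \<delta> / 4 \<le> (1 - \<xi>) ^ n * (1 - \<eta>) ^ k" by linarith
  have e: "(1 + z) ^ j \<le> exp (real j * z)" if "0 \<le> z" for z j
    using power_mono[OF exp_ge_add_one_self[of z], of j] that by (simp add: exp_of_nat_mult)
  have "(1 + \<xi>) ^ n * (1 + \<eta>) ^ k \<le> exp a * exp b"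
    unfolding a_def b_def using e assms by (intro mult_mono) auto
  also have "\<dots> = exp (a + b)" by (simp add: exp_add)
  also have "\<dots> \<le> 1 + (a + b) + (a + b)\<^sup>2" using ab assms by (intro exp_bound) auto
  also have "\<dots> \<le> 1 + (a + b) + 1 * (a + b)"
    unfolding power2_eq_square using ab assms by (intro add_left_mono mult_right_mono) auto
  also have "\<dots> \<le> 1 + \<delta> / 2" using ab(3) by (simp add: field_simps)
  finally show "(1 + \<xi>) ^ n * (1 + \<eta>) ^ k \<le> 1 + \<delta> / 2" .
qed

text \<open>By minimality of \<open>l\<close>, \<open>(1 / q) ^ l\<close> is at most
  \<open>s / q\<close> unless \<open>l = 0\<close>, which the summand 1 covers. As 4 is at most a
  fixed power of \<open>1 / q\<close>, logarithmic depth costs polynomial time.\<close>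

lemma depth_cost:
  fixes q s :: real
  assumes q: "0 < q" "q < 1" and k: "4 \<le> (1 / q) ^ k" and l: "l = 0 \<or> 1 < q ^ (l - 1) * s" and s: "0 \<le> s"
  shows "4 ^ l \<le> (1 + s / q) ^ k"
proof -
  have "4 ^ l \<le> ((1 / q) ^ k) ^ l" using k by (intro power_mono) auto
  also have "\<dots> = ((1 / q) ^ l) ^ k" by (simp only: power_mult[symmetric] mult.commute)
  also have "\<dots> \<le> (1 + s / q) ^ k"
  proof (intro power_mono)
    show "(1 / q) ^ l \<le> 1 + s / q"
    proof (cases l)
      case (Suc j)
      then have "1 < q ^ j * s" using l by simp
      then have "(1 / q) ^ j \<le> s" using q by (simp add: field_simps)
      then have "(1 / q) ^ j * (1 / q) \<le> s * (1 / q)" using q by (intro mult_right_mono) auto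
      then show ?thesis by (simp add: Suc)
    qed (use s q in simp)
  qed (use q in simp)
  finally show ?thesis .
qed

theorem theorem3p1:
  fixes c p :: real
  assumes "c > 0" and "p > 0"
  shows "\<exists>l1 l2. l1 < 1 \<and> l2 > 1 \<and>
    has_fptas {c, p} (Holant (fib_ge c p) (edge_weights l1 l2)) enc_sym partition_function"
proof -
  note c = assms(1) and p = assms(2)
  \<comment> \<open>\<open>x0\<close> and \<open>X\<close> enclose all iterates, so the constants
    below do not depend on the depth. The conditions on \<open>\<kappa>\<close> are monotone in
    \<open>x\<close> and hence only needed at \<open>x0\<close>.\<close>
  define x0 where "x0 = c + 1 / (1 + c)"
  define X where "X = 1 + c"
  define \<kappa> where "\<kappa> = max (1 / (1 + p * x0)) (1 / x0\<^sup>2)"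
  define s where "s = (1 - \<kappa>) / 10"
  \<comment> \<open>This gives \<open>\<gamma> * x ^ 2 = \<theta> * x ^ 3 \<le> s\<close> for every
    iterate.\<close>
  define \<theta> where "\<theta> = s / X ^ 3"
  have x0: "1 < x0" using iterate_gt1[OF c] by (simp add: x0_def)
  have px0: "0 < p * x0" and xx0: "1 < x0\<^sup>2" using p x0 by (auto simp: one_less_power)
  have "1 / x0\<^sup>2 < 1" using xx0 by (subst divide_less_eq_1_pos) auto
  then have \<kappa>: "0 < \<kappa>" "\<kappa> < 1" using px0 by (auto simp: \<kappa>_def less_max_iff_disj)
  have s: "0 < s" "s < 1 / 10" "\<kappa> = 1 - 10 * s" using \<kappa> by (auto simp: s_def field_simps)
  have X: "1 < X" using c by (simp add: X_def)
  have \<theta>: "0 < \<theta>" "\<theta> * X ^ 3 \<le> s" using s X by (auto simp: \<theta>_def)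
  have kx: "1 \<le> \<kappa> * x\<^sup>2" "1 \<le> \<kappa> * (1 + p * x)" if "x0 \<le> x" for x
  proof -
    have "1 = 1 / x0\<^sup>2 * x0\<^sup>2" using x0 by simp
    also have "\<dots> \<le> \<kappa> * x\<^sup>2" using that x0 \<kappa> by (intro mult_mono power_mono) (auto simp: \<kappa>_def)
    finally show "1 \<le> \<kappa> * x\<^sup>2" .
    have "1 = 1 / (1 + p * x0) * (1 + p * x0)" using px0 by simp
    also have "\<dots> \<le> \<kappa> * (1 + p * x)"
      using that px0 \<kappa> p by (intro mult_mono add_left_mono mult_left_mono) (auto simp: \<kappa>_def)
    finally show "1 \<le> \<kappa> * (1 + p * x)" .
  qed
  have "1 / (1 + c) < 1" using c by simp
  \<comment> \<open>A single rate dominates both geometric errors, \<open>1 - 6 * s\<close> per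
    level of the recursion and \<open>1 / (1 + c)\<close> per iteration. It is taken rational so
    that it may occur as a literal; so is \<open>K\<close> below.\<close>
  then have "max (1 - 6 * s) (1 / (1 + c)) < 1" using s by simp
  then obtain q where q: "q \<in> \<rat>" "max (1 - 6 * s) (1 / (1 + c)) < q" "q < 1"
    using Rats_dense_in_real by blast
  have q0: "0 < q" using q(2) s by linarith
  \<comment> \<open>The errors add up to at most
    \<open>(X ^ 2 / (6 * s) + 1) * (1 + n) * (1 + m) * q ^ l\<close>, which has to be at most a
    quarter of the capped accuracy.\<close>
  obtain K where K: "K \<in> \<rat>" "4 * (X\<^sup>2 / (6 * s) + 1) < K"
    using Rats_dense_in_real[of "4 * (X\<^sup>2 / (6 * s) + 1)" "4 * (X\<^sup>2 / (6 * s) + 1) + 1"] by auto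
  have X2: "0 \<le> X\<^sup>2 / (6 * s)" using s by simp
  have "4 * 1 \<le> 4 * (X\<^sup>2 / (6 * s) + 1)" using X2 by (intro mult_left_mono) auto
  then have K1: "4 \<le> K" using K(2) by simp
  obtain k where k: "4 < (1 / q) ^ k" using real_arch_pow[of "1 / q" 4] q0 q(3) by auto
  define C where "C = 10000 * (1 + K / q) ^ k"
  have fptas: "\<exists>Z' t. runs (prog c q K) (Node (Num \<epsilon>) (enc_sym \<Omega>)) (Num Z') t \<and>
      rel_approx \<epsilon> (partition_function \<Omega>) Z' \<and>
      real t \<le> C * (real (vsize (enc_sym \<Omega>)) + 1 / \<epsilon>) ^ (3 + 3 * k)"
    if \<Omega>: "\<Omega> \<in> Holant (fib_ge c p) (edge_weights (1 - \<theta>) (1 + \<theta>))" and \<epsilon>: "0 < \<epsilon>" for \<Omega> \<epsilon>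
  proof -
    define n where "n = nverts \<Omega>"
    define m where "m = length (edges \<Omega>)"
    define \<delta> where "\<delta> = (if \<epsilon> < 1 then \<epsilon> else 1)"
    define \<sigma> where "\<sigma> = K * (1 + real n) * (1 + real m) / \<delta>"
    define S where "S = vsize (enc_sym \<Omega>)"
    define Z where "Z = partition_function \<Omega>"
    have \<delta>: "0 < \<delta>" "\<delta> \<le> 1" "\<delta> \<le> \<epsilon>" using \<epsilon> by (auto simp: \<delta>_def)
    have ne: "\<forall>f\<in>set (vert_list \<Omega>). f \<noteq> []" by (auto simp: vert_list_def sym_entries_def)
    obtain l where l: "computes c q K 0 (Node (Num \<epsilon>) (enc_sym \<Omega>))
        (Num (estimate (iterate c l) l (vert_list \<Omega>) (edge_list \<Omega>))) (10000 * S ^ 3 * 4 ^ l)"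
      "q ^ l * \<sigma> \<le> 1" "l = 0 \<or> 1 < q ^ (l - 1) * \<sigma>"
      using run_main[OF q0 q(3) ne, of c K \<epsilon> "edge_list \<Omega>", folded enc_sym_eq]
      by (auto simp: \<sigma>_def \<delta>_def S_def n_def m_def)
    define x where "x = iterate c l"
    define A where "A = estimate x l (vert_list \<Omega>) (edge_list \<Omega>)"
    define \<xi> where "\<xi> = x\<^sup>2 * (1 - 6 * s) ^ l / (6 * s)"
    define \<eta> where "\<eta> = q ^ l"
    have x: "x0 \<le> x" "x \<le> X" using iterate_bounds[OF c] by (auto simp: x_def x0_def X_def)
    have \<sigma>0: "0 < K * (1 + real n) * (1 + real m)" using K1 by (simp add: add_pos_nonneg)
    have ql: "q ^ l * (K * (1 + real n) * (1 + real m)) \<le> \<delta>"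
      using l(2) \<delta> by (simp add: \<sigma>_def pos_divide_le_eq)
    have \<eta>: "0 \<le> \<eta>" "\<eta> \<le> 1" using q0 q(3) by (auto simp: \<eta>_def power_le_one)
    have \<eta>': "\<bar>x - 1 / x - c\<bar> \<le> c * \<eta>"
    proof -
      have "(1 / (1 + c)) ^ l \<le> q ^ l" using q(2) c by (intro power_mono) auto
      then have "c * (1 / (1 + c)) ^ l \<le> c * \<eta>" unfolding \<eta>_def using c by (intro mult_left_mono) auto
      then show ?thesis using iterate_error[OF c, of l] unfolding x_def by linarith
    qed
    have \<xi>0: "0 \<le> \<xi>" using s by (simp add: \<xi>_def)
    have "x\<^sup>2 * (1 - 6 * s) ^ l \<le> X\<^sup>2 * \<eta>"
      unfolding \<eta>_def using x x0 s q(2) by (intro mult_mono power_mono) auto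
    then have \<xi>le: "\<xi> \<le> X\<^sup>2 / (6 * s) * \<eta>" unfolding \<xi>_def using s by (simp add: divide_right_mono)
    define M where "M = X\<^sup>2 / (6 * s) + 1"
    have M: "1 \<le> M" "4 * M \<le> K" using X2 K(2) by (auto simp: M_def)
    have "\<eta> * (4 * M * (1 + real n) * (1 + real m)) \<le> \<eta> * (K * (1 + real n) * (1 + real m))"
      using M \<eta> by (intro mult_left_mono mult_right_mono) auto
    then have \<eta>M: "\<eta> * (M * ((1 + real n) * (1 + real m))) \<le> \<delta> / 4" using ql by (simp add: \<eta>_def mult_ac)
    have nm: "1 \<le> (1 + real n) * (1 + real m)" "real n \<le> (1 + real n) * (1 + real m)"
      "real (n * m) \<le> (1 + real n) * (1 + real m)"
      by (auto simp: algebra_simps)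
    have xi1: "\<xi> \<le> 1"
    proof -
      have "\<xi> \<le> (M - 1) * \<eta>" using \<xi>le by (simp add: M_def)
      also have "\<dots> \<le> M * \<eta>" using \<eta> by (intro mult_right_mono) auto
      also have "\<dots> \<le> \<eta> * (M * ((1 + real n) * (1 + real m)))"
        using mult_left_mono[OF nm(1), of "\<eta> * M"] \<eta> M by (simp add: mult_ac)
      finally show ?thesis using \<eta>M \<delta> by linarith
    qed
    have small: "real n * \<xi> + real (n * m) * \<eta> \<le> \<delta> / 4"
    proof -
      let ?W = "(1 + real n) * (1 + real m)"
      have "real n * \<xi> \<le> ?W * ((M - 1) * \<eta>)"
        using \<xi>le \<xi>0 nm(2) by (intro mult_mono) (auto simp: M_def)
      moreover have "real (n * m) * \<eta> \<le> ?W * \<eta>" using nm(3) \<eta> by (intro mult_right_mono) auto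
      ultimately have "real n * \<xi> + real (n * m) * \<eta> \<le> ?W * ((M - 1) * \<eta>) + ?W * \<eta>" by linarith
      also have "\<dots> = \<eta> * (M * ?W)" by (simp add: algebra_simps)
      finally show ?thesis using \<eta>M by linarith
    qed
    note pb = product_bounds[OF \<xi>0 xi1 \<eta> small \<delta>(1,2)]
    have x1: "1 < x" using x x0 by linarith
    note an = estimate_near[OF \<Omega> c p x1 x(2) s(1,2) less_imp_le[OF \<theta>(1)] \<theta>(2) s(3) kx[OF x(1)] \<eta> \<eta>' \<xi>_def xi1,
        folded A_def Z_def n_def m_def]
    have Z0: "0 \<le> Z" unfolding Z_def by (rule partition_function_nonneg[OF \<Omega>])
    have "(1 - \<delta> / 4) * Z \<le> A" using mult_right_mono[OF pb(1) Z0] an(1) by linarith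
    moreover have "A \<le> (1 + \<delta> / 2) * Z" using mult_right_mono[OF pb(2) Z0] an(2) by linarith
    \<comment> \<open>The margins are strictly smaller than \<open>\<epsilon>\<close>, which yields
      strict inequalities. For \<open>Z = 0\<close> the two weak bounds force
      \<open>A = 0\<close>.\<close>
    moreover have "(1 - \<epsilon>) * Z < (1 - \<delta> / 4) * Z" "(1 + \<delta> / 2) * Z < (1 + \<epsilon>) * Z" if "Z \<noteq> 0"
      using that Z0 \<delta> \<epsilon> by (auto intro!: mult_strict_right_mono)
    ultimately have rel: "rel_approx \<epsilon> Z A" unfolding rel_approx_def by fastforce
    obtain t where t: "result (prog c q K) 0 (Node (Num \<epsilon>) (enc_sym \<Omega>)) = Some (Num A, t)" "t \<le> 10000 * S ^ 3 * 4 ^ l"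
      using l(1) by (auto simp: computes_def A_def x_def)
    have runs: "runs (prog c q K) (Node (Num \<epsilon>) (enc_sym \<Omega>)) (Num A) t"
      using result_SomeD[OF t(1)] by (simp add: runs_def prog_def)
    define Y where "Y = real S + 1 / \<epsilon>"
    have S: "n + 1 \<le> S" "m + 1 \<le> S"
      using length_less_vsize[of "vert_list \<Omega>" "enc_list Num"] length_less_vsize[of "edge_list \<Omega>" enc_edge]
      by (auto simp: S_def enc_sym_eq n_def m_def)
    have Y: "1 \<le> Y" "real S \<le> Y" "1 / \<delta> \<le> Y" "1 + real n \<le> Y" "1 + real m \<le> Y"
      using S \<epsilon> by (auto simp: Y_def \<delta>_def add_increasing2 add_increasing)
    \<comment> \<open>Both size factors and \<open>1 / \<delta>\<close> are at most
      \<open>Y\<close>, whence the exponent \<open>3 * k\<close>; the other 3 comes from the cost of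
      the program.\<close>
    have "\<sigma> = K * (1 + real n) * (1 + real m) * (1 / \<delta>)" by (simp add: \<sigma>_def)
    also have "\<dots> \<le> K * Y * Y * Y" using Y K1 \<delta> by (intro mult_mono) auto
    finally have \<sigma>Y: "\<sigma> \<le> K * Y ^ 3" by (simp add: power3_eq_cube mult_ac)
    have \<sigma>_nonneg: "0 \<le> \<sigma>" using \<sigma>0 \<delta> by (simp add: \<sigma>_def)
    have "1 + \<sigma> / q \<le> (1 + K / q) * Y ^ 3"
    proof -
      have "\<sigma> / q \<le> K * Y ^ 3 / q" using \<sigma>Y q0 by (simp add: divide_right_mono)
      moreover have "1 \<le> Y ^ 3" using Y by simp
      ultimately show ?thesis by (simp add: algebra_simps)
    qed
    then have "(1 + \<sigma> / q) ^ k \<le> ((1 + K / q) * Y ^ 3) ^ k"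
      using \<sigma>_nonneg q0 by (intro power_mono) auto
    then have 4: "4 ^ l \<le> (1 + K / q) ^ k * Y ^ (3 * k)"
      unfolding power_mult_distrib power_mult
      by (rule order_trans[OF depth_cost[OF q0 q(3) less_imp_le[OF k] l(3) \<sigma>_nonneg]])
    have "real t \<le> real (10000 * S ^ 3 * 4 ^ l)" using t(2) by (simp only: of_nat_le_iff)
    then have "real t \<le> 10000 * real S ^ 3 * 4 ^ l" by simp
    also have "\<dots> \<le> 10000 * Y ^ 3 * ((1 + K / q) ^ k * Y ^ (3 * k))"
      using 4 Y by (intro mult_mono power_mono) auto
    also have "\<dots> = C * Y ^ (3 + 3 * k)" by (simp only: C_def power_add mult_ac)
    finally show ?thesis
      by (intro exI[of _ A] exI[of _ t] conjI runs rel[unfolded Z_def]) (simp only: Y_def S_def)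
  qed
  have "(\<Union>e\<in>set (prog c q K). lits e) \<subseteq> \<rat> \<union> {c, p}"
    unfolding lits_prog using q(1) K(1) by auto
  then have "has_fptas {c, p} (Holant (fib_ge c p) (edge_weights (1 - \<theta>) (1 + \<theta>))) enc_sym partition_function"
    unfolding has_fptas_def
    by (intro exI[of _ "prog c q K"] exI[of _ C] exI[of _ "3 + 3 * k"] conjI ballI allI impI fptas)
  then show ?thesis using \<theta>(1) by (intro exI[of _ "1 - \<theta>"] exI[of _ "1 + \<theta>"]) auto
qed

end
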